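(* Let $\mathbb{K}=\mathbb{R}$ or $\mathbb{C}$, let $n\geqslant 2$, and consider a completely integrable system of partial differential equations in $n$ independent variables $x=(x^1,\dots,x^n)\in\mathbb{K}^n$ and one dependent variable $y\in\mathbb{K}$ of the form $$y_{x^{j_1}x^{j_2}}(x)=F^{j_1,j_2}\big(x,y(x),y_{x^1}(x),\dots,y_{x^n}(x)\big),\qquad 1\leqslant j_1,j_2\leqslant n,$$ where $F^{j_1,j_2}=F^{j_2,j_1}$ are local $\mathbb{K}$-analytic functions. Then this system is equivalent, under a local ($\mathbb{K}$-analytic, invertible) change of coordinates $(x,y)\mapsto (X,Y)=(X(x,y),Y(x,y))$, to the flat system $$Y_{X^{j_1}X^{j_2}}=0,\qquad 1\leqslant j_1,j_2\leqslant n,$$ if and only if there exist functions $G_{j_1,j_2}$, $H_{j_1,j_2}^{k_1}$, $L_{j_1}^{k_1}$ and $M^{k_1}$ of the variables $(x,y)$, for $1\leqslant j_1,j_2,k_1\leqslant n$, satisfying the symmetry conditions $G_{j_1,j_2}=G_{j_2,j_1}$ and $H_{j_1,j_2}^{k_1}=H_{j_2,j_1}^{k_1}$, such that the system is of the specific cubic polynomial form $$y_{x^{j_1}x^{j_2}}=G_{j_1,j_2}+\sum_{k_1=1}^n y_{x^{k_1}}\Big(H_{j_1,j_2}^{k_1}+\tfrac12\,y_{x^{j_1}}L_{j_2}^{k_1}+\tfrac12\,y_{x^{j_2}}L_{j_1}^{k_1}+y_{x^{j_1}}y_{x^{j_2}}M^{k_1}\Big)$$ for $j_1,j_2=1,\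dots,n$.
   Context: The system is called completely integrable if $$D_{j_3}\big(F^{j_1,j_2}\big)=D_{j_2}\big(F^{j_1,j_3}\big)\qquad\text{for all } j_1,j_2,j_3=1,\dots,n,$$ where, for $j=1,\dots,n$, the total differentiation operator $D_j$ acts on functions of $(x,y,y_{x^1},\dots,y_{x^n})$ by $$D_j:=\frac{\partial}{\partial x^j}+y_{x^j}\frac{\partial}{\partial y}+\sum_{l=1}^n F^{j,l}\frac{\partial}{\partial y_{x^l}}.$$ Everything is local (functions defined near a base point). Two systems are equivalent under a local change of coordinates if that diffeomorphism transforms one system into the other, i.e. maps (local) graphs of solutions of the first to graphs of solutions of the second. *)

theory Defs
  imports "HOL-Analysis.Analysis"
begin

text \<open>
  Everything is stated for a scalar field \<open>'k :: real_normed_field\<close>, to be instantiated with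
  \<open>real\<close> and \<open>complex\<close>; the number \<open>n\<close> of independent variables is \<open>CARD('n)\<close>.
  A point is \<open>(x, y)\<close>; a first-order jet is \<open>(x, y, p)\<close>, where \<open>p $ j\<close> stands for the
  coordinate \<open>y_{x^j}\<close>.
\<close>

type_synonym ('k, 'n) point = "('k, 'n) vec \<times> 'k"
type_synonym ('k, 'n) jet = "('k, 'n) vec \<times> 'k \<times> ('k, 'n) vec"
type_synonym ('k, 'n) system = "'n \<Rightarrow> 'n \<Rightarrow> ('k, 'n) jet \<Rightarrow> 'k"

fun point_coord :: "'n option \<Rightarrow> ('k, 'n::finite) point \<Rightarrow> 'k" where
  "point_coord (Some j) (x, y) = x $ j"
| "point_coord None (x, y) = y"

fun jet_coord :: "'n option + 'n \<Rightarrow> ('k, 'n::finite) jet \<Rightarrow> 'k" where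
  "jet_coord (Inl i) (x, y, p) = point_coord i (x, y)"
| "jet_coord (Inr j) (x, y, p) = p $ j"

text \<open>
  \<open>'k\<close>-analyticity of a function of several variables: near \<open>a\<close> it is the sum of a power series
  in the coordinates \<open>crd i v - crd i a\<close>, indexed by multi-indices \<open>\<alpha> :: 'i \<Rightarrow> nat\<close>.
\<close>

definition K_analytic_at ::
  "('i::finite \<Rightarrow> 'v::topological_space \<Rightarrow> 'k::real_normed_field) \<Rightarrow> ('v \<Rightarrow> 'k) \<Rightarrow> 'v \<Rightarrow> bool" where
  "K_analytic_at crd f a \<longleftrightarrow>
     (\<exists>c :: ('i \<Rightarrow> nat) \<Rightarrow> 'k. \<forall>\<^sub>F v in nhds a.
        ((\<lambda>\<alpha>. c \<alpha> * (\<Prod>i\<in>UNIV. (crd i v - crd i a) ^ \<alpha> i)) has_sum f v) UNIV)"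

definition analytic_on_points ::
  "(('k::real_normed_field, 'n::finite) point \<Rightarrow> 'k) \<Rightarrow> ('k, 'n) point set \<Rightarrow> bool" where
  "analytic_on_points f W \<longleftrightarrow> (\<forall>a\<in>W. K_analytic_at point_coord f a)"

definition analytic_on_jets ::
  "(('k::real_normed_field, 'n::finite) jet \<Rightarrow> 'k) \<Rightarrow> ('k, 'n) jet set \<Rightarrow> bool" where
  "analytic_on_jets f N \<longleftrightarrow> (\<forall>a\<in>N. K_analytic_at jet_coord f a)"

definition partial_x ::
  "'n \<Rightarrow> (('k::real_normed_field, 'n::finite) jet \<Rightarrow> 'k) \<Rightarrow> ('k, 'n) jet \<Rightarrow> 'k" where
  "partial_x j f = (\<lambda>(x, y, p). deriv (\<lambda>t. f (x + axis j t, y, p)) 0)"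

definition partial_y ::
  "(('k::real_normed_field, 'n::finite) jet \<Rightarrow> 'k) \<Rightarrow> ('k, 'n) jet \<Rightarrow> 'k" where
  "partial_y f = (\<lambda>(x, y, p). deriv (\<lambda>t. f (x, y + t, p)) 0)"

definition partial_p ::
  "'n \<Rightarrow> (('k::real_normed_field, 'n::finite) jet \<Rightarrow> 'k) \<Rightarrow> ('k, 'n) jet \<Rightarrow> 'k" where
  "partial_p l f = (\<lambda>(x, y, p). deriv (\<lambda>t. f (x, y, p + axis l t)) 0)"

definition total_diff ::
  "('k::real_normed_field, 'n::finite) system \<Rightarrow> 'n \<Rightarrow> (('k, 'n) jet \<Rightarrow> 'k) \<Rightarrow> ('k, 'n) jet \<Rightarrow> 'k" where
  "total_diff F j f = (\<lambda>(x, y, p).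
     partial_x j f (x, y, p) + p $ j * partial_y f (x, y, p)
     + (\<Sum>l\<in>UNIV. F j l (x, y, p) * partial_p l f (x, y, p)))"

definition completely_integrable ::
  "('k::real_normed_field, 'n::finite) system \<Rightarrow> ('k, 'n) jet set \<Rightarrow> bool" where
  "completely_integrable F \<Omega> \<longleftrightarrow>
     (\<forall>s\<in>\<Omega>. \<forall>j1 j2 j3. total_diff F j3 (F j1 j2) s = total_diff F j2 (F j1 j3) s)"

definition analytic_system ::
  "('k::real_normed_field, 'n::finite) system \<Rightarrow> ('k, 'n) jet set \<Rightarrow> bool" where
  "analytic_system F \<Omega> \<longleftrightarrow> open \<Omega> \<and>
     (\<forall>j1 j2. analytic_on_jets (F j1 j2) \<Omega> \<and> (\<forall>s\<in>\<Omega>. F j1 j2 s = F j2 j1 s))"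

text \<open>
  Solutions on the open set \<open>U\<close> whose first-order jets stay in \<open>N\<close>: \<open>p x\<close> is the gradient of \<open>y\<close>
  at \<open>x\<close>, and the partial derivatives of its components are prescribed by \<open>F\<close>. The derivatives
  are given by \<open>'k\<close>-linear maps, so that over \<open>complex\<close> this is complex differentiability.
\<close>

definition solution ::
  "('k::real_normed_field, 'n::finite) system \<Rightarrow> ('k, 'n) jet set
    \<Rightarrow> ('k, 'n) vec set \<Rightarrow> (('k, 'n) vec \<Rightarrow> 'k) \<Rightarrow> bool" where
  "solution F N U y \<longleftrightarrow> open U \<and>
     (\<exists>p. \<forall>x\<in>U. (x, y x, p x) \<in> N
        \<and> (y has_derivative (\<lambda>h. \<Sum>j\<in>UNIV. p x $ j * h $ j)) (at x)
        \<and> (\<forall>j1. ((\<lambda>z. p z $ j1) has_derivative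
                   (\<lambda>h. \<Sum>j2\<in>UNIV. F j1 j2 (x, y x, p x) * h $ j2)) (at x)))"

definition graph_on :: "('k, 'n::finite) vec set \<Rightarrow> (('k, 'n) vec \<Rightarrow> 'k) \<Rightarrow> ('k, 'n) point set" where
  "graph_on U y = (\<lambda>x. (x, y x)) ` U"

definition maps_solutions ::
  "(('k::real_normed_field, 'n::finite) point \<Rightarrow> ('k, 'n) point)
    \<Rightarrow> ('k, 'n) system \<Rightarrow> ('k, 'n) jet set \<Rightarrow> ('k, 'n) system \<Rightarrow> ('k, 'n) jet set \<Rightarrow> bool" where
  "maps_solutions \<phi> F N F' N' \<longleftrightarrow>
     (\<forall>U y. solution F N U y \<longrightarrow>
        (\<forall>x\<in>U. \<exists>U1 V Y. open U1 \<and> x \<in> U1 \<and> U1 \<subseteq> U \<and> solution F' N' V Y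
           \<and> \<phi> ` graph_on U1 y = graph_on V Y))"

definition analytic_diffeo ::
  "('k::real_normed_field, 'n::finite) point set \<Rightarrow> ('k, 'n) point set
    \<Rightarrow> (('k, 'n) point \<Rightarrow> ('k, 'n) point) \<Rightarrow> (('k, 'n) point \<Rightarrow> ('k, 'n) point) \<Rightarrow> bool" where
  "analytic_diffeo W W' \<phi> \<psi> \<longleftrightarrow> open W \<and> open W'
     \<and> (\<forall>v\<in>W. \<phi> v \<in> W' \<and> \<psi> (\<phi> v) = v) \<and> (\<forall>w\<in>W'. \<psi> w \<in> W \<and> \<phi> (\<psi> w) = w)
     \<and> (\<forall>i. analytic_on_points (\<lambda>v. point_coord i (\<phi> v)) W)
     \<and> (\<forall>i. analytic_on_points (\<lambda>w. point_coord i (\<psi> w)) W')"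

text \<open>
  Equivalence of the systems \<open>F\<close> (on \<open>\<Omega>\<close>) and \<open>F'\<close> (on \<open>\<Omega>'\<close>), local at the base jet \<open>s\<close>: a local
  diffeomorphism \<open>\<phi>\<close> of points, with inverse \<open>\<psi>\<close>, maps graphs of solutions of \<open>F\<close> with jets near \<open>s\<close>
  to graphs of solutions of \<open>F'\<close>, and conversely. A diffeomorphism of points acts on first-order
  jets only where images of graphs are again graphs, hence the open sets \<open>N\<close> and \<open>N'\<close> of jets.
  If the systems are completely integrable, there is a solution through every jet in \<open>N\<close> and in
  \<open>N'\<close>, so the two conditions force \<open>N'\<close> to be the image of \<open>N\<close> under the prolongation of \<open>\<phi>\<close>.
\<close>

definition locally_equivalent ::
  "('k::real_normed_field, 'n::finite) system \<Rightarrow> ('k, 'n) jet set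
    \<Rightarrow> ('k, 'n) system \<Rightarrow> ('k, 'n) jet set \<Rightarrow> ('k, 'n) jet \<Rightarrow> bool" where
  "locally_equivalent F \<Omega> F' \<Omega>' s \<longleftrightarrow>
     (\<exists>W W' \<phi> \<psi> N N'. analytic_diffeo W W' \<phi> \<psi>
        \<and> open N \<and> s \<in> N \<and> N \<subseteq> \<Omega> \<and> (\<forall>(x, y, p)\<in>N. (x, y) \<in> W)
        \<and> open N' \<and> N' \<subseteq> \<Omega>' \<and> (\<forall>(x, y, p)\<in>N'. (x, y) \<in> W')
        \<and> maps_solutions \<phi> F N F' N' \<and> maps_solutions \<psi> F' N' F N)"

definition flat_system :: "('k::real_normed_field, 'n::finite) system" where
  "flat_system = (\<lambda>j1 j2 s. 0)"

definition has_cubic_form ::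
  "('k::real_normed_field, 'n::finite) system \<Rightarrow> ('k, 'n) jet set \<Rightarrow> ('k, 'n) jet \<Rightarrow> bool" where
  "has_cubic_form F \<Omega> s \<longleftrightarrow>
     (\<exists>N W. open N \<and> s \<in> N \<and> N \<subseteq> \<Omega> \<and> open W \<and> (\<forall>(x, y, p)\<in>N. (x, y) \<in> W) \<and>
      (\<exists>(G :: 'n \<Rightarrow> 'n \<Rightarrow> ('k, 'n) point \<Rightarrow> 'k) (H :: 'n \<Rightarrow> 'n \<Rightarrow> 'n \<Rightarrow> ('k, 'n) point \<Rightarrow> 'k)
         (L :: 'n \<Rightarrow> 'n \<Rightarrow> ('k, 'n) point \<Rightarrow> 'k) (M :: 'n \<Rightarrow> ('k, 'n) point \<Rightarrow> 'k).
         (\<forall>j1 j2. analytic_on_points (G j1 j2) W)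
       \<and> (\<forall>j1 j2 k1. analytic_on_points (H j1 j2 k1) W)
       \<and> (\<forall>j1 k1. analytic_on_points (L j1 k1) W)
       \<and> (\<forall>k1. analytic_on_points (M k1) W)
       \<and> (\<forall>v\<in>W. \<forall>j1 j2. G j1 j2 v = G j2 j1 v)
       \<and> (\<forall>v\<in>W. \<forall>j1 j2 k1. H j1 j2 k1 v = H j2 j1 k1 v)
       \<and> (\<forall>(x, y, p)\<in>N. \<forall>j1 j2.
            F j1 j2 (x, y, p) = G j1 j2 (x, y)
              + (\<Sum>k1\<in>UNIV. p $ k1 *
                  (H j1 j2 k1 (x, y)
                   + 1/2 * p $ j1 * L j2 k1 (x, y)
                   + 1/2 * p $ j2 * L j1 k1 (x, y)
                   + p $ j1 * p $ j2 * M k1 (x, y))))))"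

end

theory Submission
  imports Defs
begin

text \<open>
  Write \<open>z = (x, y)\<close>, let \<open>\<xi> = dy - p dx\<close> be the covector of a jet and \<open>e\<^sub>j = \<partial>/\<partial>x\<^sup>j + p\<^sub>j \<partial>/\<partial>y\<close> the
  vectors spanning its kernel. The cubic systems are exactly the systems
  \<open>F\<^sub>i\<^sub>j = - \<xi>\<^sub>c \<Gamma>\<^sup>c\<^sub>a\<^sub>b e\<^sub>i\<^sup>a e\<^sub>j\<^sup>b\<close> with a symmetric connection \<open>\<Gamma>\<close> on the space of points: their solutions are
  the totally geodesic hypersurfaces, and only the projective class of \<open>\<Gamma>\<close> matters.

  If \<open>\<Phi>\<close> maps solutions to affine hyperplanes, differentiate \<open>\<beta> \<cdot> D\<Phi> \<cdot> e\<^sub>j = 0\<close> along a solution, with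
  \<open>\<beta>\<close> the constant conormal of the hyperplane. As there is a solution through every jet, \<open>F\<close> comes from
  the pullback of the flat connection.

  Conversely, choose \<open>\<Gamma>\<close> trace-free in its projective class. Complete integrability says that
  \<open>\<xi> R(e\<^sub>k, e\<^sub>j) e\<^sub>i = 0\<close> for \<open>p\<close> near the base value, hence for all \<open>p\<close>, because this is polynomial in \<open>p\<close>.
  So the curvature preserves all hyperplanes that contain its two arguments, which forces the Weyl
  tensor to vanish; in dimension \<open>n + 1 \<ge> 3\<close> the Bianchi identity then kills the Cotton tensor.
  Therefore the linear system \<open>\<nabla>\<^sub>b \<nabla>\<^sub>a u = - P\<^sub>a\<^sub>b u\<close> is in involution, and quotients \<open>u\<^sub>A / u\<^sub>0\<close> of its
  solutions are coordinates in which the geodesic hypersurfaces are hyperplanes.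

  The existence theorems (Frobenius, inverse functions) are proved for power series in the weighted
  \<open>l\<^sup>1\<close> norm on a polydisc, where integration along rays turns both into contractions.
\<close>

section \<open>Power series in several variables\<close>

text \<open>The real and the complex case are treated together, so no Cauchy formula is available
  and all estimates go through coefficients. The weighted \<open>l^1\<close> norm is
  submultiplicative, bounds the sup norm and is not increased by substitution or by integrals over
  rays, whereas differentiation costs radius. Hence a differential equation is iterated only in
  integrated form. Equivalence is a statement about graphs of solutions, not about transformed
  equations. To recover the equation at a jet one needs a solution through it, so Frobenius serves
  the passage to the cubic form as well as the construction of flat coordinates. Moreover the image
  of a graph is a graph only where the transported conormal has a nonzero \<open>dy\<close>
  component; this condition accompanies all changes of coordinates. The assumption n \<ge> 2
  supplies a third index in dimension n + 1. The Weyl argument compares components whose upper index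
  avoids two given ones, and the Cotton tensor appears in a Bianchi component with such an
  index.\<close>

class scalar_field = real_normed_field + euclidean_space

instance real :: scalar_field ..
instance complex :: scalar_field ..

section \<open>Unconditional sums and double series\<close>

lemma has_sum_sum:
  fixes f :: "'i \<Rightarrow> 'a \<Rightarrow> 'b::topological_comm_monoid_add"
  assumes "finite I" "\<And>i. i \<in> I \<Longrightarrow> (f i has_sum s i) A"
  shows "((\<lambda>x. \<Sum>i\<in>I. f i x) has_sum (\<Sum>i\<in>I. s i)) A"
  using assms by (induction I rule: finite_induct) (auto intro: has_sum_add)

text \<open>Finite dimension over the reals is decisive: each real coordinate of a summable family
  is absolutely summable, and the norm is at most the sum of the absolute coordinates. This turns
  bare convergence of a power series into control of the \<open>l^1\<close> norm of its
  coefficients.\<close>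

lemma scalar_field_abs_summable:
  fixes f :: "'a \<Rightarrow> 'k::scalar_field"
  assumes "f summable_on A"
  shows "(\<lambda>x. norm (f x)) summable_on A"
proof -
  have "((\<lambda>x. \<Sum>b\<in>Basis. \<bar>f x \<bullet> b\<bar>) has_sum (\<Sum>b\<in>Basis. \<Sum>\<^sub>\<infinity>x\<in>A. \<bar>f x \<bullet> b\<bar>)) A"
  proof (rule has_sum_sum)
    fix b :: 'k
    have "(\<lambda>x. f x \<bullet> b) summable_on A"
      by (rule summable_on_bounded_linear[OF bounded_linear_inner_left assms])
    then have "(\<lambda>x. \<bar>f x \<bullet> b\<bar>) summable_on A"
      using summable_on_iff_abs_summable_on_real by fastforce
    then show "((\<lambda>x. \<bar>f x \<bullet> b\<bar>) has_sum (\<Sum>\<^sub>\<infinity>x\<in>A. \<bar>f x \<bullet> b\<bar>)) A"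
      by simp
  qed auto
  then have "(\<lambda>x. \<Sum>b\<in>Basis. \<bar>f x \<bullet> b\<bar>) summable_on A"
    by (rule has_sum_imp_summable)
  then show ?thesis
    by (rule summable_on_comparison_test) (auto intro: norm_le_l1)
qed

lemma double_series_nonneg:
  fixes M :: "'a \<Rightarrow> 'b \<Rightarrow> real"
  assumes nn: "\<And>j \<alpha>. j \<in> J \<Longrightarrow> \<alpha> \<in> K \<Longrightarrow> 0 \<le> M j \<alpha>"
    and row: "\<And>j. j \<in> J \<Longrightarrow> (M j has_sum N j) K" and N: "(N has_sum S) J"
  shows "((\<lambda>(j, \<alpha>). M j \<alpha>) has_sum S) (J \<times> K)"
proof -
  have "(\<lambda>(j, \<alpha>). M j \<alpha>) summable_on (J \<times> K)"
    by (rule summable_on_SigmaI[where g = N]) (use nn row N in \<open>auto intro: has_sum_imp_summable\<close>)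
  then show ?thesis
    by (intro has_sum_SigmaI[where g = N]) (use row N in auto)
qed

lemma has_sum_Times_swap:
  "((\<lambda>(j, \<alpha>). f j \<alpha>) has_sum S) (J \<times> K) \<longleftrightarrow> ((\<lambda>(\<alpha>, j). f j \<alpha>) has_sum S) (K \<times> J)"
  by (rule has_sum_reindex_bij_witness[where i = prod.swap and j = prod.swap]) auto

lemma has_sum_rows:
  fixes f :: "'a \<Rightarrow> 'b \<Rightarrow> 'k::banach"
  assumes f: "((\<lambda>(j, \<alpha>). f j \<alpha>) has_sum S) (J \<times> K)"
  shows "\<And>j. j \<in> J \<Longrightarrow> (f j has_sum (\<Sum>\<^sub>\<infinity>\<alpha>\<in>K. f j \<alpha>)) K"
    and "((\<lambda>j. \<Sum>\<^sub>\<infinity>\<alpha>\<in>K. f j \<alpha>) has_sum S) J"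
proof -
  show *: "(f j has_sum (\<Sum>\<^sub>\<infinity>\<alpha>\<in>K. f j \<alpha>)) K" if "j \<in> J" for j
  proof -
    have "(\<lambda>(j, \<alpha>). f j \<alpha>) summable_on (Pair j ` K)"
      by (rule summable_on_subset_banach[OF has_sum_imp_summable[OF f]]) (use that in auto)
    then have "((\<lambda>(j, \<alpha>). f j \<alpha>) \<circ> Pair j) summable_on K"
      by (subst (asm) summable_on_reindex) (auto simp: inj_on_def)
    then show ?thesis by (simp add: o_def)
  qed
  show "((\<lambda>j. \<Sum>\<^sub>\<infinity>\<alpha>\<in>K. f j \<alpha>) has_sum S) J"
    by (rule has_sum_SigmaD[OF f]) (use * in auto)
qed

lemma has_sum_cols:
  fixes f :: "'a \<Rightarrow> 'b \<Rightarrow> 'k::banach"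
  assumes f: "((\<lambda>(j, \<alpha>). f j \<alpha>) has_sum S) (J \<times> K)"
  shows "\<And>\<alpha>. \<alpha> \<in> K \<Longrightarrow> ((\<lambda>j. f j \<alpha>) has_sum (\<Sum>\<^sub>\<infinity>j\<in>J. f j \<alpha>)) J"
    and "((\<lambda>\<alpha>. \<Sum>\<^sub>\<infinity>j\<in>J. f j \<alpha>) has_sum S) K"
  using has_sum_rows[of "\<lambda>\<alpha> j. f j \<alpha>" K J S] f by (auto simp: has_sum_Times_swap[of f])

section \<open>The weighted \<open>l^1\<close> norm on a polydisc\<close>

definition deg :: "('i::finite \<Rightarrow> nat) \<Rightarrow> nat" where
  "deg \<alpha> = (\<Sum>i\<in>UNIV. \<alpha> i)"

definition mon :: "('i::finite \<Rightarrow> nat) \<Rightarrow> 'k::scalar_field ^ 'i \<Rightarrow> 'k" where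
  "mon \<alpha> h = (\<Prod>i\<in>UNIV. (h $ i) ^ \<alpha> i)"

definition pball :: "real \<Rightarrow> ('k::scalar_field ^ 'i::finite) set" where
  "pball r = {h. \<forall>i. norm (h $ i) \<le> r}"

text \<open>\<open>C\<close> is an upper bound for the norm \<open>S\<close> rather than the norm
  itself, so that estimates can be relaxed freely. The expansion is required on the closed polydisc,
  where the \<open>l^1\<close> bound guarantees convergence; outside it \<open>f\<close> is
  arbitrary.\<close>

definition has_ps :: "real \<Rightarrow> real \<Rightarrow> (('i::finite \<Rightarrow> nat) \<Rightarrow> 'k::scalar_field) \<Rightarrow> ('k ^ 'i \<Rightarrow> 'k) \<Rightarrow> bool" where
  "has_ps r C c f \<longleftrightarrow>
     (\<exists>S\<le>C. ((\<lambda>\<alpha>. norm (c \<alpha>) * r ^ deg \<alpha>) has_sum S) UNIV) \<and>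
     (\<forall>h\<in>pball r. ((\<lambda>\<alpha>. c \<alpha> * mon \<alpha> h) has_sum f h) UNIV)"

definition majorized :: "real \<Rightarrow> real \<Rightarrow> ('k::scalar_field ^ 'i::finite \<Rightarrow> 'k) \<Rightarrow> bool" where
  "majorized r C f \<longleftrightarrow> (\<exists>c. has_ps r C c f)"

lemma norm_mon_le: "h \<in> pball r \<Longrightarrow> norm (mon \<alpha> h) \<le> r ^ deg \<alpha>"
  unfolding mon_def deg_def prod_norm[symmetric] power_sum norm_power
  by (rule prod_mono) (auto simp: pball_def intro!: power_mono)

lemma pballD: "h \<in> pball r \<Longrightarrow> norm (h $ i) \<le> r"
  by (auto simp: pball_def)

lemma pball_mono: "r \<le> s \<Longrightarrow> h \<in> pball r \<Longrightarrow> h \<in> pball s"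
  by (auto simp: pball_def intro: order_trans)

lemma zero_in_pball [simp]: "0 \<le> r \<Longrightarrow> 0 \<in> pball r"
  by (auto simp: pball_def)

lemma norm_le_pball: "norm h \<le> r \<Longrightarrow> h \<in> pball r"
  using order_trans[OF Finite_Cartesian_Product.norm_nth_le] by (auto simp: pball_def)

lemma eventually_pball: "0 < r \<Longrightarrow> \<forall>\<^sub>F h in nhds 0. h \<in> pball r"
  by (rule eventually_mono[OF eventually_nhds_ball[of r]]) (auto intro: norm_le_pball)

lemma has_ps_bound:
  assumes "has_ps r C c f" "h \<in> pball r"
  shows "norm (f h) \<le> C"
proof -
  obtain S where S: "S \<le> C" "((\<lambda>\<alpha>. norm (c \<alpha>) * r ^ deg \<alpha>) has_sum S) UNIV"
    and f: "((\<lambda>\<alpha>. c \<alpha> * mon \<alpha> h) has_sum f h) UNIV"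
    using assms by (auto simp: has_ps_def)
  have "norm (f h) \<le> S"
    by (rule norm_infsum_le[OF f S(2)])
      (auto simp: norm_mult intro!: mult_left_mono norm_mon_le assms)
  with S(1) show ?thesis by simp
qed

lemma majorized_bound: "majorized r C f \<Longrightarrow> h \<in> pball r \<Longrightarrow> norm (f h) \<le> C"
  by (auto simp: majorized_def intro: has_ps_bound)

lemma majorized_nonneg: "majorized r C f \<Longrightarrow> 0 \<le> r \<Longrightarrow> 0 \<le> C"
  using majorized_bound[of r C f 0] norm_ge_zero order_trans by (metis zero_in_pball)

lemma has_ps_cong:
  "has_ps r C c f \<Longrightarrow> C \<le> C' \<Longrightarrow> (\<And>h. h \<in> pball r \<Longrightarrow> f h = g h) \<Longrightarrow> has_ps r C' c g"
  unfolding has_ps_def by (auto intro: order_trans)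

lemma majorized_cong:
  "majorized r C f \<Longrightarrow> C \<le> C' \<Longrightarrow> (\<And>h. h \<in> pball r \<Longrightarrow> f h = g h) \<Longrightarrow> majorized r C' g"
  unfolding majorized_def by (blast intro: has_ps_cong)

lemma has_ps_shrink:
  assumes f: "has_ps r C c f" and s: "0 \<le> s" "s \<le> r"
  shows "has_ps s C c f"
proof -
  obtain S where S: "S \<le> C" "((\<lambda>\<alpha>. norm (c \<alpha>) * r ^ deg \<alpha>) has_sum S) UNIV"
    using f by (auto simp: has_ps_def)
  have le: "norm (c \<alpha>) * s ^ deg \<alpha> \<le> norm (c \<alpha>) * r ^ deg \<alpha>" for \<alpha>
    using s by (intro mult_left_mono power_mono) auto
  have "(\<lambda>\<alpha>. norm (c \<alpha>) * s ^ deg \<alpha>) summable_on UNIV"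
    by (rule summable_on_comparison_test[OF has_sum_imp_summable[OF S(2)]]) (use le s in auto)
  then obtain S' where S': "((\<lambda>\<alpha>. norm (c \<alpha>) * s ^ deg \<alpha>) has_sum S') UNIV"
    by (auto simp: summable_on_def)
  have "S' \<le> S"
    by (rule has_sum_mono[OF S' S(2)]) (use le in auto)
  with S' S(1) f s show ?thesis
    unfolding has_ps_def using order_trans[OF \<open>S' \<le> S\<close> S(1)] by (blast intro: pball_mono)
qed

lemma majorized_shrink: "majorized r C f \<Longrightarrow> 0 \<le> s \<Longrightarrow> s \<le> r \<Longrightarrow> majorized s C f"
  unfolding majorized_def by (blast intro: has_ps_shrink)

lemma has_ps_single:
  assumes "0 \<le> r"
  shows "has_ps r (norm k * r ^ deg \<beta>) (\<lambda>\<alpha>. if \<alpha> = \<beta> then k else 0) (\<lambda>h. k * mon \<beta> h)"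
  unfolding has_ps_def
proof (intro conjI exI ballI)
  show "((\<lambda>\<alpha>. norm (if \<alpha> = \<beta> then k else 0) * r ^ deg \<alpha>) has_sum (norm k * r ^ deg \<beta>)) UNIV"
    by (rule has_sum_finite_neutralI[where B = "{\<beta>}"]) auto
  show "((\<lambda>\<alpha>. (if \<alpha> = \<beta> then k else 0) * mon \<alpha> h) has_sum (k * mon \<beta> h)) UNIV" for h
    by (rule has_sum_finite_neutralI[where B = "{\<beta>}"]) auto
qed auto

lemma deg_zero [simp]: "deg (\<lambda>_. 0) = 0" and mon_zero [simp]: "mon (\<lambda>_. 0) h = 1"
  by (auto simp: deg_def mon_def)

definition unit_ix :: "'i \<Rightarrow> 'i \<Rightarrow> nat" where
  "unit_ix i = (\<lambda>j. if j = i then 1 else 0)"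

lemma deg_unit_ix [simp]: "deg (unit_ix i) = 1" and mon_unit_ix [simp]: "mon (unit_ix i) h = h $ i"
  by (auto simp: deg_def mon_def unit_ix_def if_distrib[where f = "\<lambda>n. _ ^ n"] cong: if_cong)

lemma majorized_const: "0 \<le> r \<Longrightarrow> majorized r (norm k) (\<lambda>_. k)"
  using has_ps_single[of r k "\<lambda>_. 0"] by (auto simp: majorized_def)

lemma majorized_coord: "0 \<le> r \<Longrightarrow> majorized r r (\<lambda>h. h $ i)"
  using has_ps_single[of r 1 "unit_ix i"] by (auto simp: majorized_def)

text \<open>Completeness of the space of such series. All the terms
  \<open>c j \<alpha> * mon \<alpha> h\<close> form one absolutely summable double family, dominated
  by \<open>M\<close>. Summing by rows gives the series of functions, summing by columns gives the
  power series with coefficients \<open>c'\<close>.\<close>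

lemma majorized_infsum:
  fixes f :: "'j \<Rightarrow> 'k::scalar_field ^ 'i::finite \<Rightarrow> 'k"
  assumes f: "\<And>j. j \<in> J \<Longrightarrow> majorized r (C j) (f j)" and C: "(C has_sum D) J" and r: "0 < r"
  shows "majorized r D (\<lambda>h. \<Sum>\<^sub>\<infinity>j\<in>J. f j h)"
    and "h \<in> pball r \<Longrightarrow> ((\<lambda>j. f j h) has_sum (\<Sum>\<^sub>\<infinity>j\<in>J. f j h)) J"
proof -
  obtain c where c: "has_ps r (C j) (c j) (f j)" if "j \<in> J" for j
    using f unfolding majorized_def by metis
  then obtain N where N: "j \<in> J \<Longrightarrow> N j \<le> C j" 
    "j \<in> J \<Longrightarrow> ((\<lambda>\<alpha>. norm (c j \<alpha>) * r ^ deg \<alpha>) has_sum N j) UNIV" for j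
    unfolding has_ps_def by metis
  have ps: "j \<in> J \<Longrightarrow> h \<in> pball r \<Longrightarrow> ((\<lambda>\<alpha>. c j \<alpha> * mon \<alpha> h) has_sum f j h) UNIV" for j h
    using c unfolding has_ps_def by blast
  have N0: "j \<in> J \<Longrightarrow> 0 \<le> N j" for j
    by (rule has_sum_nonneg[OF N(2)]) (use r in auto)
  have "N summable_on J"
    by (rule summable_on_comparison_test[OF has_sum_imp_summable[OF C]]) (use N0 N in auto)
  then obtain S where S: "(N has_sum S) J" by (auto simp: summable_on_def)
  have SD: "S \<le> D" by (rule has_sum_mono[OF S C]) (use N in auto)
  define M where "M = (\<lambda>j \<alpha>. norm (c j \<alpha>) * r ^ deg \<alpha>)"
  have M0: "0 \<le> M j \<alpha>" for j \<alpha> using r by (auto simp: M_def)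
  have M: "((\<lambda>(j, \<alpha>). M j \<alpha>) has_sum S) (J \<times> UNIV)"
    by (rule double_series_nonneg[OF _ _ S]) (use N(2) r in \<open>auto simp: M_def\<close>)
  note Mcol = has_sum_cols[OF M]
  define c' where "c' = (\<lambda>\<alpha>. \<Sum>\<^sub>\<infinity>j\<in>J. c j \<alpha>)"
  have c': "((\<lambda>j. c j \<alpha>) has_sum c' \<alpha>) J" and c'_le: "norm (c' \<alpha>) * r ^ deg \<alpha> \<le> (\<Sum>\<^sub>\<infinity>j\<in>J. M j \<alpha>)" for \<alpha>
  proof -
    have "(\<lambda>j. M j \<alpha> * inverse (r ^ deg \<alpha>)) summable_on J"
      by (rule summable_on_cmult_left[OF has_sum_imp_summable[OF Mcol(1)]]) auto
    then have "(\<lambda>j. norm (c j \<alpha>)) summable_on J"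
      using r by (simp add: M_def field_simps)
    then have s: "(\<lambda>j. c j \<alpha>) summable_on J" by (rule abs_summable_summable)
    then show 1: "((\<lambda>j. c j \<alpha>) has_sum c' \<alpha>) J" by (simp add: c'_def)
    have "((\<lambda>j. c j \<alpha> * of_real (r ^ deg \<alpha>)) has_sum c' \<alpha> * of_real (r ^ deg \<alpha>)) J"
      by (rule has_sum_cmult_left[OF 1])
    from norm_infsum_le[OF this Mcol(1)] r
    show "norm (c' \<alpha>) * r ^ deg \<alpha> \<le> (\<Sum>\<^sub>\<infinity>j\<in>J. M j \<alpha>)"
      by (simp add: M_def norm_mult norm_power)
  qed
  have "(\<lambda>\<alpha>. norm (c' \<alpha>) * r ^ deg \<alpha>) summable_on UNIV"
    by (rule summable_on_comparison_test[OF has_sum_imp_summable[OF Mcol(2)]]) (use c'_le r in auto)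
  then obtain S' where S': "((\<lambda>\<alpha>. norm (c' \<alpha>) * r ^ deg \<alpha>) has_sum S') UNIV"
    by (auto simp: summable_on_def)
  have "S' \<le> S" by (rule has_sum_mono[OF S' Mcol(2)]) (use c'_le in auto)
  have *: "((\<lambda>j. f j h) has_sum (\<Sum>\<^sub>\<infinity>j\<in>J. f j h)) J \<and> 
      ((\<lambda>\<alpha>. c' \<alpha> * mon \<alpha> h) has_sum (\<Sum>\<^sub>\<infinity>j\<in>J. f j h)) UNIV" if h: "h \<in> pball r" for h
  proof -
    have "(\<lambda>(j, \<alpha>). norm (c j \<alpha> * mon \<alpha> h)) summable_on (J \<times> UNIV)"
      by (rule summable_on_comparison_test[OF has_sum_imp_summable[OF M]])
        (auto simp: M_def norm_mult intro!: mult_left_mono norm_mon_le h)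
    then have "(\<lambda>x. norm ((\<lambda>(j, \<alpha>). c j \<alpha> * mon \<alpha> h) x)) summable_on (J \<times> UNIV)"
      by (simp add: case_prod_unfold)
    then obtain T where T: "((\<lambda>(j, \<alpha>). c j \<alpha> * mon \<alpha> h) has_sum T) (J \<times> UNIV)"
      using abs_summable_summable by (auto simp: summable_on_def)
    have row: "(\<Sum>\<^sub>\<infinity>\<alpha>. c j \<alpha> * mon \<alpha> h) = f j h" if "j \<in> J" for j
      using ps[OF that h] by (rule infsumI)
    have 1: "((\<lambda>j. f j h) has_sum T) J"
      using has_sum_rows(2)[OF T] row by (simp cong: has_sum_cong)
    have col: "(\<Sum>\<^sub>\<infinity>j\<in>J. c j \<alpha> * mon \<alpha> h) = c' \<alpha> * mon \<alpha> h" for \<alpha>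
      by (rule infsumI[OF has_sum_cmult_left[OF c']])
    have 2: "((\<lambda>\<alpha>. c' \<alpha> * mon \<alpha> h) has_sum T) UNIV"
      using has_sum_cols(2)[OF T] col by simp
    show ?thesis using 1 2 infsumI[OF 1] by simp
  qed
  then show "h \<in> pball r \<Longrightarrow> ((\<lambda>j. f j h) has_sum (\<Sum>\<^sub>\<infinity>j\<in>J. f j h)) J" by blast
  have "has_ps r D c' (\<lambda>h. \<Sum>\<^sub>\<infinity>j\<in>J. f j h)"
    unfolding has_ps_def using S' order_trans[OF \<open>S' \<le> S\<close> SD] * by blast
  then show "majorized r D (\<lambda>h. \<Sum>\<^sub>\<infinity>j\<in>J. f j h)" unfolding majorized_def by blast
qed

lemma majorized_has_sum:
  fixes f :: "'j \<Rightarrow> 'k::scalar_field ^ 'i::finite \<Rightarrow> 'k"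
  assumes "\<And>j. j \<in> J \<Longrightarrow> majorized r (C j) (f j)" "(C has_sum D) J" "0 < r"
    and F: "\<And>h. h \<in> pball r \<Longrightarrow> ((\<lambda>j. f j h) has_sum F h) J"
  shows "majorized r D F"
  by (rule majorized_cong[OF majorized_infsum(1)[OF assms(1-3)]]) (auto intro: infsumI F)

lemma majorized_sum:
  fixes f :: "'j \<Rightarrow> 'k::scalar_field ^ 'i::finite \<Rightarrow> 'k"
  assumes "finite J" "\<And>j. j \<in> J \<Longrightarrow> majorized r (C j) (f j)" "0 < r"
  shows "majorized r (\<Sum>j\<in>J. C j) (\<lambda>h. \<Sum>j\<in>J. f j h)"
  by (rule majorized_has_sum[OF assms(2) _ assms(3)]) (use assms in auto)

lemma majorized_add:
  assumes "majorized r C f" "majorized r D g" "0 < r"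
  shows "majorized r (C + D) (\<lambda>h. f h + g h)"
  using majorized_sum[of "UNIV :: bool set" r "\<lambda>b. if b then C else D" "\<lambda>b. if b then f else g"] assms
  by (simp add: UNIV_bool add.commute)

text \<open>Multiplication by a monomial merely shifts the indices by \<open>\<beta>\<close>. A
  general product is an infinite sum of such terms, which spares \<open>majorized_mult\<close> a
  Cauchy product over multi-indices.\<close>

lemma majorized_mon_mult:
  fixes g :: "'k::scalar_field ^ 'i::finite \<Rightarrow> 'k"
  assumes g: "majorized r D g" and r: "0 \<le> r"
  shows "majorized r (norm k * r ^ deg \<beta> * D) (\<lambda>h. k * mon \<beta> h * g h)"
proof -
  obtain c S where S: "S \<le> D" "((\<lambda>\<alpha>. norm (c \<alpha>) * r ^ deg \<alpha>) has_sum S) UNIV"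
    and ps: "h \<in> pball r \<Longrightarrow> ((\<lambda>\<alpha>. c \<alpha> * mon \<alpha> h) has_sum g h) UNIV" for h
    using g unfolding majorized_def has_ps_def by blast
  define s where "s = (\<lambda>\<alpha> i. \<alpha> i + \<beta> i :: nat)"
  define c' where "c' = (\<lambda>\<gamma>. if \<gamma> \<in> range s then k * c (\<lambda>i. \<gamma> i - \<beta> i) else 0)"
  have inj: "inj s" by (auto simp: s_def inj_on_def fun_eq_iff)
  have c's: "c' (s \<alpha>) = k * c \<alpha>" for \<alpha> by (auto simp: c'_def s_def)
  have degs: "deg (s \<alpha>) = deg \<beta> + deg \<alpha>" for \<alpha> by (simp add: s_def deg_def sum.distrib)
  have mons: "mon (s \<alpha>) h = mon \<beta> h * mon \<alpha> h" for \<alpha> h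
    by (simp add: s_def mon_def power_add prod.distrib mult.commute)
  have tr: "(F has_sum a) UNIV" if "((F \<circ> s) has_sum a) UNIV" "\<And>\<gamma>. \<gamma> \<notin> range s \<Longrightarrow> F \<gamma> = 0"
    for F :: "('i \<Rightarrow> nat) \<Rightarrow> 'z::{comm_monoid_add,topological_space}" and a
  proof -
    have "(F has_sum a) (range s)" using has_sum_reindex[OF inj] that(1) by blast
    then show ?thesis
      by (subst has_sum_cong_neutral[where T = "range s" and g = F]) (use that(2) in auto)
  qed
  have 1: "((\<lambda>\<gamma>. norm (c' \<gamma>) * r ^ deg \<gamma>) has_sum (norm k * r ^ deg \<beta> * S)) UNIV"
  proof (rule tr)
    show "((\<lambda>\<gamma>. norm (c' \<gamma>) * r ^ deg \<gamma>) \<circ> s has_sum norm k * r ^ deg \<beta> * S) UNIV"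
      using has_sum_cmult_right[OF S(2), of "norm k * r ^ deg \<beta>"]
      by (simp add: o_def c's degs norm_mult power_add mult_ac)
  qed (auto simp: c'_def)
  have 2: "((\<lambda>\<gamma>. c' \<gamma> * mon \<gamma> h) has_sum (k * mon \<beta> h * g h)) UNIV" if "h \<in> pball r" for h
  proof (rule tr)
    show "((\<lambda>\<gamma>. c' \<gamma> * mon \<gamma> h) \<circ> s has_sum k * mon \<beta> h * g h) UNIV"
      using has_sum_cmult_right[OF ps[OF that], of "k * mon \<beta> h"]
      by (simp add: o_def c's mons mult_ac)
  qed (auto simp: c'_def)
  have "norm k * r ^ deg \<beta> * S \<le> norm k * r ^ deg \<beta> * D"
    using r S by (intro mult_left_mono) auto
  then show ?thesis
    unfolding majorized_def has_ps_def using 1 2 by blast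
qed

lemma majorized_mult:
  fixes f g :: "'k::scalar_field ^ 'i::finite \<Rightarrow> 'k"
  assumes f: "majorized r C f" and g: "majorized r D g" and r: "0 < r"
  shows "majorized r (C * D) (\<lambda>h. f h * g h)"
proof -
  obtain c S where S: "S \<le> C" "((\<lambda>\<alpha>. norm (c \<alpha>) * r ^ deg \<alpha>) has_sum S) UNIV"
    and ps: "h \<in> pball r \<Longrightarrow> ((\<lambda>\<alpha>. c \<alpha> * mon \<alpha> h) has_sum f h) UNIV" for h
    using f unfolding majorized_def has_ps_def by blast
  have D: "0 \<le> D" using majorized_nonneg[OF g] r by simp
  have "majorized r (S * D) (\<lambda>h. f h * g h)"
  proof (rule majorized_has_sum[where f = "\<lambda>\<alpha> h. c \<alpha> * mon \<alpha> h * g h"])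
    show "majorized r (norm (c \<alpha>) * r ^ deg \<alpha> * D) (\<lambda>h. c \<alpha> * mon \<alpha> h * g h)" for \<alpha>
      by (rule majorized_mon_mult[OF g]) (use r in simp)
    show "((\<lambda>\<alpha>. norm (c \<alpha>) * r ^ deg \<alpha> * D) has_sum (S * D)) UNIV"
      by (rule has_sum_cmult_left[OF S(2)])
  qed (use r ps in \<open>auto intro!: has_sum_cmult_left\<close>)
  then show ?thesis
    by (rule majorized_cong) (use S D in \<open>auto intro: mult_right_mono\<close>)
qed

lemma majorized_cmult: "majorized r C f \<Longrightarrow> 0 < r \<Longrightarrow> majorized r (norm k * C) (\<lambda>h. k * f h)"
  by (rule majorized_mult[OF majorized_const]) auto

lemma majorized_power:
  "majorized r C f \<Longrightarrow> 0 < r \<Longrightarrow> majorized r (C ^ n) (\<lambda>h. f h ^ n)"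
  by (induction n) (use majorized_const[of r 1] in \<open>auto intro: majorized_mult\<close>)

lemma majorized_prod:
  assumes "finite I" "\<And>i. i \<in> I \<Longrightarrow> majorized r (C i) (f i)" "0 < r"
  shows "majorized r (\<Prod>i\<in>I. C i) (\<lambda>h. \<Prod>i\<in>I. f i h)"
  using assms(1,2)
  by (induction I rule: finite_induct) (use majorized_const[of r 1] assms(3) in \<open>auto intro: majorized_mult\<close>)

lemma majorized_mon_comp:
  fixes U :: "'j::finite \<Rightarrow> 'k::scalar_field ^ 'i::finite \<Rightarrow> 'k"
  assumes "\<And>j. majorized r \<rho> (U j)" "0 < r"
  shows "majorized r (\<rho> ^ deg \<beta>) (\<lambda>h. mon \<beta> (\<chi> j. U j h))"
  using majorized_prod[OF finite_class.finite_UNIV, where f = "\<lambda>j h. U j h ^ \<beta> j" and C = "\<lambda>j. \<rho> ^ \<beta> j" and r = r]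
    majorized_power[OF assms(1) assms(2)] assms(2)
  by (simp add: mon_def deg_def power_sum)

lemma majorized_pball:
  assumes "\<And>j. majorized r \<rho> (U j)" "h \<in> pball r"
  shows "(\<chi> j. U j h) \<in> pball \<rho>"
  using majorized_bound[OF assms(1) assms(2)] by (simp add: pball_def)

text \<open>Substituting functions of norm at most \<rho> makes the monomial of index \<alpha> a
  function of norm at most \<open>\<rho> ^ deg \<alpha>\<close>, which is exactly its weight in the
  norm of \<open>f\<close>. So composition loses nothing.\<close>

lemma majorized_compose:
  fixes U :: "'j::finite \<Rightarrow> 'k::scalar_field ^ 'i::finite \<Rightarrow> 'k"
  assumes f: "majorized \<rho> C f" and U: "\<And>j. majorized r \<rho> (U j)" and r: "0 < r"
  shows "majorized r C (\<lambda>h. f (\<chi> j. U j h))"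
proof -
  obtain c S where S: "S \<le> C" "((\<lambda>\<alpha>. norm (c \<alpha>) * \<rho> ^ deg \<alpha>) has_sum S) UNIV"
    and ps: "h \<in> pball \<rho> \<Longrightarrow> ((\<lambda>\<alpha>. c \<alpha> * mon \<alpha> h) has_sum f h) UNIV" for h
    using f unfolding majorized_def has_ps_def by blast
  have "majorized r S (\<lambda>h. f (\<chi> j. U j h))"
  proof (rule majorized_has_sum[OF _ S(2) r])
    show "majorized r (norm (c \<alpha>) * \<rho> ^ deg \<alpha>) (\<lambda>h. c \<alpha> * mon \<alpha> (\<chi> j. U j h))" for \<alpha>
      by (rule majorized_cmult[OF majorized_mon_comp[OF U r] r])
  qed (rule ps[OF majorized_pball[OF U]])
  then show ?thesis by (rule majorized_cong) (use S in auto)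
qed

text \<open>A mean value estimate for monomials. The three bounds collected in \<open>Q\<close> are
  stable under products because the difference of two products telescopes into
  \<open>(f - g) * f' + g * (f' - g')\<close>.\<close>

lemma majorized_mon_diff:
  fixes U V :: "'j::finite \<Rightarrow> 'k::scalar_field ^ 'i::finite \<Rightarrow> 'k"
  assumes U: "\<And>j. majorized r \<rho> (U j)" and V: "\<And>j. majorized r \<rho> (V j)"
    and d: "\<And>j. majorized r \<delta> (\<lambda>h. U j h - V j h)" and r: "0 < r"
  shows "majorized r (real (deg \<beta>) * \<rho> ^ (deg \<beta> - 1) * \<delta>)
           (\<lambda>h. mon \<beta> (\<chi> j. U j h) - mon \<beta> (\<chi> j. V j h))"
proof -
  define Q where "Q = (\<lambda>n (f :: 'k ^ 'i \<Rightarrow> 'k) g. majorized r (\<rho> ^ n) f \<and> majorized r (\<rho> ^ n) g \<and>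
     majorized r (real n * \<rho> ^ (n - 1) * \<delta>) (\<lambda>h. f h - g h))"
  have Q_mult: "Q (n + m) (\<lambda>h. f h * f' h) (\<lambda>h. g h * g' h)" if "Q n f g" "Q m f' g'" for n m f g f' g'
  proof -
    have "majorized r (real n * \<rho> ^ (n - 1) * \<delta> * \<rho> ^ m + \<rho> ^ n * (real m * \<rho> ^ (m - 1) * \<delta>))
        (\<lambda>h. (f h - g h) * f' h + g h * (f' h - g' h))"
      using that r unfolding Q_def by (intro majorized_add majorized_mult) auto
    moreover have "real n * \<rho> ^ (n - 1) * \<delta> * \<rho> ^ m + \<rho> ^ n * (real m * \<rho> ^ (m - 1) * \<delta>)
       = real (n + m) * \<rho> ^ (n + m - 1) * \<delta>"
      by (cases n; cases m) (auto simp: algebra_simps power_add)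
    ultimately have "majorized r (real (n + m) * \<rho> ^ (n + m - 1) * \<delta>) (\<lambda>h. f h * f' h - g h * g' h)"
      by (auto simp: algebra_simps elim!: majorized_cong)
    then show ?thesis
      using that r majorized_mult[of r "\<rho> ^ n" _ "\<rho> ^ m"] by (auto simp: Q_def power_add)
  qed
  have Q0: "Q 0 (\<lambda>_. 1) (\<lambda>_. 1)"
    using majorized_const[of r 1] majorized_const[of r 0] r by (auto simp: Q_def)
  have Q_pow: "Q n (\<lambda>h. U j h ^ n) (\<lambda>h. V j h ^ n)" for j n
  proof (induction n)
    case (Suc n)
    have "Q 1 (U j) (V j)" using U V d by (auto simp: Q_def)
    from Q_mult[OF this Suc] show ?case by simp
  qed (use Q0 in simp)
  have "Q (\<Sum>j\<in>J. \<beta> j) (\<lambda>h. \<Prod>j\<in>J. U j h ^ \<beta> j) (\<lambda>h. \<Prod>j\<in>J. V j h ^ \<beta> j)" if "finite J" for J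
    using that by (induction J rule: finite_induct) (use Q0 Q_mult[OF Q_pow] in auto)
  from this[OF finite_class.finite_UNIV] show ?thesis
    by (simp add: Q_def deg_def mon_def)
qed

text \<open>Differentiating a monomial of degree \<open>n\<close> costs a factor \<open>n\<close>,
  and halving the radius pays for it since \<open>n \<le> 2 ^ (n - 1)\<close>. This Lipschitz
  estimate is what makes the maps in \<open>analytic_inverse\<close> and \<open>ray_system\<close>
  contractions.\<close>

lemma majorized_compose_diff:
  fixes U V :: "'j::finite \<Rightarrow> 'k::scalar_field ^ 'i::finite \<Rightarrow> 'k"
  assumes f: "majorized \<rho>' C f" and \<rho>: "0 < \<rho>" "\<rho> \<le> \<rho>' / 2"
    and U: "\<And>j. majorized r \<rho> (U j)" and V: "\<And>j. majorized r \<rho> (V j)"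
    and d: "\<And>j. majorized r \<delta> (\<lambda>h. U j h - V j h)" and r: "0 < r"
  shows "majorized r (C / \<rho>' * \<delta>) (\<lambda>h. f (\<chi> j. U j h) - f (\<chi> j. V j h))"
proof -
  obtain c S where S: "S \<le> C" "((\<lambda>\<alpha>. norm (c \<alpha>) * \<rho>' ^ deg \<alpha>) has_sum S) UNIV"
    and ps: "h \<in> pball \<rho>' \<Longrightarrow> ((\<lambda>\<alpha>. c \<alpha> * mon \<alpha> h) has_sum f h) UNIV" for h
    using f unfolding majorized_def has_ps_def by blast
  have \<delta>: "0 \<le> \<delta>" using majorized_nonneg[OF d] r by simp
  have \<rho>': "0 < \<rho>'" using \<rho> by simp
  have bound: "real n * \<rho> ^ (n - 1) \<le> \<rho>' ^ n / \<rho>'" for n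
  proof (cases n)
    case (Suc m)
    have "real (Suc m) \<le> 2 ^ m" by (induction m) auto
    moreover have "\<rho> ^ m \<le> (\<rho>' / 2) ^ m" using \<rho> by (intro power_mono) auto
    ultimately have "real (Suc m) * \<rho> ^ m \<le> 2 ^ m * (\<rho>' / 2) ^ m"
      using \<rho> by (intro mult_mono) auto
    then show ?thesis using Suc \<rho>' by (simp add: power_divide)
  qed (use \<rho>' in auto)
  have "majorized r (S * (\<delta> / \<rho>')) (\<lambda>h. f (\<chi> j. U j h) - f (\<chi> j. V j h))"
  proof (rule majorized_has_sum[OF _ has_sum_cmult_left[OF S(2)] r])
    fix \<alpha>
    have "majorized r (norm (c \<alpha>) * (real (deg \<alpha>) * \<rho> ^ (deg \<alpha> - 1) * \<delta>))
       (\<lambda>h. c \<alpha> * (mon \<alpha> (\<chi> j. U j h) - mon \<alpha> (\<chi> j. V j h)))"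
      by (rule majorized_cmult[OF majorized_mon_diff[OF U V d r] r])
    moreover have "norm (c \<alpha>) * (real (deg \<alpha>) * \<rho> ^ (deg \<alpha> - 1) * \<delta>) \<le> norm (c \<alpha>) * (\<rho>' ^ deg \<alpha> / \<rho>' * \<delta>)"
      using \<delta> by (intro mult_left_mono mult_right_mono bound) auto
    ultimately show "majorized r (norm (c \<alpha>) * \<rho>' ^ deg \<alpha> * (\<delta> / \<rho>'))
       (\<lambda>h. c \<alpha> * (mon \<alpha> (\<chi> j. U j h) - mon \<alpha> (\<chi> j. V j h)))"
      by (auto elim!: majorized_cong)
  next
    fix h :: "'k ^ 'i" assume h: "h \<in> pball r"
    have "(\<chi> j. U j h) \<in> pball \<rho>'" "(\<chi> j. V j h) \<in> pball \<rho>'"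
      using majorized_pball[of r \<rho> U, OF U h] majorized_pball[of r \<rho> V, OF V h] pball_mono[of \<rho> \<rho>'] \<rho> \<rho>' by auto
    then have "((\<lambda>\<alpha>. c \<alpha> * mon \<alpha> (\<chi> j. U j h) + - (c \<alpha> * mon \<alpha> (\<chi> j. V j h))) has_sum
        f (\<chi> j. U j h) + - f (\<chi> j. V j h)) UNIV"
      by (intro has_sum_add has_sum_uminusI ps)
    then show "((\<lambda>\<alpha>. c \<alpha> * (mon \<alpha> (\<chi> j. U j h) - mon \<alpha> (\<chi> j. V j h))) has_sum
        f (\<chi> j. U j h) - f (\<chi> j. V j h)) UNIV"
      by (simp add: algebra_simps)
  qed
  moreover have "S * (\<delta> / \<rho>') \<le> C / \<rho>' * \<delta>"
    using S \<delta> \<rho>' by (auto simp: divide_simps intro: mult_right_mono)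
  ultimately show ?thesis by (auto elim!: majorized_cong)
qed

lemma mon_at_0: "mon \<alpha> 0 = (if deg \<alpha> = 0 then 1 else 0)"
  by (auto simp: mon_def deg_def)

lemma deg_eq_0: "deg \<alpha> = 0 \<longleftrightarrow> \<alpha> = (\<lambda>_. 0)"
  by (auto simp: deg_def)

lemma deg_eq_1: "deg \<alpha> = 1 \<longleftrightarrow> (\<exists>i. \<alpha> = unit_ix i)"
proof
  assume "deg \<alpha> = 1"
  then obtain i where "\<alpha> i = 1" "\<And>j. i \<noteq> j \<Longrightarrow> \<alpha> j = 0"
    unfolding deg_def by (metis UNIV_I finite_class.finite_UNIV sum_eq_1_iff)
  then have "\<alpha> = unit_ix i" by (auto simp: unit_ix_def fun_eq_iff)
  then show "\<exists>i. \<alpha> = unit_ix i" ..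
qed auto

text \<open>Each coefficient that survives has degree at least \<open>m\<close> and gains
  \<open>t ^ m\<close>. With \<open>m = 1\<close> functions that vanish at 0 become small; with
  \<open>m = 2\<close> nonlinear remainders get a Lipschitz constant proportional to
  \<open>t\<close>.\<close>

lemma has_ps_scale:
  assumes f: "has_ps r C c f" and t: "0 \<le> t" "t \<le> 1" and r: "0 \<le> r"
    and low: "\<And>\<alpha>. deg \<alpha> < m \<Longrightarrow> c \<alpha> = 0"
  shows "has_ps (t * r) (t ^ m * C) c f"
proof -
  obtain S where S: "S \<le> C" "((\<lambda>\<alpha>. norm (c \<alpha>) * r ^ deg \<alpha>) has_sum S) UNIV"
    and ps: "h \<in> pball r \<Longrightarrow> ((\<lambda>\<alpha>. c \<alpha> * mon \<alpha> h) has_sum f h) UNIV" for h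
    using f unfolding has_ps_def by blast
  have tS: "((\<lambda>\<alpha>. t ^ m * (norm (c \<alpha>) * r ^ deg \<alpha>)) has_sum t ^ m * S) UNIV"
    by (rule has_sum_cmult_right[OF S(2)])
  have le: "norm (c \<alpha>) * (t * r) ^ deg \<alpha> \<le> t ^ m * (norm (c \<alpha>) * r ^ deg \<alpha>)" for \<alpha>
  proof (cases "deg \<alpha> < m")
    case False
    then have "t ^ deg \<alpha> \<le> t ^ m" using t by (intro power_decreasing) auto
    then have "t ^ deg \<alpha> * (norm (c \<alpha>) * r ^ deg \<alpha>) \<le> t ^ m * (norm (c \<alpha>) * r ^ deg \<alpha>)"
      using r by (intro mult_right_mono) auto
    then show ?thesis by (simp add: power_mult_distrib mult_ac)
  qed (simp add: low)
  have "(\<lambda>\<alpha>. norm (c \<alpha>) * (t * r) ^ deg \<alpha>) summable_on UNIV"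
    by (rule summable_on_comparison_test[OF has_sum_imp_summable[OF tS]]) (use le t r in auto)
  then obtain S' where S': "((\<lambda>\<alpha>. norm (c \<alpha>) * (t * r) ^ deg \<alpha>) has_sum S') UNIV"
    by (auto simp: summable_on_def)
  have "S' \<le> t ^ m * S" by (rule has_sum_mono[OF S' tS]) (use le in auto)
  also have "\<dots> \<le> t ^ m * C" using S t by (intro mult_left_mono) auto
  finally have "S' \<le> t ^ m * C" .
  moreover have "h \<in> pball r" if "h \<in> pball (t * r)" for h :: "'b ^ 'a"
    by (rule pball_mono[OF _ that]) (use t r in \<open>simp add: mult_left_le_one_le\<close>)
  ultimately show ?thesis unfolding has_ps_def using S' ps by blast
qed

lemma has_ps_0:
  assumes "has_ps r C c f" "0 \<le> r"
  shows "c (\<lambda>_. 0) = f 0"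
proof -
  have "((\<lambda>\<alpha>. c \<alpha> * mon \<alpha> 0) has_sum f 0) UNIV"
    using assms by (auto simp: has_ps_def)
  moreover have "((\<lambda>\<alpha>. c \<alpha> * mon \<alpha> 0) has_sum c (\<lambda>_. 0)) UNIV"
    by (rule has_sum_finite_neutralI[where B = "{\<lambda>_. 0}"]) (auto simp: mon_at_0 deg_eq_0)
  ultimately show ?thesis by (metis has_sum_unique)
qed

lemma majorized_scale:
  assumes "majorized r C f" "f 0 = 0" "0 \<le> t" "t \<le> 1" "0 \<le> r"
  shows "majorized (t * r) (t * C) f"
proof -
  obtain c where c: "has_ps r C c f" using assms by (auto simp: majorized_def)
  have "has_ps (t * r) (t ^ 1 * C) c f"
    by (rule has_ps_scale[OF c assms(3,4,5)]) (use has_ps_0[OF c] assms in \<open>auto simp: deg_eq_0\<close>)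
  then show ?thesis by (auto simp: majorized_def)
qed

lemma has_ps_remove_linear:
  fixes f :: "'k::scalar_field ^ 'i::finite \<Rightarrow> 'k"
  assumes f: "has_ps r C c f" and r: "0 \<le> r"
  shows "has_ps r C (\<lambda>\<alpha>. if deg \<alpha> < 2 then 0 else c \<alpha>)
           (\<lambda>h. f h - f 0 - (\<Sum>i\<in>UNIV. c (unit_ix i) * h $ i))"
proof -
  obtain S where S: "S \<le> C" "((\<lambda>\<alpha>. norm (c \<alpha>) * r ^ deg \<alpha>) has_sum S) UNIV"
    and ps: "h \<in> pball r \<Longrightarrow> ((\<lambda>\<alpha>. c \<alpha> * mon \<alpha> h) has_sum f h) UNIV" for h
    using f unfolding has_ps_def by blast
  let ?c = "\<lambda>\<alpha>. if deg \<alpha> < 2 then 0 else c \<alpha>"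
  have le: "norm (?c \<alpha>) * r ^ deg \<alpha> \<le> norm (c \<alpha>) * r ^ deg \<alpha>" for \<alpha> using r by auto
  have "(\<lambda>\<alpha>. norm (?c \<alpha>) * r ^ deg \<alpha>) summable_on UNIV"
    by (rule summable_on_comparison_test[OF has_sum_imp_summable[OF S(2)]]) (use le r in auto)
  then obtain S' where S': "((\<lambda>\<alpha>. norm (?c \<alpha>) * r ^ deg \<alpha>) has_sum S') UNIV"
    by (auto simp: summable_on_def)
  have "S' \<le> S" by (rule has_sum_mono[OF S' S(2)]) (use le in auto)
  with S(1) have S'C: "S' \<le> C" by simp
  have low: "{\<alpha>. deg \<alpha> < 2} = insert (\<lambda>_. 0) (range (unit_ix :: 'i \<Rightarrow> _))"
    using deg_eq_1 deg_eq_0 by (auto simp: less_2_cases_iff)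
  have inj: "inj (unit_ix :: 'i \<Rightarrow> _)"
    by (rule injI) (metis unit_ix_def zero_neq_one)
  have n0: "(\<lambda>_. 0) \<notin> range (unit_ix :: 'i \<Rightarrow> _)" by (metis deg_unit_ix deg_zero imageE zero_neq_one)
  have "((\<lambda>\<alpha>. ?c \<alpha> * mon \<alpha> h) has_sum f h - f 0 - (\<Sum>i\<in>UNIV. c (unit_ix i) * h $ i)) UNIV"
    if h: "h \<in> pball r" for h
  proof -
    have "((\<lambda>\<alpha>. c \<alpha> * mon \<alpha> h) has_sum (\<Sum>\<alpha>\<in>{\<alpha>. deg \<alpha> < 2}. c \<alpha> * mon \<alpha> h)) {\<alpha>. deg \<alpha> < 2}"
      by (rule has_sum_finite) (simp add: low)
    moreover have "(\<Sum>\<alpha>\<in>{\<alpha>. deg \<alpha> < 2}. c \<alpha> * mon \<alpha> h) = f 0 + (\<Sum>i\<in>UNIV. c (unit_ix i) * h $ i)"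
      unfolding low using n0 has_ps_0[OF f r] by (subst sum.insert) (auto simp: sum.reindex[OF inj])
    ultimately have "((\<lambda>\<alpha>. c \<alpha> * mon \<alpha> h) has_sum f h - (f 0 + (\<Sum>i\<in>UNIV. c (unit_ix i) * h $ i))) (UNIV - {\<alpha>. deg \<alpha> < 2})"
      using has_sum_Diff[OF ps[OF h]] by (metis subset_UNIV)
    also have "?this \<longleftrightarrow> ((\<lambda>\<alpha>. ?c \<alpha> * mon \<alpha> h) has_sum f h - (f 0 + (\<Sum>i\<in>UNIV. c (unit_ix i) * h $ i))) UNIV"
      by (rule has_sum_cong_neutral) auto
    finally show ?thesis by (simp add: algebra_simps)
  qed
  then show ?thesis unfolding has_ps_def using S' S'C by blast
qed

text \<open>Once the terms of degree below 2 are removed, \<open>has_ps_scale\<close> at radius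
  \<open>norm k\<close> bounds the remainder by a multiple of
  \<open>(norm k)\<^sup>2\<close>.\<close>

lemma has_ps_derivative_0:
  fixes f :: "'k::scalar_field ^ 'i::finite \<Rightarrow> 'k"
  assumes f: "has_ps r C c f" and r: "0 < r"
  shows "(f has_derivative (\<lambda>k. \<Sum>i\<in>UNIV. c (unit_ix i) * k $ i)) (at 0)"
proof -
  define g where "g = (\<lambda>h. f h - f 0 - (\<Sum>i\<in>UNIV. c (unit_ix i) * h $ i))"
  have g: "has_ps r C (\<lambda>\<alpha>. if deg \<alpha> < 2 then 0 else c \<alpha>) g"
    unfolding g_def by (rule has_ps_remove_linear[OF f]) (use r in simp)
  have C: "0 \<le> C" using majorized_nonneg[of r C f] f r by (auto simp: majorized_def)
  have bound: "norm (g k) \<le> C / r\<^sup>2 * (norm k)\<^sup>2" if "norm k \<le> r" for k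
  proof -
    have "has_ps (norm k / r * r) ((norm k / r) ^ 2 * C) (\<lambda>\<alpha>. if deg \<alpha> < 2 then 0 else c \<alpha>) g"
      by (rule has_ps_scale[OF g]) (use r that in auto)
    from has_ps_bound[OF this, of k] norm_le_pball[of k "norm k"] r show ?thesis
      by (simp add: power_divide mult_ac)
  qed
  have lin: "bounded_linear (\<lambda>k :: 'k ^ 'i. \<Sum>i\<in>UNIV. c (unit_ix i) * k $ i)"
    by (intro bounded_linear_sum bounded_linear_const_mult bounded_linear_vec_nth)
  have lim: "((\<lambda>k. C / r\<^sup>2 * norm k) \<longlongrightarrow> 0) (at (0 :: 'k ^ 'i))"
    by (rule tendsto_eq_intros | simp)+
  have "((\<lambda>k. norm (g k) / norm k) \<longlongrightarrow> 0) (at (0 :: 'k ^ 'i))"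
  proof (rule tendsto_sandwich[OF _ _ tendsto_const lim])
    have "\<forall>\<^sub>F k in at (0 :: 'k ^ 'i). norm k \<le> r"
      unfolding eventually_at using r by (intro exI[of _ r]) auto
    then show "\<forall>\<^sub>F k in at (0 :: 'k ^ 'i). norm (g k) / norm k \<le> C / r\<^sup>2 * norm k"
    proof eventually_elim
      case (elim k)
      have "norm (g k) / norm k \<le> C / r\<^sup>2 * (norm k)\<^sup>2 / norm k"
        using bound[OF elim] by (intro divide_right_mono) auto
      then show ?case by (cases "k = 0") (auto simp: power2_eq_square)
    qed
  qed auto
  then show ?thesis
    unfolding has_derivative_at by (auto simp: lin g_def)
qed


section \<open>Recentring and differentiating power series\<close>

lemma mon_add:
  fixes h k :: "'k::scalar_field ^ 'i::finite"
  shows "mon \<alpha> (h + k) = (\<Sum>\<beta>\<in>{\<beta>. \<forall>i. \<beta> i \<le> \<alpha> i}.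
           of_nat (\<Prod>i\<in>UNIV. \<alpha> i choose \<beta> i) * mon \<beta> h * mon (\<lambda>i. \<alpha> i - \<beta> i) k)"
proof -
  have "mon \<alpha> (h + k) = (\<Prod>i\<in>UNIV. \<Sum>j\<in>{..\<alpha> i}. of_nat (\<alpha> i choose j) * (h $ i) ^ j * (k $ i) ^ (\<alpha> i - j))"
    by (simp add: mon_def binomial_ring)
  also have "\<dots> = (\<Sum>\<beta>\<in>PiE UNIV (\<lambda>i. {..\<alpha> i}).
      \<Prod>i\<in>UNIV. of_nat (\<alpha> i choose \<beta> i) * (h $ i) ^ \<beta> i * (k $ i) ^ (\<alpha> i - \<beta> i))"
    by (rule prod_sum_PiE) auto
  also have "PiE UNIV (\<lambda>i. {..\<alpha> i}) = {\<beta>. \<forall>i. \<beta> i \<le> \<alpha> i}"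
    by (auto simp: PiE_def Pi_def)
  finally show ?thesis by (simp add: mon_def prod.distrib)
qed

lemma finite_multi_index_le: "finite {\<beta> :: 'i::finite \<Rightarrow> nat. \<forall>i. \<beta> i \<le> \<alpha> i}"
proof -
  have "{\<beta>. \<forall>i. \<beta> i \<le> \<alpha> i} = PiE UNIV (\<lambda>i. {..\<alpha> i})"
    by (auto simp: PiE_def Pi_def)
  then show ?thesis by (simp add: finite_PiE)
qed

definition ix_add :: "('i \<Rightarrow> nat) \<Rightarrow> ('i \<Rightarrow> nat) \<Rightarrow> 'i \<Rightarrow> nat" where
  "ix_add \<beta> \<gamma> = (\<lambda>i. \<beta> i + \<gamma> i)"

definition ix_binom :: "('i::finite \<Rightarrow> nat) \<Rightarrow> ('i \<Rightarrow> nat) \<Rightarrow> nat" where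
  "ix_binom \<beta> \<gamma> = (\<Prod>i\<in>UNIV. (\<beta> i + \<gamma> i) choose \<beta> i)"

text \<open>Passes from sums over two exponents to sums over the total exponent and one part of it.
  \<open>F\<close> receives all three indices, so one statement serves for norms and for
  values.\<close>

lemma has_sum_ix_add:
  "((\<lambda>(\<beta>, \<gamma>). F (ix_add \<beta> \<gamma>) \<beta> \<gamma>) has_sum S) (UNIV \<times> UNIV) \<longleftrightarrow>
   ((\<lambda>(\<alpha>, \<beta>). F \<alpha> \<beta> (\<lambda>i. \<alpha> i - \<beta> i)) has_sum S) (SIGMA \<alpha>:UNIV. {\<beta>. \<forall>i. \<beta> i \<le> \<alpha> i})"
  by (rule has_sum_reindex_bij_witness[where j = "\<lambda>(\<beta>, \<gamma>). (ix_add \<beta> \<gamma>, \<beta>)"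
        and i = "\<lambda>(\<alpha>, \<beta>). (\<beta>, \<lambda>i. \<alpha> i - \<beta> i)"])
    (auto simp: ix_add_def)

lemma mon_const: "mon \<alpha> (\<chi> i. x) = x ^ deg \<alpha>"
  by (simp add: mon_def deg_def power_sum)

text \<open>For the sum \<open>f\<close> of the series with coefficients \<open>c\<close>, this is
  the derivative of order \<gamma> at \<open>h\<close> divided by the factorial of \<gamma>, as a
  power series in \<open>h\<close>.\<close>

definition taylor_coeff :: "(('i::finite \<Rightarrow> nat) \<Rightarrow> 'k::scalar_field) \<Rightarrow> ('i \<Rightarrow> nat) \<Rightarrow> 'k ^ 'i \<Rightarrow> 'k" where
  "taylor_coeff c \<gamma> h = (\<Sum>\<^sub>\<infinity>\<beta>. c (ix_add \<beta> \<gamma>) * of_nat (ix_binom \<beta> \<gamma>) * mon \<beta> h)"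

text \<open>The binomial expansion of \<open>mon \<alpha> (h + k)\<close> gives a double series in
  (\<beta>, \<gamma>). Its absolute sum is found from the same expansion at the constant vectors
  \<open>s\<close> and \<open>t\<close>, where the inner sum is
  \<open>(s + t) ^ deg \<alpha>\<close>. Summing over \<beta> first yields the expansion about
  \<open>h\<close>; bounding a single column yields the Cauchy estimate
  \<open>C / t ^ deg \<gamma>\<close>, over both fields.\<close>

lemma
  fixes f :: "'k::scalar_field ^ 'i::finite \<Rightarrow> 'k"
  assumes f: "has_ps r C c f" and st: "0 \<le> s" "0 < t" "s + t \<le> r"
  shows has_ps_recenter: "h \<in> pball s \<Longrightarrow> has_ps t C (\<lambda>\<gamma>. taylor_coeff c \<gamma> h) (\<lambda>k. f (h + k))"
    and has_ps_taylor_coeff: "has_ps s (C / t ^ deg \<gamma>)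
          (\<lambda>\<beta>. c (ix_add \<beta> \<gamma>) * of_nat (ix_binom \<beta> \<gamma>)) (taylor_coeff c \<gamma>)"
proof -
  have f': "has_ps (s + t) C c f" by (rule has_ps_shrink[OF f]) (use st in auto)
  obtain S where S: "S \<le> C" "((\<lambda>\<alpha>. norm (c \<alpha>) * (s + t) ^ deg \<alpha>) has_sum S) UNIV"
    and ps: "h \<in> pball (s + t) \<Longrightarrow> ((\<lambda>\<alpha>. c \<alpha> * mon \<alpha> h) has_sum f h) UNIV" for h
    using f' unfolding has_ps_def by blast
  define M where "M = (\<lambda>\<beta> \<gamma>. norm (c (ix_add \<beta> \<gamma>)) * real (ix_binom \<beta> \<gamma>) * s ^ deg \<beta> * t ^ deg \<gamma>)"
  have bin: "ix_binom \<beta> (\<lambda>i. \<alpha> i - \<beta> i) = (\<Prod>i\<in>UNIV. \<alpha> i choose \<beta> i)" if "\<forall>i. \<beta> i \<le> \<alpha> i" for \<alpha> \<beta> :: "'i \<Rightarrow> nat"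
    using that by (simp add: ix_binom_def)
  let ?B = "\<lambda>\<alpha> :: 'i \<Rightarrow> nat. {\<beta>. \<forall>i. \<beta> i \<le> \<alpha> i}"
  let ?G = "\<lambda>(\<alpha>, \<beta>). norm (c \<alpha>) * real (ix_binom \<beta> (\<lambda>i. \<alpha> i - \<beta> i)) * s ^ deg \<beta> * t ^ deg (\<lambda>i. \<alpha> i - \<beta> i)"
  have M: "((\<lambda>(\<beta>, \<gamma>). M \<beta> \<gamma>) has_sum S) (UNIV \<times> UNIV)"
    unfolding M_def
    unfolding has_sum_ix_add[of "\<lambda>\<alpha> \<beta> \<gamma>. norm (c \<alpha>) * real (ix_binom \<beta> \<gamma>) * s ^ deg \<beta> * t ^ deg \<gamma>"]
  proof -
    have row: "((\<lambda>\<beta>. ?G (\<alpha>, \<beta>)) has_sum norm (c \<alpha>) * (s + t) ^ deg \<alpha>) (?B \<alpha>)" for \<alpha>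
    proof (rule has_sum_finiteI[OF finite_multi_index_le])
      have "(s + t) ^ deg \<alpha> = mon \<alpha> ((\<chi> i. s) + (\<chi> i. t))"
        unfolding mon_const[symmetric] by (simp add: plus_vec_def)
      also have "\<dots> = (\<Sum>\<beta>\<in>?B \<alpha>. real (ix_binom \<beta> (\<lambda>i. \<alpha> i - \<beta> i)) * s ^ deg \<beta> * t ^ deg (\<lambda>i. \<alpha> i - \<beta> i))"
        unfolding mon_add mon_const by (rule sum.cong) (auto simp: bin)
      finally show "norm (c \<alpha>) * (s + t) ^ deg \<alpha> = (\<Sum>\<beta>\<in>?B \<alpha>. ?G (\<alpha>, \<beta>))"
        by (simp add: sum_distrib_left mult_ac)
    qed
    have "?G summable_on (Sigma UNIV ?B)"
      by (rule summable_on_SigmaI[where g = "\<lambda>\<alpha>. norm (c \<alpha>) * (s + t) ^ deg \<alpha>", OF row has_sum_imp_summable[OF S(2)]])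
        (use st in auto)
    then show "(?G has_sum S) (Sigma UNIV ?B)"
      by (intro has_sum_SigmaI[where g = "\<lambda>\<alpha>. norm (c \<alpha>) * (s + t) ^ deg \<alpha>", OF row S(2)])
  qed
  note col = has_sum_cols[OF M]
  let ?F = "\<lambda>h k \<beta> \<gamma>. c (ix_add \<beta> \<gamma>) * of_nat (ix_binom \<beta> \<gamma>) * mon \<beta> h * mon \<gamma> k"
  have F: "((\<lambda>(\<beta>, \<gamma>). ?F h k \<beta> \<gamma>) has_sum f (h + k)) (UNIV \<times> UNIV)"
    if h: "h \<in> pball s" and k: "k \<in> pball t" for h k
  proof -
    have "(\<lambda>(\<beta>, \<gamma>). norm (?F h k \<beta> \<gamma>)) summable_on (UNIV \<times> UNIV)"
      by (rule summable_on_comparison_test[OF has_sum_imp_summable[OF M]])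
        (use st in \<open>auto simp: M_def norm_mult intro!: mult_mono norm_mon_le h k\<close>)
    then have "(\<lambda>x. norm ((\<lambda>(\<beta>, \<gamma>). ?F h k \<beta> \<gamma>) x)) summable_on (UNIV \<times> UNIV)"
      by (simp add: case_prod_unfold)
    then obtain T where T: "((\<lambda>(\<beta>, \<gamma>). ?F h k \<beta> \<gamma>) has_sum T) (UNIV \<times> UNIV)"
      using abs_summable_summable by (auto simp: summable_on_def)
    have hk: "h + k \<in> pball (s + t)"
      using h k by (auto simp: pball_def intro!: norm_triangle_mono)
    have "((\<lambda>\<alpha>. c \<alpha> * mon \<alpha> (h + k)) has_sum T) UNIV"
    proof (rule has_sum_SigmaD)
      show "((\<lambda>(\<alpha>, \<beta>). c \<alpha> * of_nat (ix_binom \<beta> (\<lambda>i. \<alpha> i - \<beta> i)) * mon \<beta> h * mon (\<lambda>i. \<alpha> i - \<beta> i) k) has_sum T) (Sigma UNIV ?B)"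
        using T unfolding has_sum_ix_add[of "\<lambda>\<alpha> \<beta> \<gamma>. c \<alpha> * of_nat (ix_binom \<beta> \<gamma>) * mon \<beta> h * mon \<gamma> k"] .
      show "((\<lambda>\<beta>. case (\<alpha>, \<beta>) of (\<alpha>, \<beta>) \<Rightarrow> c \<alpha> * of_nat (ix_binom \<beta> (\<lambda>i. \<alpha> i - \<beta> i)) * mon \<beta> h * mon (\<lambda>i. \<alpha> i - \<beta> i) k)
           has_sum c \<alpha> * mon \<alpha> (h + k)) (?B \<alpha>)" for \<alpha>
        by (rule has_sum_finiteI[OF finite_multi_index_le])
          (auto simp: mon_add sum_distrib_left bin mult_ac intro!: sum.cong)
    qed
    with ps[OF hk] have "T = f (h + k)" by (metis has_sum_unique)
    with T show ?thesis by simp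
  qed
  have Mcol: "((\<lambda>\<beta>. M \<beta> \<gamma> / t ^ deg \<gamma>) has_sum (\<Sum>\<^sub>\<infinity>\<beta>. M \<beta> \<gamma>) / t ^ deg \<gamma>) UNIV" for \<gamma>
    using has_sum_divide_const[OF col(1)] by blast
  have Mdiv: "M \<beta> \<gamma> / t ^ deg \<gamma> = norm (c (ix_add \<beta> \<gamma>) * of_nat (ix_binom \<beta> \<gamma>)) * s ^ deg \<beta>" for \<beta> \<gamma>
    using st by (simp add: M_def norm_mult)
  have Mcol_le: "(\<Sum>\<^sub>\<infinity>\<beta>. M \<beta> \<gamma>) \<le> C" for \<gamma>
  proof -
    have "(\<Sum>\<^sub>\<infinity>\<beta>. M \<beta> \<gamma>) \<le> S"
      using finite_sum_le_has_sum[OF col(2), of "{\<gamma>}"] st infsum_nonneg[of UNIV "\<lambda>\<beta>. M \<beta> _"]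
      by (auto simp: M_def)
    then show ?thesis using S by simp
  qed
  have tc: "((\<lambda>\<beta>. c (ix_add \<beta> \<gamma>) * of_nat (ix_binom \<beta> \<gamma>) * mon \<beta> h) has_sum taylor_coeff c \<gamma> h) UNIV"
    if h: "h \<in> pball s" for h \<gamma>
  proof -
    have "(\<lambda>\<beta>. norm (c (ix_add \<beta> \<gamma>) * of_nat (ix_binom \<beta> \<gamma>) * mon \<beta> h)) summable_on UNIV"
      by (rule summable_on_comparison_test[OF has_sum_imp_summable[OF Mcol[of \<gamma>]]])
        (auto simp: Mdiv norm_mult intro!: mult_left_mono norm_mon_le h)
    then show ?thesis
      unfolding taylor_coeff_def by (rule has_sum_infsum[OF abs_summable_summable])
  qed
  show "has_ps s (C / t ^ deg \<gamma>) (\<lambda>\<beta>. c (ix_add \<beta> \<gamma>) * of_nat (ix_binom \<beta> \<gamma>)) (taylor_coeff c \<gamma>)" for \<gamma>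
    unfolding has_ps_def
  proof (intro conjI ballI exI)
    show "((\<lambda>\<beta>. norm (c (ix_add \<beta> \<gamma>) * of_nat (ix_binom \<beta> \<gamma>)) * s ^ deg \<beta>) has_sum
        (\<Sum>\<^sub>\<infinity>\<beta>. M \<beta> \<gamma>) / t ^ deg \<gamma>) UNIV"
      using Mcol[of \<gamma>] unfolding Mdiv .
    show "(\<Sum>\<^sub>\<infinity>\<beta>. M \<beta> \<gamma>) / t ^ deg \<gamma> \<le> C / t ^ deg \<gamma>"
      by (rule divide_right_mono[OF Mcol_le]) (use st in simp)
  qed (rule tc)
  show "has_ps t C (\<lambda>\<gamma>. taylor_coeff c \<gamma> h) (\<lambda>k. f (h + k))" if h: "h \<in> pball s"
  proof -
    have le: "norm (taylor_coeff c \<gamma> h) * t ^ deg \<gamma> \<le> (\<Sum>\<^sub>\<infinity>\<beta>. M \<beta> \<gamma>)" for \<gamma>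
    proof -
      have "norm (taylor_coeff c \<gamma> h) \<le> (\<Sum>\<^sub>\<infinity>\<beta>. M \<beta> \<gamma>) / t ^ deg \<gamma>"
        by (rule norm_infsum_le[OF tc[OF h] Mcol])
          (auto simp: Mdiv norm_mult intro!: mult_left_mono norm_mon_le h)
      then show ?thesis using st by (simp add: field_simps)
    qed
    have "(\<lambda>\<gamma>. norm (taylor_coeff c \<gamma> h) * t ^ deg \<gamma>) summable_on UNIV"
      by (rule summable_on_comparison_test[OF has_sum_imp_summable[OF col(2)]]) (use le st in auto)
    then obtain S' where S': "((\<lambda>\<gamma>. norm (taylor_coeff c \<gamma> h) * t ^ deg \<gamma>) has_sum S') UNIV"
      by (auto simp: summable_on_def)
    have "S' \<le> S" by (rule has_sum_mono[OF S' col(2)]) (use le in auto)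
    moreover have "((\<lambda>\<gamma>. taylor_coeff c \<gamma> h * mon \<gamma> k) has_sum f (h + k)) UNIV" if k: "k \<in> pball t" for k
    proof -
      have "(\<Sum>\<^sub>\<infinity>\<beta>. ?F h k \<beta> \<gamma>) = taylor_coeff c \<gamma> h * mon \<gamma> k" for \<gamma>
        by (rule infsumI[OF has_sum_cmult_left[OF tc[OF h]]])
      then show ?thesis using has_sum_cols(2)[OF F[OF h k]] by simp
    qed
    ultimately show ?thesis unfolding has_ps_def using S' S(1) by (blast intro: order_trans)
  qed
qed

lemma ix_binom_unit_ix: "ix_binom \<beta> (unit_ix i) = \<beta> i + 1"
proof -
  have "(\<beta> j + unit_ix i j) choose \<beta> j = (if j = i then \<beta> i + 1 else 1)" for j
    by (auto simp: unit_ix_def)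
  then show ?thesis by (simp add: ix_binom_def)
qed

lemma has_ps_has_derivative:
  fixes f :: "'k::scalar_field ^ 'i::finite \<Rightarrow> 'k"
  assumes f: "has_ps r C c f" and s: "0 \<le> s" "s < r" and h: "h \<in> pball s"
  shows "(f has_derivative (\<lambda>k. \<Sum>i\<in>UNIV. taylor_coeff c (unit_ix i) h * k $ i)) (at h)"
proof -
  have "has_ps (r - s) C (\<lambda>\<gamma>. taylor_coeff c \<gamma> h) (\<lambda>k. f (h + k))"
    by (rule has_ps_recenter[OF f]) (use s h in auto)
  from has_ps_derivative_0[OF this] s
  have "((\<lambda>k. f (h + k)) has_derivative (\<lambda>k. \<Sum>i\<in>UNIV. taylor_coeff c (unit_ix i) h * k $ i)) (at 0)"
    by simp
  then have "((\<lambda>k. f (h + k)) has_derivative (\<lambda>k. \<Sum>i\<in>UNIV. taylor_coeff c (unit_ix i) h * k $ i)) (at (h - h))"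
    by simp
  moreover have "((\<lambda>x. x - h) has_derivative (\<lambda>x. x)) (at h)"
    by (auto intro!: derivative_eq_intros)
  ultimately show ?thesis
    using has_derivative_compose[of "\<lambda>x. x - h" "\<lambda>x. x" h UNIV "\<lambda>k. f (h + k)"] by simp
qed

section \<open>Integration along rays and the fixed point principle\<close>

lemma pow_has_integral: "((\<lambda>t :: real. t ^ n) has_integral 1 / real (Suc n)) {0..1}"
proof -
  have "((\<lambda>t :: real. t ^ n) has_integral (1 ^ Suc n / real (Suc n) - 0 ^ Suc n / real (Suc n))) {0..1}"
  proof (rule fundamental_theorem_of_calculus)
    fix t :: real
    have "((\<lambda>t. t ^ Suc n / real (Suc n)) has_real_derivative t ^ n) (at t within {0..1})"
      by (auto intro!: derivative_eq_intros simp del: power_Suc of_nat_Suc)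
    then show "((\<lambda>t. t ^ Suc n / real (Suc n)) has_vector_derivative t ^ n) (at t within {0..1})"
      by (rule has_real_derivative_iff_has_vector_derivative[THEN iffD1])
  qed auto
  then show ?thesis by simp
qed

lemma mon_scaleR: "mon \<alpha> (t *\<^sub>R h) = t ^ deg \<alpha> *\<^sub>R mon \<alpha> h"
proof -
  have "mon \<alpha> (t *\<^sub>R h) = (\<Prod>i\<in>UNIV. of_real (t ^ \<alpha> i) * (h $ i) ^ \<alpha> i)"
    unfolding mon_def vector_scaleR_component by (simp add: scaleR_conv_of_real[where 'a = 'a] power_mult_distrib)
  also have "\<dots> = of_real (t ^ deg \<alpha>) * mon \<alpha> h"
    by (simp only: prod.distrib mon_def deg_def power_sum of_real_prod)
  finally show ?thesis by (simp add: scaleR_conv_of_real)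
qed

lemma pball_scaleR: "h \<in> pball r \<Longrightarrow> 0 \<le> t \<Longrightarrow> t \<le> 1 \<Longrightarrow> t *\<^sub>R h \<in> pball r"
  unfolding pball_def by (auto intro!: order_trans[OF mult_left_le_one_le])

text \<open>Integrating over \<open>t\<close> divides the coefficient of index \<alpha> by
  \<open>deg \<alpha> + 1\<close>, so neither norm nor radius is lost. Uniform convergence along the
  ray justifies the integration term by term.\<close>

lemma
  fixes g :: "'k::scalar_field ^ 'i::finite \<Rightarrow> 'k"
  assumes g: "majorized r C g" and r: "0 < r"
  shows majorized_ray_integral: "majorized r C (\<lambda>h. integral {0..1} (\<lambda>t. g (t *\<^sub>R h)))"
    and majorized_ray_integrable: "h \<in> pball r \<Longrightarrow> (\<lambda>t. g (t *\<^sub>R h)) integrable_on {0..1}"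
    and majorized_ray_continuous: "h \<in> pball r \<Longrightarrow> continuous_on {0..1} (\<lambda>t. g (t *\<^sub>R h))"
proof -
  obtain c S where S: "S \<le> C" "((\<lambda>\<alpha>. norm (c \<alpha>) * r ^ deg \<alpha>) has_sum S) UNIV"
    and ps: "h \<in> pball r \<Longrightarrow> ((\<lambda>\<alpha>. c \<alpha> * mon \<alpha> h) has_sum g h) UNIV" for h
    using g unfolding majorized_def has_ps_def by blast
  define c' where "c' = (\<lambda>\<alpha>. c \<alpha> * of_real (1 / real (Suc (deg \<alpha>))))"
  have main: "continuous_on {0..1} (\<lambda>t. g (t *\<^sub>R h)) \<and> (\<lambda>t. g (t *\<^sub>R h)) integrable_on {0..1} \<and>
     ((\<lambda>\<alpha>. c' \<alpha> * mon \<alpha> h) has_sum integral {0..1} (\<lambda>t. g (t *\<^sub>R h))) UNIV"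
    if h: "h \<in> pball r" for h
  proof -
    have ul: "uniform_limit {0..1} (\<lambda>X t. \<Sum>\<alpha>\<in>X. c \<alpha> * mon \<alpha> (t *\<^sub>R h)) (\<lambda>t. g (t *\<^sub>R h)) (finite_subsets_at_top UNIV)"
      by (rule Weierstrass_m_test_general'[OF _ _ has_sum_imp_summable[OF S(2)]])
        (use h in \<open>auto simp: norm_mult intro!: mult_left_mono norm_mon_le ps pball_scaleR\<close>)
    have cont: "continuous_on {0..1} (\<lambda>t. \<Sum>\<alpha>\<in>X. c \<alpha> * mon \<alpha> (t *\<^sub>R h))" for X
      unfolding mon_scaleR by (intro continuous_intros)
    obtain I J where I: "\<And>X. ((\<lambda>t. \<Sum>\<alpha>\<in>X. c \<alpha> * mon \<alpha> (t *\<^sub>R h)) has_integral I X) {0..1}"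
      and J: "((\<lambda>t. g (t *\<^sub>R h)) has_integral J) {0..1}" and IJ: "(I \<longlongrightarrow> J) (finite_subsets_at_top UNIV)"
      by (rule uniform_limit_integral[OF ul cont]) auto
    have "I X = (\<Sum>\<alpha>\<in>X. c' \<alpha> * mon \<alpha> h)" if "finite X" for X
    proof (rule has_integral_unique[OF I])
      have "((\<lambda>t. c \<alpha> * mon \<alpha> h * of_real (t ^ deg \<alpha>)) has_integral c \<alpha> * mon \<alpha> h * of_real (1 / real (Suc (deg \<alpha>)))) {0..1}" for \<alpha>
        by (intro has_integral_mult_right has_integral_of_real pow_has_integral)
      then show "((\<lambda>t. \<Sum>\<alpha>\<in>X. c \<alpha> * mon \<alpha> (t *\<^sub>R h)) has_integral (\<Sum>\<alpha>\<in>X. c' \<alpha> * mon \<alpha> h)) {0..1}"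
        using that by (intro has_integral_sum) (auto simp: c'_def mon_scaleR scaleR_conv_of_real[where 'a = 'k] mult_ac)
    qed
    then have "\<forall>\<^sub>F X in finite_subsets_at_top UNIV. I X = (\<Sum>\<alpha>\<in>X. c' \<alpha> * mon \<alpha> h)"
      by (auto intro: eventually_finite_subsets_at_top_weakI)
    then have "((\<lambda>\<alpha>. c' \<alpha> * mon \<alpha> h) has_sum J) UNIV"
      unfolding has_sum_def using IJ by (simp cong: tendsto_cong)
    moreover have "continuous_on {0..1} (\<lambda>t. g (t *\<^sub>R h))"
      by (rule uniform_limit_theorem[OF _ ul]) (use cont in auto)
    ultimately show ?thesis using J integral_unique[OF J] by blast
  qed
  then show "h \<in> pball r \<Longrightarrow> (\<lambda>t. g (t *\<^sub>R h)) integrable_on {0..1}"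
    and "h \<in> pball r \<Longrightarrow> continuous_on {0..1} (\<lambda>t. g (t *\<^sub>R h))" by blast+
  have le: "norm (c' \<alpha>) * r ^ deg \<alpha> \<le> norm (c \<alpha>) * r ^ deg \<alpha>" for \<alpha>
  proof -
    have "norm (c' \<alpha>) \<le> norm (c \<alpha>)"
      unfolding c'_def norm_mult norm_of_real by (rule mult_left_le) auto
    then show ?thesis using r by (intro mult_right_mono) auto
  qed
  have "(\<lambda>\<alpha>. norm (c' \<alpha>) * r ^ deg \<alpha>) summable_on UNIV"
    by (rule summable_on_comparison_test[OF has_sum_imp_summable[OF S(2)]]) (use le r in auto)
  then obtain S' where S': "((\<lambda>\<alpha>. norm (c' \<alpha>) * r ^ deg \<alpha>) has_sum S') UNIV"
    by (auto simp: summable_on_def)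
  have "S' \<le> S" by (rule has_sum_mono[OF S' S(2)]) (use le in auto)
  then show "majorized r C (\<lambda>h. integral {0..1} (\<lambda>t. g (t *\<^sub>R h)))"
    unfolding majorized_def has_ps_def using S(1) S' main by (blast intro: order_trans)
qed

text \<open>By substitution, \<open>s\<close> times the integral is the integral of \<open>G\<close>
  over \<open>{0..s}\<close>, to which the fundamental theorem applies. The derivative at 1 is
  one-sided because \<open>G\<close> is controlled only up to the end of the ray.\<close>

lemma ray_integral_derivative:
  fixes G :: "real \<Rightarrow> 'k::euclidean_space"
  assumes G: "continuous_on {0..1} G"
  shows "((\<lambda>s. s *\<^sub>R integral {0..1} (\<lambda>t. G (t * s))) has_vector_derivative G 1) (at 1 within {0..1})"
proof -
  have eq: "integral {0..s} G = s *\<^sub>R integral {0..1} (\<lambda>t. G (t * s))" if s: "s \<in> {0..1}" for s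
  proof (cases "s = 0")
    case False
    with s have s0: "0 < s" by simp
    have "continuous_on {0..s} G" by (rule continuous_on_subset[OF G]) (use s in auto)
    then have "(G has_integral integral {0..s} G) (cbox 0 s)"
      using integrable_continuous_real by (auto intro: integrable_integral)
    from has_integral_affinity[OF this, of s 0] s0
    have "((\<lambda>x. G (s * x)) has_integral (1 / s) *\<^sub>R integral {0..s} G) ((\<lambda>x. (1 / s) * x) ` {0..s})"
      by simp
    moreover have "(\<lambda>x. (1 / s) * x) ` {0..s} = {0..1}"
      using s0 image_mult_atLeastAtMost[of "1 / s" 0 s] by simp
    ultimately have "integral {0..1} (\<lambda>t. G (t * s)) = (1 / s) *\<^sub>R integral {0..s} G"
      by (intro integral_unique) (simp add: mult.commute[of s])
    then show ?thesis using s0 by simp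
  qed simp
  have "((\<lambda>u. integral {0..u} G) has_vector_derivative G 1) (at 1 within {0..1})"
    by (rule integral_has_vector_derivative[OF G]) auto
  then show ?thesis
    by (rule has_vector_derivative_transform[rotated 2]) (simp, rule eq[symmetric])
qed

text \<open>The contraction principle with ratio 1/2 in the majorant norm, for a family of unknowns.
  The limit is built as the sum of the successive differences of the iterates, with
  \<open>majorized_infsum\<close> in the role of completeness.\<close>

lemma majorized_fixpoint:
  fixes T :: "('r \<Rightarrow> 'k::scalar_field ^ 'i::finite \<Rightarrow> 'k) \<Rightarrow> 'r \<Rightarrow> 'k ^ 'i \<Rightarrow> 'k"
  assumes r: "0 < r" and R: "0 \<le> R"
    and T0: "\<And>i. majorized r (R / 2) (T (\<lambda>_ _. 0) i)"
    and contr: "\<And>U V \<delta> i. \<lbrakk>\<And>i. majorized r R (U i); \<And>i. majorized r R (V i);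
        \<And>i. majorized r \<delta> (\<lambda>h. U i h - V i h)\<rbrakk> \<Longrightarrow> majorized r (\<delta> / 2) (\<lambda>h. T U i h - T V i h)"
  obtains U where "\<And>i. majorized r R (U i)" "\<And>i h. h \<in> pball r \<Longrightarrow> T U i h = U i h"
proof -
  define u where "u = (\<lambda>n. (T ^^ n) (\<lambda>_ _. 0))"
  \<comment> \<open>\<open>e n\<close> bounds the difference of iterates \<open>n\<close> and
    \<open>n + 1\<close>. The bounds add up to \<open>R\<close>, so no iterate leaves the ball in
    which \<open>contr\<close> is available.\<close>
  define e where "e = (\<lambda>n. R / 2 * (1 / 2) ^ n)"
  have u_Suc: "u (Suc n) = T (u n)" for n by (simp add: u_def)
  have u0: "u 0 = (\<lambda>_ _. 0)" by (simp add: u_def)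
  have e_sum: "(\<Sum>m<n. e m) = R * (1 - (1 / 2) ^ n)" for n
    by (induction n) (auto simp: e_def field_simps)
  have *: "(\<forall>i. majorized r (\<Sum>m<n. e m) (u n i)) \<and> (\<forall>i. majorized r (\<Sum>m<Suc n. e m) (u (Suc n) i)) \<and>
      (\<forall>i. majorized r (e n) (\<lambda>h. u (Suc n) i h - u n i h))" for n
  proof (induction n)
    case 0
    have "majorized r 0 (\<lambda>_ :: 'k ^ 'i. 0)" using majorized_const[of r 0] r by simp
    then show ?case using T0 by (auto simp: u0 u_Suc e_def)
  next
    case (Suc n)
    have le: "(\<Sum>m<n. e m) \<le> R" for n
      using R by (auto simp: e_sum mult_left_le)
    have "majorized r (e n / 2) (\<lambda>h. T (u (Suc n)) i h - T (u n) i h)" for i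
      using Suc le by (intro contr) (blast intro: majorized_cong)+
    then have d: "majorized r (e (Suc n)) (\<lambda>h. u (Suc (Suc n)) i h - u (Suc n) i h)" for i
      by (simp add: u_Suc e_def)
    have "majorized r ((\<Sum>m<Suc n. e m) + e (Suc n))
        (\<lambda>h. u (Suc n) i h + (u (Suc (Suc n)) i h - u (Suc n) i h))" for i
      using Suc d r by (intro majorized_add) auto
    then show ?case using d Suc by simp
  qed
  define U where "U = (\<lambda>i h. \<Sum>\<^sub>\<infinity>n. u (Suc n) i h - u n i h)"
  have geo: "(e has_sum R * (1 / 2) ^ n) {n..}" for n
  proof -
    have "((\<lambda>m. R / 2 * (1 / 2) ^ n * (1 / 2) ^ m) sums (R / 2 * (1 / 2) ^ n * (1 / (1 - 1 / 2)))) "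
      by (intro sums_mult geometric_sums) simp
    then have "((\<lambda>m. e (n + m)) has_sum R * (1 / 2) ^ n) UNIV"
      using R by (intro sums_nonneg_imp_has_sum) (auto simp: e_def power_add mult.assoc)
    then show ?thesis
      by (subst (asm) has_sum_reindex_bij_betw[where g = "\<lambda>m. n + m" and B = "{n..}" and f = e])
        (auto simp: bij_betw_def inj_on_def image_iff le_iff_add)
  qed
  have geo0: "(e has_sum R) UNIV"
    using geo[of 0] by (simp add: atLeast_0)
  have U: "majorized r R (U i)" for i
    unfolding U_def by (rule majorized_infsum(1)[OF _ geo0 r]) (use * in blast)
  have tail: "majorized r (R * (1 / 2) ^ n) (\<lambda>h. U i h - u n i h)" for i n
  proof (rule majorized_has_sum[OF _ geo r])
    show "majorized r (e m) (\<lambda>h. u (Suc m) i h - u m i h)" for m using * by blast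
    fix h :: "'k ^ 'i" assume h: "h \<in> pball r"
    have 1: "((\<lambda>m. u (Suc m) i h - u m i h) has_sum U i h) UNIV"
      unfolding U_def by (rule majorized_infsum(2)[OF _ geo0 r h]) (use * in blast)
    have 2: "((\<lambda>m. u (Suc m) i h - u m i h) has_sum u n i h) {..<n}"
      by (rule has_sum_finiteI) (simp_all add: sum_lessThan_telescope[of "\<lambda>m. u m i h"] u0)
    have "UNIV - {..<n} = {n..}" by auto
    with has_sum_Diff[OF 1 2] show "((\<lambda>m. u (Suc m) i h - u m i h) has_sum U i h - u n i h) {n..}"
      by simp
  qed
  have "T U i h = U i h" if h: "h \<in> pball r" for i h
  proof -
    have uR: "majorized r R (u n i)" for n i
      by (rule majorized_cong[of r "\<Sum>m<n. e m"]) (use * R in \<open>auto simp: e_sum mult_left_le\<close>)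
    \<comment> \<open>Both \<open>T U\<close> and \<open>U\<close> are within a geometric tail of
      iterate \<open>n + 1\<close>.\<close>
    have "norm (T U i h - U i h) \<le> R * (1 / 2) ^ n" for n
    proof -
      have "norm (T U i h - u (Suc n) i h) \<le> R * (1 / 2) ^ n / 2"
        using majorized_bound[OF contr[OF U uR tail] h] by (simp add: u_Suc)
      moreover have "norm (U i h - u (Suc n) i h) \<le> R * (1 / 2) ^ Suc n"
        by (rule majorized_bound[OF tail h])
      ultimately show ?thesis
        using norm_triangle_ineq4[of "T U i h - u (Suc n) i h" "U i h - u (Suc n) i h"] by simp
    qed
    moreover have "(\<lambda>n. R * (1 / 2) ^ n) \<longlonglongrightarrow> R * 0"
      by (intro tendsto_intros LIMSEQ_realpow_zero) auto
    ultimately have "norm (T U i h - U i h) \<le> R * 0"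
      by (intro LIMSEQ_le_const) auto
    then show ?thesis by simp
  qed
  with U that show ?thesis by blast
qed

section \<open>Analytic functions\<close>

definition an :: "('k::scalar_field ^ 'i::finite \<Rightarrow> 'k) \<Rightarrow> 'k ^ 'i \<Rightarrow> bool" where
  "an f a \<longleftrightarrow> (\<exists>r>0. \<exists>C. majorized r C (\<lambda>h. f (a + h)))"

lemma anI: "majorized r C (\<lambda>h. f (a + h)) \<Longrightarrow> 0 < r \<Longrightarrow> an f a"
  unfolding an_def by blast

text \<open>Taken along one axis by \<open>deriv\<close>, so as to agree with the partial
  derivatives in the definition of \<open>total_diff\<close>. For analytic functions
  \<open>an_has_derivative\<close> adds total differentiability.\<close>

definition pd :: "'i::finite \<Rightarrow> ('k::scalar_field ^ 'i \<Rightarrow> 'k) \<Rightarrow> 'k ^ 'i \<Rightarrow> 'k" where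
  "pd i f v = deriv (\<lambda>t. f (v + axis i t)) 0"

lemma bounded_linear_axis: "bounded_linear (axis i :: 'k::euclidean_space \<Rightarrow> 'k ^ 'i::finite)"
  unfolding linear_conv_bounded_linear[symmetric]
  by (rule linearI) (auto simp: vec_eq_iff axis_def)

lemma pd_eqI:
  assumes "(f has_derivative (\<lambda>k. \<Sum>j\<in>UNIV. d j * k $ j)) (at v)"
  shows "pd i f v = d i"
proof -
  have "((\<lambda>t. v + axis i t) has_derivative axis i) (at 0)"
    by (auto intro!: derivative_eq_intros bounded_linear_imp_has_derivative bounded_linear_axis)
  moreover have "v + axis i 0 = v" by (simp add: axis_def vec_eq_iff)
  ultimately have "((\<lambda>t. f (v + axis i t)) has_derivative (\<lambda>t. \<Sum>j\<in>UNIV. d j * axis i t $ j)) (at 0)"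
    using has_derivative_compose[of "\<lambda>t. v + axis i t" "axis i" 0 UNIV f "\<lambda>k. \<Sum>j\<in>UNIV. d j * k $ j"] assms by (simp only:)
  moreover have "(\<Sum>j\<in>UNIV. d j * axis i t $ j) = d i * t" for t
    by (simp add: axis_def if_distrib[where f = "\<lambda>x. _ * x"] cong: if_cong)
  ultimately show ?thesis
    unfolding pd_def by (intro DERIV_imp_deriv) (simp add: has_field_derivative_def)
qed

lemma shift_has_derivative:
  "((\<lambda>k. f (a + k)) has_derivative D) (at h) \<longleftrightarrow> (f has_derivative D) (at (a + h))"
proof
  assume *: "((\<lambda>k. f (a + k)) has_derivative D) (at h)"
  have "((\<lambda>x. x - a) has_derivative (\<lambda>x. x)) (at (a + h))" by (auto intro!: derivative_eq_intros)
  from has_derivative_compose[OF this, of "\<lambda>k. f (a + k)" D] * show "(f has_derivative D) (at (a + h))" by simp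
next
  assume *: "(f has_derivative D) (at (a + h))"
  have "((\<lambda>x. a + x) has_derivative (\<lambda>x. x)) (at h)" by (auto intro!: derivative_eq_intros)
  from has_derivative_compose[OF this *] show "((\<lambda>k. f (a + k)) has_derivative D) (at h)" by simp
qed

text \<open>Everything is read off the coefficients: the partial derivative is the Taylor
  coefficient of index \<open>unit_ix i\<close>, and mixed second derivatives agree because
  multi-indices add commutatively.\<close>

lemma majorized_derivative:
  assumes f: "majorized r C (\<lambda>h. f (a + h))" and s: "0 < s" "s < r"
  shows "majorized s (C / (r - s)) (\<lambda>h. pd i f (a + h))"
    and "h \<in> pball s \<Longrightarrow> (f has_derivative (\<lambda>k. \<Sum>i\<in>UNIV. pd i f (a + h) * k $ i)) (at (a + h))"
    and "pd i (pd j f) a = pd j (pd i f) a"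
proof -
  obtain c where c: "has_ps r C c (\<lambda>h. f (a + h))" using f by (auto simp: majorized_def)
  have D: "(f has_derivative (\<lambda>k. \<Sum>i\<in>UNIV. taylor_coeff c (unit_ix i) h * k $ i)) (at (a + h))"
    if "h \<in> pball s" for h
    using has_ps_has_derivative[OF c _ s(2) that] s by (simp add: shift_has_derivative)
  have pd: "pd i f (a + h) = taylor_coeff c (unit_ix i) h" if "h \<in> pball s" for h i
    by (rule pd_eqI[OF D[OF that]])
  show "h \<in> pball s \<Longrightarrow> (f has_derivative (\<lambda>k. \<Sum>i\<in>UNIV. pd i f (a + h) * k $ i)) (at (a + h))"
    using D by (simp add: pd)
  have ps: "has_ps s (C / (r - s)) (\<lambda>\<beta>. c (ix_add \<beta> (unit_ix i)) * of_nat (\<beta> i + 1)) (\<lambda>h. pd i f (a + h))" for i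
  proof -
    have "has_ps s (C / (r - s) ^ deg (unit_ix i)) (\<lambda>\<beta>. c (ix_add \<beta> (unit_ix i)) * of_nat (ix_binom \<beta> (unit_ix i)))
        (taylor_coeff c (unit_ix i))"
      by (rule has_ps_taylor_coeff[OF c]) (use s in auto)
    then show ?thesis
      using pd by (auto simp: ix_binom_unit_ix elim!: has_ps_cong)
  qed
  then show "majorized s (C / (r - s)) (\<lambda>h. pd i f (a + h))" unfolding majorized_def by blast
  have pd2: "pd j (pd i f) a = c (ix_add (unit_ix j) (unit_ix i)) * of_nat (unit_ix j i + 1)" for i j
  proof (rule pd_eqI)
    have "(pd i f has_derivative (\<lambda>k. \<Sum>j\<in>UNIV. c (ix_add (unit_ix j) (unit_ix i)) * of_nat (unit_ix j i + 1) * k $ j)) (at (a + 0))"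
      unfolding shift_has_derivative[symmetric] by (rule has_ps_derivative_0[OF ps s(1)])
    then show "(pd i f has_derivative (\<lambda>k. \<Sum>j\<in>UNIV. c (ix_add (unit_ix j) (unit_ix i)) * of_nat (unit_ix j i + 1) * k $ j)) (at a)"
      by simp
  qed
  have "ix_add (unit_ix j) (unit_ix i) = ix_add (unit_ix i) (unit_ix j)" "unit_ix j i = unit_ix i j"
    by (auto simp: ix_add_def unit_ix_def)
  then show "pd i (pd j f) a = pd j (pd i f) a" by (simp add: pd2)
qed

lemma an_has_derivative: "an f a \<Longrightarrow> (f has_derivative (\<lambda>k. \<Sum>i\<in>UNIV. pd i f a * k $ i)) (at a)"
  and an_pd: "an f a \<Longrightarrow> an (pd i f) a"
  and pd_commute: "an f a \<Longrightarrow> pd i (pd j f) a = pd j (pd i f) a"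
proof -
  assume "an f a"
  then obtain r C where r: "0 < r" and f: "majorized r C (\<lambda>h. f (a + h))" by (auto simp: an_def)
  note * = majorized_derivative[OF f, of "r / 2"]
  show "(f has_derivative (\<lambda>k. \<Sum>i\<in>UNIV. pd i f a * k $ i)) (at a)" using *(2)[of 0] r by simp
  have "majorized (r / 2) (C / (r - r / 2)) (\<lambda>h. pd i f (a + h))" using *(1) r by simp
  with r show "an (pd i f) a" unfolding an_def by (meson half_gt_zero)
  show "pd i (pd j f) a = pd j (pd i f) a" using *(3) r by simp
qed

lemma an_isCont: "an f a \<Longrightarrow> isCont f a"
  using an_has_derivative has_derivative_continuous by blast

lemma an_eventually: 
  assumes "an f a"
  shows "\<forall>\<^sub>F b in nhds a. an f b"
proof -
  obtain r C c where r: "0 < r" and c: "has_ps r C c (\<lambda>h. f (a + h))"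
    using assms by (auto simp: an_def majorized_def)
  have "an f (a + h)" if "h \<in> pball (r / 2)" for h
  proof -
    have "has_ps (r / 2) C (\<lambda>\<gamma>. taylor_coeff c \<gamma> h) (\<lambda>k. f (a + (h + k)))"
      by (rule has_ps_recenter[OF c]) (use r that in auto)
    then have "majorized (r / 2) C (\<lambda>k. f (a + h + k))" by (auto simp: majorized_def add.assoc)
    with r show ?thesis unfolding an_def by (intro exI[of _ "r / 2"]) auto
  qed
  note * = this
  have "((\<lambda>b. b - a) \<longlongrightarrow> a - a) (nhds a)" by (intro tendsto_diff filterlim_ident tendsto_const)
  then have "filterlim (\<lambda>b. b - a) (nhds 0) (nhds a)" by simp
  from eventually_compose_filterlim[OF eventually_pball this, of "r / 2"] r
  have "\<forall>\<^sub>F b in nhds a. b - a \<in> pball (r / 2)" by simp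
  then show ?thesis by (rule eventually_mono) (use *[of "_ - a"] in simp)
qed

lemma an_common:
  assumes "finite J" "\<And>j. j \<in> J \<Longrightarrow> an (f j) a"
  shows "\<exists>r C. 0 < r \<and> (\<forall>j\<in>J. majorized r (C j) (\<lambda>h. f j (a + h)))"
proof -
  obtain \<rho> C where \<rho>: "\<And>j. j \<in> J \<Longrightarrow> 0 < \<rho> j" "\<And>j. j \<in> J \<Longrightarrow> majorized (\<rho> j) (C j) (\<lambda>h. f j (a + h))"
    using assms(2) unfolding an_def by metis
  define r where "r = Min (insert 1 (\<rho> ` J))"
  have "0 < r" "\<And>j. j \<in> J \<Longrightarrow> r \<le> \<rho> j" using assms(1) \<rho>(1) by (auto simp: r_def)
  with \<rho>(2) show ?thesis by (intro exI[of _ r] exI[of _ C]) (auto intro: majorized_shrink[OF _ less_imp_le])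
qed

lemma an_const: "an (\<lambda>_. k) a"
  unfolding an_def by (intro exI[of _ 1] conjI exI[of _ "norm k"] majorized_const) auto

lemma an_nth: "an (\<lambda>h. h $ i) a"
proof -
  have "majorized 1 (norm (a $ i) + 1) (\<lambda>h. a $ i + h $ i)"
    by (rule majorized_add[OF majorized_const majorized_coord]) auto
  then show ?thesis unfolding an_def by (intro exI[of _ 1]) auto
qed

lemma an_sum:
  assumes "\<And>j. j \<in> J \<Longrightarrow> an (f j) a"
  shows "an (\<lambda>h. \<Sum>j\<in>J. f j h) a"
proof (cases "finite J")
  case True
  obtain r C where "0 < r" "\<forall>j\<in>J. majorized r (C j) (\<lambda>h. f j (a + h))"
    using an_common[of J f a] True assms by blast
  then show ?thesis
    by (intro anI[OF majorized_sum[OF True, of r C "\<lambda>j h. f j (a + h)"]]) auto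
qed (simp add: an_const)

lemma an_pair:
  assumes "an f a" "an g a"
  obtains r C D where "0 < r" "majorized r C (\<lambda>h. f (a + h))" "majorized r D (\<lambda>h. g (a + h))"
proof -
  have "an (if b then f else g) a" for b using assms by simp
  from an_common[of UNIV "\<lambda>b. if b then f else g" a, OF finite_class.finite_UNIV this]
  obtain r C where "0 < r" "\<forall>b\<in>UNIV. majorized r (C b) (\<lambda>h. (if b then f else g) (a + h))" by (elim exE conjE)
  from this(1) this(2)[THEN bspec, of True] this(2)[THEN bspec, of False] that show ?thesis by simp
qed

lemma an_add: "an f a \<Longrightarrow> an g a \<Longrightarrow> an (\<lambda>h. f h + g h) a"
  by (erule an_pair, assumption) (rule anI[OF majorized_add])

lemma an_mult: "an f a \<Longrightarrow> an g a \<Longrightarrow> an (\<lambda>h. f h * g h) a"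
  by (erule an_pair, assumption) (rule anI[OF majorized_mult])

lemma an_minus: "an f a \<Longrightarrow> an (\<lambda>h. - f h) a"
  using an_mult[OF an_const[of "-1"], of f a] by simp

lemma an_diff: "an f a \<Longrightarrow> an g a \<Longrightarrow> an (\<lambda>h. f h - g h) a"
  by (drule (1) an_add[OF _ an_minus]) (simp only: diff_conv_add_uminus)

text \<open>\<open>f - f a\<close> vanishes at the centre, so shrinking the radius by a factor
  shrinks its norm at least by that factor.\<close>

lemma an_small:
  assumes "an f a" "0 < \<rho>" 
  shows "\<exists>r>0. \<forall>s. 0 < s \<longrightarrow> s \<le> r \<longrightarrow> majorized s \<rho> (\<lambda>h. f (a + h) - f a)"
proof -
  have "an (\<lambda>h. f h - f a) a" using assms by (intro an_diff an_const)
  then obtain r C where r: "0 < r" and f: "majorized r C (\<lambda>h. f (a + h) - f a)" by (auto simp: an_def)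
  have C: "0 \<le> C" using majorized_nonneg[OF f] r by simp
  define t where "t = min 1 (\<rho> / (C + 1))"
  have t: "0 < t" "t \<le> 1" "t * C \<le> \<rho>"
    using C assms(2) by (auto simp: t_def min_def field_simps)
  have "majorized (t * r) \<rho> (\<lambda>h. f (a + h) - f a)"
    by (rule majorized_cong[OF majorized_scale[OF f]]) (use t r in auto)
  with t r show ?thesis by (intro exI[of _ "t * r"]) (auto intro: majorized_shrink[OF _ less_imp_le])
qed

lemma an_compose:
  fixes U :: "'j::finite \<Rightarrow> 'k::scalar_field ^ 'i::finite \<Rightarrow> 'k"
  assumes f: "an f (\<chi> j. U j a)" and U: "\<And>j. an (U j) a"
  shows "an (\<lambda>h. f (\<chi> j. U j h)) a"
proof -
  obtain \<rho> C where \<rho>: "0 < \<rho>" and F: "majorized \<rho> C (\<lambda>h. f ((\<chi> j. U j a) + h))" using f by (auto simp: an_def)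
  have "\<exists>r>0. \<forall>s. 0 < s \<longrightarrow> s \<le> r \<longrightarrow> majorized s \<rho> (\<lambda>h. U j (a + h) - U j a)" for j
    by (rule an_small[OF U \<rho>])
  then have "\<forall>j. \<exists>r. 0 < r \<and> (\<forall>s. 0 < s \<longrightarrow> s \<le> r \<longrightarrow> majorized s \<rho> (\<lambda>h. U j (a + h) - U j a))" by blast
  then obtain R where "\<forall>j. 0 < R j \<and> (\<forall>s. 0 < s \<longrightarrow> s \<le> R j \<longrightarrow> majorized s \<rho> (\<lambda>h. U j (a + h) - U j a))"
    by (rule choice[THEN exE])
  then have R: "\<And>j. 0 < R j" "\<And>j s. 0 < s \<Longrightarrow> s \<le> R j \<Longrightarrow> majorized s \<rho> (\<lambda>h. U j (a + h) - U j a)" by blast+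
  define r where "r = Min (range R)"
  have r: "0 < r" "\<And>j. r \<le> R j" using R(1) by (auto simp: r_def)
  have "majorized r C (\<lambda>h. f ((\<chi> j. U j a) + (\<chi> j. U j (a + h) - U j a)))"
    by (rule majorized_compose[OF F]) (use R r in auto)
  moreover have "(\<chi> j. U j a) + (\<chi> j. U j (a + h) - U j a) = (\<chi> j. U j (a + h))" for h
    by (simp add: vec_eq_iff)
  ultimately have "majorized r C (\<lambda>h. f (\<chi> j. U j (a + h)))" by (simp only:)
  then show ?thesis by (rule anI) (rule r)
qed

text \<open>Write \<open>f\<close> as \<open>f a * (1 - w)\<close> with \<open>w\<close> of norm at
  most 1/2 near \<open>a\<close>, and sum the geometric series in the majorant norm.\<close>

lemma an_inverse:
  fixes f :: "'k::scalar_field ^ 'i::finite \<Rightarrow> 'k"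
  assumes f: "an f a" and nz: "f a \<noteq> 0"
  shows "an (\<lambda>h. inverse (f h)) a"
proof -
  define w where "w = (\<lambda>h. (f a - f h) / f a)"
  have "an (\<lambda>h. inverse (f a) * (f a - f h)) a"
    by (intro an_mult an_diff an_const f)
  then have "an w a" by (simp add: w_def divide_inverse mult.commute)
  from an_small[OF this, of "1/2"] obtain r where r: "0 < r" "majorized r (1/2) (\<lambda>h. w (a + h) - w a)"
    by auto
  have w: "majorized r (1/2) (\<lambda>h. w (a + h))" using r by (simp add: w_def)
  have "majorized r 2 (\<lambda>h. inverse (1 - w (a + h)))"
  proof (rule majorized_has_sum[OF majorized_power[OF w r(1)] _ r(1)])
    have "((\<lambda>n. (1/2::real) ^ n) sums (1 / (1 - 1/2)))" by (rule geometric_sums) simp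
    then show "((\<lambda>n. (1/2::real) ^ n) has_sum 2) UNIV" by (intro sums_nonneg_imp_has_sum) auto
    fix h :: "'k ^ 'i" assume h: "h \<in> pball r"
    have "norm (w (a + h)) < 1" using majorized_bound[OF w h] by simp
    then have "((\<lambda>n. w (a + h) ^ n) has_sum 1 / (1 - w (a + h))) UNIV"
      by (intro norm_summable_imp_has_sum geometric_sums) (auto simp: norm_power)
    then show "((\<lambda>n. w (a + h) ^ n) has_sum inverse (1 - w (a + h))) UNIV" by (simp add: divide_inverse)
  qed
  then have "an (\<lambda>h. inverse (1 - w h)) a" by (rule anI) (rule r)
  then have res: "an (\<lambda>h. inverse (f a) * inverse (1 - w h)) a" by (intro an_mult an_const)
  have fh: "f h = f a * (1 - w h)" for h
    using nz by (simp add: w_def field_simps)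
  have eq: "(\<lambda>h. inverse (f h)) = (\<lambda>h. inverse (f a) * inverse (1 - w h))"
    by (rule ext, subst fh) (rule inverse_mult_distrib)
  show ?thesis by (subst eq) (rule res)
qed

lemma has_derivative_vec_lambda:
  fixes U :: "'j::finite \<Rightarrow> 'a::real_normed_vector \<Rightarrow> 'k::euclidean_space"
  assumes "\<And>j. (U j has_derivative D j) (at x within S)"
  shows "((\<lambda>h. \<chi> j. U j h) has_derivative (\<lambda>k. \<chi> j. D j k)) (at x within S)"
proof -
  have e: "(\<chi> j. c j) = (\<Sum>j\<in>UNIV. axis j (c j))" for c :: "'j \<Rightarrow> 'k"
    by (simp add: vec_eq_iff sum_component axis_def)
  show ?thesis unfolding e
    by (intro has_derivative_sum bounded_linear.has_derivative[OF bounded_linear_axis] assms)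
qed

lemma pd_add: "an f a \<Longrightarrow> an g a \<Longrightarrow> pd i (\<lambda>h. f h + g h) a = pd i f a + pd i g a"
  by (rule pd_eqI, rule has_derivative_eq_rhs, rule has_derivative_add; (rule an_has_derivative, assumption)?)
    (simp add: sum.distrib distrib_right)

lemma pd_diff: "an f a \<Longrightarrow> an g a \<Longrightarrow> pd i (\<lambda>h. f h - g h) a = pd i f a - pd i g a"
  by (rule pd_eqI, rule has_derivative_eq_rhs, rule has_derivative_diff; (rule an_has_derivative, assumption)?)
    (simp add: sum_subtractf left_diff_distrib)

lemma pd_mult: "an f a \<Longrightarrow> an g a \<Longrightarrow> pd i (\<lambda>h. f h * g h) a = pd i f a * g a + f a * pd i g a"
  by (rule pd_eqI, rule has_derivative_eq_rhs, rule has_derivative_mult; (rule an_has_derivative, assumption)?)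
    (simp add: sum.distrib algebra_simps sum_distrib_left)

lemma pd_sum:
  assumes "\<And>j. j \<in> J \<Longrightarrow> an (f j) a"
  shows "pd i (\<lambda>h. \<Sum>j\<in>J. f j h) a = (\<Sum>j\<in>J. pd i (f j) a)"
proof (rule pd_eqI, rule has_derivative_eq_rhs, rule has_derivative_sum)
  show "j \<in> J \<Longrightarrow> (f j has_derivative (\<lambda>k. \<Sum>i\<in>UNIV. pd i (f j) a * k $ i)) (at a)" for j
    by (rule an_has_derivative[OF assms])
qed (simp add: sum_distrib_right, subst sum.swap, simp)

lemma pd_const [simp]: "pd i (\<lambda>_. c) a = 0"
  by (simp add: pd_def)

lemma pd_nth: "pd i (\<lambda>h. h $ j) a = (if i = j then 1 else 0)"
proof -
  have "(\<lambda>h. h $ j) = (\<lambda>h :: 'a ^ 'b. \<Sum>l\<in>UNIV. (if l = j then 1 else 0) * h $ l)"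
    by (simp add: if_distrib[where f = "\<lambda>x. x * _"] cong: if_cong)
  then have "((\<lambda>h. h $ j) has_derivative (\<lambda>h :: 'a ^ 'b. \<Sum>l\<in>UNIV. (if l = j then 1 else 0) * h $ l)) (at a)"
    using bounded_linear_imp_has_derivative[OF bounded_linear_vec_nth] by metis
  then show ?thesis by (rule pd_eqI)
qed

lemma pd_cong: 
  assumes "\<forall>\<^sub>F b in nhds a. f b = g b" "an f a"
  shows "pd i f a = pd i g a"
proof -
  have "(g has_derivative (\<lambda>k. \<Sum>i\<in>UNIV. pd i f a * k $ i)) (at a)"
  proof (rule has_derivative_transform_eventually[OF an_has_derivative[OF assms(2)]])
    show "\<forall>\<^sub>F x' in at a. f x' = g x'" "f a = g a"
      using assms(1) by (simp_all add: eventually_nhds_conv_at)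
  qed simp
  then show ?thesis by (rule pd_eqI[symmetric])
qed

lemma pd_minus: "an f a \<Longrightarrow> pd i (\<lambda>h. - f h) a = - pd i f a"
  using pd_diff[OF an_const[of 0], of f a i] by simp

lemma has_derivative_compose_vec:
  fixes U :: "'j::finite \<Rightarrow> 'a::real_normed_vector \<Rightarrow> 'k::scalar_field"
  assumes f: "an f (\<chi> j. U j a)" and U: "\<And>j. (U j has_derivative D j) (at a within S)"
  shows "((\<lambda>h. f (\<chi> j. U j h)) has_derivative (\<lambda>k. \<Sum>j\<in>UNIV. pd j f (\<chi> j. U j a) * D j k)) (at a within S)"
  using has_derivative_compose[OF has_derivative_vec_lambda[OF U] an_has_derivative[OF f]] by simp

lemma pd_compose:
  fixes U :: "'j::finite \<Rightarrow> 'k::scalar_field ^ 'i::finite \<Rightarrow> 'k"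
  assumes f: "an f (\<chi> j. U j a)" and U: "\<And>j. an (U j) a"
  shows "pd i (\<lambda>h. f (\<chi> j. U j h)) a = (\<Sum>j\<in>UNIV. pd j f (\<chi> j. U j a) * pd i (U j) a)"
proof (rule pd_eqI, rule has_derivative_eq_rhs, rule has_derivative_compose_vec[OF f an_has_derivative[OF U]])
qed (simp add: sum_distrib_left sum_distrib_right mult.assoc, subst sum.swap, simp)

lemma pd_shift: "pd i (\<lambda>v. f (v - a)) v = pd i f (v - a)"
  by (simp add: pd_def diff_add_eq)

lemma an_shift: "an (\<lambda>v. f (v - a)) v \<longleftrightarrow> an f (v - a)"
  by (simp add: an_def diff_add_eq)

lemma an_isCont_vec:
  assumes "\<And>i. an (\<lambda>v. \<Phi> v $ i) a"
  shows "isCont \<Phi> a"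
proof -
  have "((\<lambda>h. \<chi> j. \<Phi> h $ j) has_derivative (\<lambda>k. \<chi> j. \<Sum>i\<in>UNIV. pd i (\<lambda>v. \<Phi> v $ j) a * k $ i)) (at a)"
    by (intro has_derivative_vec_lambda an_has_derivative assms)
  from has_derivative_continuous[OF this] show ?thesis by (simp add: vec_lambda_eta)
qed

section \<open>Inverse functions and the Frobenius theorem\<close>

text \<open>In terms of \<open>h = v - a\<close> the map is a constant plus the identity plus a
  remainder \<open>Rm\<close> that starts in degree 2. The inverse solves
  \<open>U = h - Rm U\<close>, a contraction on a small polydisc. The normalisation
  \<open>id\<close> suffices later because the first derivatives of the flat coordinates at the base
  point can be prescribed.\<close>

lemma analytic_inverse:
  fixes \<Phi> :: "'k::scalar_field ^ 'i::finite \<Rightarrow> 'k ^ 'i"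
  assumes an: "\<And>i. an (\<lambda>v. \<Phi> v $ i) a"
    and id: "\<And>i j. pd j (\<lambda>v. \<Phi> v $ i) a = (if i = j then 1 else 0)"
  obtains W W' \<Psi> where "open W" "a \<in> W" "open W'"
    "\<And>v. v \<in> W \<Longrightarrow> \<Phi> v \<in> W' \<and> \<Psi> (\<Phi> v) = v" "\<And>w. w \<in> W' \<Longrightarrow> \<Psi> w \<in> W \<and> \<Phi> (\<Psi> w) = w"
    "\<And>v i. v \<in> W \<Longrightarrow> an (\<lambda>v. \<Phi> v $ i) v" "\<And>w i. w \<in> W' \<Longrightarrow> an (\<lambda>w. \<Psi> w $ i) w"
proof -
  define Rm where "Rm = (\<lambda>i h. \<Phi> (a + h) $ i - \<Phi> a $ i - h $ i)"
  obtain r0 C0 where r0: "0 < r0" "\<And>i. majorized r0 (C0 i) (\<lambda>h. \<Phi> (a + h) $ i)"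
    using an_common[of UNIV "\<lambda>i v. \<Phi> v $ i" a] an by auto
  define C where "C = 1 + (\<Sum>i\<in>UNIV. C0 i)"
  have C0: "0 \<le> C0 i" for i using majorized_nonneg[OF r0(2)] r0(1) by simp
  have C: "0 < C" "C0 i \<le> C" for i
    using sum_nonneg[of UNIV C0] member_le_sum[of i UNIV C0] C0 by (auto simp: C_def)
  \<comment> \<open>Shrinking by \<open>t\<close> gives \<open>Rm\<close> the norm
    \<open>t ^ 2 * C\<close> at radius \<open>t * r0\<close>, hence the Lipschitz constant
    \<open>t * C / r0\<close>; this choice makes it at most 1/2.\<close>
  define t where "t = min 1 (r0 / (2 * C))"
  have t: "0 < t" "t \<le> 1" "t * C / r0 \<le> 1 / 2"
    using C r0 by (auto simp: t_def min_def field_simps)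
  define \<rho> where "\<rho> = t * r0"
  have \<rho>: "0 < \<rho>" using t r0 by (simp add: \<rho>_def)
  have Rm: "majorized \<rho> (t ^ 2 * C) (Rm i)" for i
  proof -
    obtain c where c: "has_ps r0 (C0 i) c (\<lambda>h. \<Phi> (a + h) $ i)" using r0 by (auto simp: majorized_def)
    have "c (unit_ix j) = (if i = j then 1 else 0)" for j
    proof -
      have "((\<lambda>v. \<Phi> v $ i) has_derivative (\<lambda>k. \<Sum>j\<in>UNIV. c (unit_ix j) * k $ j)) (at (a + 0))"
        unfolding shift_has_derivative[symmetric] by (rule has_ps_derivative_0[OF c r0(1)])
      from pd_eqI[of "\<lambda>v. \<Phi> v $ i" "\<lambda>j. c (unit_ix j)" a j] this id show ?thesis by simp
    qed
    then have "has_ps r0 (C0 i) (\<lambda>\<alpha>. if deg \<alpha> < 2 then 0 else c \<alpha>) (Rm i)"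
      using has_ps_remove_linear[OF c] r0(1) 
      by (simp add: Rm_def if_distrib[where f = "\<lambda>x. x * _"] cong: if_cong)
    then have "has_ps r0 C (\<lambda>\<alpha>. if deg \<alpha> < 2 then 0 else c \<alpha>) (Rm i)"
      by (rule has_ps_cong) (use C in auto)
    from has_ps_scale[OF this, of t 2] t r0(1) show ?thesis
      by (auto simp: majorized_def \<rho>_def)
  qed
  have lip: "majorized s (\<delta> / 2) (\<lambda>h. Rm i (\<chi> j. U j h) - Rm i (\<chi> j. V j h))"
    if "\<And>j. majorized s (\<rho> / 2) (U j)" "\<And>j. majorized s (\<rho> / 2) (V j)"
      "\<And>j. majorized s \<delta> (\<lambda>h. U j h - V j h)" "0 < s" for U V :: "'i \<Rightarrow> 'k ^ 'i \<Rightarrow> 'k" and s \<delta> i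
  proof -
    have "majorized s (t ^ 2 * C / \<rho> * \<delta>) (\<lambda>h. Rm i (\<chi> j. U j h) - Rm i (\<chi> j. V j h))"
      by (rule majorized_compose_diff[OF Rm _ _ that(1,2,3,4)]) (use \<rho> in auto)
    moreover have "0 \<le> \<delta>" using majorized_nonneg[OF that(3)] that(4) by simp
    then have "t ^ 2 * C / \<rho> * \<delta> \<le> 1 / 2 * \<delta>"
      using t r0(1) by (intro mult_right_mono) (auto simp: \<rho>_def power2_eq_square)
    ultimately show ?thesis by (auto elim!: majorized_cong)
  qed
  \<comment> \<open>The iteration sends 0 to \<open>h\<close>, of norm \<open>\<rho> / 4\<close> at
    this radius: half the radius \<open>\<rho> / 2\<close> of the ball in which the fixed point is
    sought.\<close>
  define s where "s = \<rho> / 4"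
  have s: "0 < s" using \<rho> by (simp add: s_def)
  have "\<exists>U. (\<forall>i. majorized s (\<rho> / 2) (U i)) \<and> (\<forall>i h. h \<in> pball s \<longrightarrow> h $ i - Rm i (\<chi> j. U j h) = U i h)"
  proof (rule majorized_fixpoint[OF s, where R = "\<rho> / 2" and T = "\<lambda>U i h. h $ i - Rm i (\<chi> j. U j h)"])
    have "Rm i (\<chi> j. 0) = 0" for i by (simp add: Rm_def flip: zero_vec_def)
    then show "majorized s (\<rho> / 2 / 2) (\<lambda>h. h $ i - Rm i (\<chi> j. 0))" for i
      using majorized_coord[of s i] s by (simp add: s_def)
    show "majorized s (\<delta> / 2) (\<lambda>h. (h $ i - Rm i (\<chi> j. U j h)) - (h $ i - Rm i (\<chi> j. V j h)))"
      if U: "\<And>j. majorized s (\<rho> / 2) (U j)" and V: "\<And>j. majorized s (\<rho> / 2) (V j)"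
      and d: "\<And>j. majorized s \<delta> (\<lambda>h. U j h - V j h)" for U V \<delta> i
      using majorized_cmult[OF lip[OF U V d s] s, of "-1" i] by simp
  qed (use \<rho> in auto)
  then obtain U where U: "\<And>i. majorized s (\<rho> / 2) (U i)"
    and fixU: "\<And>i h. h \<in> pball s \<Longrightarrow> h $ i - Rm i (\<chi> j. U j h) = U i h" by blast
  define \<Psi> where "\<Psi> = (\<lambda>w. a + (\<chi> i. U i (w - \<Phi> a)))"
  have right: "\<Phi> (\<Psi> w) = w" if "w - \<Phi> a \<in> pball s" for w
  proof (rule vec_eq_iff[THEN iffD2], rule allI)
    fix i
    from fixU[OF that, of i] show "\<Phi> (\<Psi> w) $ i = w $ i"
      by (simp add: Rm_def \<Psi>_def algebra_simps)
  qed
  have \<Psi>_mem: "\<Psi> w - a \<in> pball (\<rho> / 2)" if "w - \<Phi> a \<in> pball s" for w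
    unfolding \<Psi>_def using majorized_pball[of s "\<rho>/2" U, OF U that] by simp
  \<comment> \<open>Injectivity follows from the same Lipschitz estimate, applied to constant
    functions in place of \<open>U\<close> and \<open>V\<close>.\<close>
  have inj: "x = y" if x: "x - a \<in> pball (\<rho> / 2)" and y: "y - a \<in> pball (\<rho> / 2)" and eq: "\<Phi> x = \<Phi> y" for x y
  proof -
    define \<delta> where "\<delta> = Max (range (\<lambda>j. norm ((x - y) $ j)))"
    have \<delta>: "norm ((x - y) $ j) \<le> \<delta>" for j unfolding \<delta>_def by (rule Max_ge) auto
    obtain i where i: "\<delta> = norm ((x - y) $ i)"
      using Max_in[of "range (\<lambda>j. norm ((x - y) $ j))"] unfolding \<delta>_def by (metis (mono_tags, lifting) UNIV_I empty_iff finite_class.finite_UNIV finite_imageI image_iff)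
    have *: "majorized 1 \<delta>' (\<lambda>_ :: 'k ^ 'i. k)" if "norm k \<le> \<delta>'" for \<delta>' and k :: 'k
      by (rule majorized_cong[OF majorized_const that]) auto
    have "majorized 1 (\<delta> / 2) (\<lambda>h :: 'k ^ 'i. Rm i (\<chi> j. (x - a) $ j) - Rm i (\<chi> j. (y - a) $ j))"
      by (rule lip; (rule *)?) (use pballD[OF x] pballD[OF y] \<delta> in auto)
    from majorized_bound[OF this, of 0]
    have "norm (Rm i (x - a) - Rm i (y - a)) \<le> \<delta> / 2" unfolding vec_lambda_eta using s by simp
    moreover have "Rm i (x - a) - Rm i (y - a) = - ((x - y) $ i)"
      by (simp add: Rm_def eq)
    ultimately have "\<delta> \<le> \<delta> / 2" by (simp only: i norm_minus_cancel)
    then have "norm ((x - y) $ j) \<le> 0" for j using \<delta>[of j] by linarith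
    then have "(x - y) $ j = 0" for j by (simp only: norm_le_zero_iff)
    then show ?thesis by (simp add: vec_eq_iff)
  qed
  have an\<Psi>: "an (\<lambda>w. \<Psi> w $ i) (\<Phi> a)" for i
  proof -
    have "majorized s (norm (a $ i) + \<rho> / 2) (\<lambda>h. a $ i + U i h)"
      by (intro majorized_add majorized_const U s) (use s in simp)
    then show ?thesis by (intro anI[of s "norm (a $ i) + \<rho> / 2"]) (auto simp: \<Psi>_def s)
  qed
  have \<Psi>a: "\<Psi> (\<Phi> a) = a"
    by (rule inj) (use \<Psi>_mem[of "\<Phi> a"] right[of "\<Phi> a"] s \<rho> in auto)
  have near: "\<forall>\<^sub>F v in nhds c. v - c \<in> pball e" if "0 < e" for e and c :: "'k ^ 'i"
  proof -
    have "((\<lambda>b. b - c) \<longlongrightarrow> c - c) (nhds c)" by (intro tendsto_diff filterlim_ident tendsto_const)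
    then have "filterlim (\<lambda>b. b - c) (nhds 0) (nhds c)" by simp
    from eventually_compose_filterlim[OF eventually_pball this] that show ?thesis by simp
  qed
  have "\<forall>\<^sub>F v in nhds a. v - a \<in> pball (\<rho> / 2) \<and> (\<forall>i. an (\<lambda>v. \<Phi> v $ i) v)"
    by (intro eventually_conj near eventually_all_finite an_eventually an) (use \<rho> in auto)
  then obtain O1 where O1: "open O1" "a \<in> O1" "\<And>v. v \<in> O1 \<Longrightarrow> v - a \<in> pball (\<rho> / 2)"
    "\<And>v i. v \<in> O1 \<Longrightarrow> an (\<lambda>v. \<Phi> v $ i) v" unfolding eventually_nhds by blast
  have "isCont \<Psi> (\<Phi> a)" by (rule an_isCont_vec[OF an\<Psi>])
  then have "(\<Psi> \<longlongrightarrow> a) (nhds (\<Phi> a))"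
    by (simp add: continuous_at \<Psi>a tendsto_nhds_iff)
  from topological_tendstoD[OF this O1(1,2)] have "\<forall>\<^sub>F w in nhds (\<Phi> a). \<Psi> w \<in> O1" .
  then have "\<forall>\<^sub>F w in nhds (\<Phi> a). \<Psi> w \<in> O1 \<and> w - \<Phi> a \<in> pball s \<and> (\<forall>i. an (\<lambda>v. \<Psi> v $ i) w)"
    by (intro eventually_conj near eventually_all_finite an_eventually an\<Psi>) (use s in auto)
  then obtain W' where W': "open W'" "\<Phi> a \<in> W'" "\<And>w. w \<in> W' \<Longrightarrow> \<Psi> w \<in> O1"
    "\<And>w. w \<in> W' \<Longrightarrow> w - \<Phi> a \<in> pball s" "\<And>w i. w \<in> W' \<Longrightarrow> an (\<lambda>v. \<Psi> v $ i) w"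
    unfolding eventually_nhds by blast
  \<comment> \<open>Cutting down to the preimage of \<open>W'\<close> makes \<Phi> and \<Psi>
    mutually inverse between \<open>W\<close> and \<open>W'\<close>.\<close>
  define W where "W = {v \<in> O1. \<Phi> v \<in> W'}"
  have "continuous_on O1 \<Phi>"
    by (rule continuous_at_imp_continuous_on) (use O1 an_isCont_vec in blast)
  moreover have W_eq: "W = O1 \<inter> \<Phi> -` W'" by (auto simp: W_def)
  ultimately have "open W"
    using continuous_open_preimage[OF _ O1(1) W'(1)] by simp
  moreover have "a \<in> W" using O1(2) W'(2) by (simp add: W_def)
  moreover have "\<Phi> v \<in> W' \<and> \<Psi> (\<Phi> v) = v" if "v \<in> W" for v
  proof -
    have v: "v \<in> O1" "\<Phi> v \<in> W'" using that by (simp_all add: W_def)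
    note m = W'(4)[OF v(2)]
    show ?thesis using inj[OF \<Psi>_mem[OF m] O1(3)[OF v(1)] right[OF m]] v(2) by simp
  qed
  moreover have "\<Psi> w \<in> W \<and> \<Phi> (\<Psi> w) = w" if "w \<in> W'" for w
    unfolding W_def using W'(3)[OF that] right[OF W'(4)[OF that]] that by simp
  moreover have "an (\<lambda>v. \<Phi> v $ i) v" if "v \<in> W" for v i
    by (rule O1(4)) (use that in \<open>simp add: W_def\<close>)
  ultimately show thesis
    by (intro that[of W W' \<Psi>] W'(1) W'(5))
qed

section \<open>The Frobenius theorem\<close>

definition join :: "'k ^ 'i \<Rightarrow> 'k ^ 'r \<Rightarrow> 'k ^ ('i + 'r)" where
  "join z u = (\<chi> m. case m of Inl i \<Rightarrow> z $ i | Inr q \<Rightarrow> u $ q)"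

lemma join_nth [simp]: "join z u $ Inl i = z $ i" "join z u $ Inr q = u $ q"
  by (simp_all add: join_def)

lemma sum_UNIV_Plus:
  "(\<Sum>m\<in>UNIV. g m) = (\<Sum>i\<in>UNIV. g (Inl i)) + (\<Sum>q\<in>UNIV. g (Inr q))"
  for g :: "'i::finite + 'r::finite \<Rightarrow> 'a::comm_monoid_add"
  by (simp add: UNIV_Plus_UNIV[symmetric] sum.Plus del: UNIV_Plus_UNIV)

text \<open>A linear system \<open>e' = A e\<close> along a segment with small coefficients and \<open>e 0 = 0\<close>:
  the maximum of \<open>\<Sum>\<bar>e\<bar>\<close> is at most half of itself.\<close>

lemma small_linear_ode_zero:
  fixes e :: "'r::finite \<Rightarrow> real \<Rightarrow> 'k::scalar_field"
  assumes e0: "\<And>l. e l 0 = 0"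
    and e': "\<And>l t. t \<in> {0..1} \<Longrightarrow> (e l has_vector_derivative (\<Sum>q\<in>UNIV. A l q t * e q t)) (at t)"
    and A: "\<And>l q t. t \<in> {0..1} \<Longrightarrow> norm (A l q t) \<le> \<kappa>" and \<kappa>: "real CARD('r) * \<kappa> \<le> 1 / 2"
    and t: "t \<in> {0..1}"
  shows "e l t = 0"
proof -
  define N where "N = (\<lambda>t. \<Sum>l\<in>UNIV. norm (e l t))"
  have cont: "continuous_on {0..1} (e l)" for l
    by (rule continuous_at_imp_continuous_on) (auto intro: has_vector_derivative_continuous e')
  have "\<exists>x\<in>{0..1}. \<forall>y\<in>{0..1}. N y \<le> N x"
    by (rule continuous_attains_sup) (auto simp: N_def intro!: continuous_intros cont)
  then obtain x where x: "x \<in> {0..1}" "\<And>y. y \<in> {0..1} \<Longrightarrow> N y \<le> N x" by blast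
  have \<kappa>0: "0 \<le> \<kappa>" using order_trans[OF norm_ge_zero A[of 0 undefined undefined]] by simp
  have "norm (e l x) \<le> \<kappa> * N x" for l
  proof (cases "x = 0")
    case False
    with x have x0: "0 < x" by auto
    have "continuous_on {0..x} (e l)" by (rule continuous_on_subset[OF cont]) (use x in auto)
    moreover have "(e l has_derivative (\<lambda>s. s *\<^sub>R (\<Sum>q\<in>UNIV. A l q y * e q y))) (at y)" if "y \<in> {0<..<x}" for y
      using e'[of y l] that x unfolding has_vector_derivative_def by auto
    ultimately obtain y where y: "y \<in> {0<..<x}"
      "norm (e l x - e l 0) \<le> norm ((x - 0) *\<^sub>R (\<Sum>q\<in>UNIV. A l q y * e q y))"
      using mvt_general[OF x0, where f = "e l" and f' = "\<lambda>y s. s *\<^sub>R (\<Sum>q\<in>UNIV. A l q y * e q y)"] by auto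
    have y01: "y \<in> {0..1}" using y x by auto
    have "norm (e l x) \<le> x * norm (\<Sum>q\<in>UNIV. A l q y * e q y)" using y x0 by (simp add: e0)
    also have "\<dots> \<le> 1 * norm (\<Sum>q\<in>UNIV. A l q y * e q y)" using x by (intro mult_right_mono) auto
    also have "\<dots> \<le> (\<Sum>q\<in>UNIV. \<kappa> * norm (e q y))"
      unfolding mult_1 by (rule sum_norm_le) (auto simp: norm_mult intro!: mult_right_mono A[OF y01])
    also have "\<dots> = \<kappa> * N y" by (simp add: N_def sum_distrib_left)
    also have "\<dots> \<le> \<kappa> * N x" by (rule mult_left_mono[OF x(2)[OF y01] \<kappa>0])
    finally show ?thesis .
  qed (use \<kappa>0 in \<open>auto simp: e0 N_def intro!: mult_nonneg_nonneg sum_nonneg\<close>)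
  then have "N x \<le> (\<Sum>l\<in>(UNIV :: 'r set). \<kappa> * N x)" by (subst (1) N_def) (intro sum_mono, simp)
  also have "\<dots> = real CARD('r) * \<kappa> * N x" by simp
  also have "\<dots> \<le> 1 / 2 * N x" by (rule mult_right_mono[OF \<kappa>]) (auto simp: N_def intro: sum_nonneg)
  finally have "N x \<le> 0" by simp
  with x(2)[OF t] have "N t \<le> 0" by simp
  moreover have "norm (e l t) \<le> N t" unfolding N_def by (rule member_le_sum) auto
  ultimately have "norm (e l t) \<le> 0" by linarith
  then show ?thesis by simp
qed

text \<open>The radial component of an overdetermined system is solvable whether or not the system
  is integrable: \<open>V\<close> is the fixed point of \<open>T\<close>, which integrates the
  right-hand side along rays. Differentiating at the end of the ray gives the last
  conclusion.\<close>

lemma ray_system: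
  fixes F :: "'i::finite \<Rightarrow> 'r::finite \<Rightarrow> 'k::scalar_field ^ ('i + 'r) \<Rightarrow> 'k"
  assumes an: "\<And>j l. an (F j l) (join a b)"
  obtains V r where "0 < r" "\<And>l. an (V l) 0" "\<And>l. V l 0 = 0"
    "\<And>l h. h \<in> pball r \<Longrightarrow> (\<Sum>j\<in>UNIV. pd j (V l) h * h $ j) =
       (\<Sum>j\<in>UNIV. h $ j * F j l (join a b + join h (\<chi> q. V q h)))"
proof -
  obtain \<rho> C0 where \<rho>: "0 < \<rho>" "\<And>j l. majorized \<rho> (C0 (j, l)) (\<lambda>h. F j l (join a b + h))"
    using an_common[of UNIV "\<lambda>(j, l). F j l" "join a b"] an by (auto simp: split_beta)
  define C where "C = 1 + (\<Sum>x\<in>UNIV. C0 x)"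
  have C00: "0 \<le> C0 x" for x using majorized_nonneg[OF \<rho>(2)[of "fst x" "snd x"]] \<rho>(1) by simp
  have C: "0 < C" "C0 x \<le> C" for x
    using sum_nonneg[of UNIV C0] member_le_sum[of x UNIV C0] C00 by (auto simp: C_def)
  have F: "majorized \<rho> C (\<lambda>h. F j l (join a b + h))" for j l
    by (rule majorized_cong[OF \<rho>(2) C(2)]) simp
  define n where "n = real CARD('i)"
  have n: "0 < n" by (simp add: n_def)
  \<comment> \<open>The first bound keeps the pair of \<open>h\<close> and \<open>V\<close> at half
    the radius \<rho>, as \<open>majorized_compose_diff\<close> requires. The second gives
    \<open>n * r * C \<le> \<rho> / 4\<close>, which puts \<open>T\<close> of 0 into half the ball
    and makes \<open>T\<close> contract.\<close>
  define r where "r = min (\<rho> / 2) (\<rho> / (4 * n * C))"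
  have r: "0 < r" "r \<le> \<rho> / 2" "n * r * C \<le> \<rho> / 4"
    using \<rho> C n by (auto simp: r_def min_def field_simps)
  define W where "W = (\<lambda>(V :: 'r \<Rightarrow> 'k ^ 'i \<Rightarrow> 'k) m h. case m of Inl i \<Rightarrow> h $ i | Inr q \<Rightarrow> V q h)"
  define G where "G = (\<lambda>V j l h. F j l (join a b + (\<chi> m. W V m h)))"
  define T where "T = (\<lambda>V l h. \<Sum>j\<in>UNIV. h $ j * integral {0..1} (\<lambda>t. G V j l (t *\<^sub>R h)))"
  have W: "majorized r (\<rho> / 2) (W V m)" if "\<And>q. majorized r (\<rho> / 2) (V q)" for V m
    using that r by (cases m) (auto simp: W_def intro!: majorized_cong[OF majorized_coord])
  have G: "majorized r C (G V j l)" if "\<And>q. majorized r (\<rho> / 2) (V q)" for V j l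
  proof -
    have "majorized r \<rho> (W V m)" for m by (rule majorized_cong[OF W[OF that]]) (use \<rho> in auto)
    then show ?thesis unfolding G_def by (intro majorized_compose[OF F] r)
  qed
  have n_sum: "(\<Sum>j\<in>(UNIV :: 'i set). r * c) = n * r * c" for c by (simp add: n_def)
  have T: "majorized r (n * r * C) (T V l)" if "\<And>q. majorized r (\<rho> / 2) (V q)" for V l
    unfolding T_def n_sum[symmetric]
    by (intro majorized_sum majorized_mult majorized_coord majorized_ray_integral G that r) (use r in auto)
  have "\<exists>V. (\<forall>q. majorized r (\<rho> / 2) (V q)) \<and> (\<forall>l h. h \<in> pball r \<longrightarrow> T V l h = V l h)"
  proof (rule majorized_fixpoint[OF r(1), where R = "\<rho> / 2" and T = T])
    show "majorized r (\<rho> / 2 / 2) (T (\<lambda>_ _. 0) l)" for l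
    proof (rule majorized_cong[OF T])
      show "majorized r (\<rho> / 2) (\<lambda>_ :: 'k ^ 'i. 0)"
        by (rule majorized_cong[OF majorized_const]) (use r \<rho> in auto)
    qed (use r in auto)
    show "majorized r (\<delta> / 2) (\<lambda>h. T U l h - T V l h)"
      if U: "\<And>q. majorized r (\<rho> / 2) (U q)" and V: "\<And>q. majorized r (\<rho> / 2) (V q)"
      and d: "\<And>q. majorized r \<delta> (\<lambda>h. U q h - V q h)" for U V \<delta> l
    proof -
      have \<delta>: "0 \<le> \<delta>" using majorized_nonneg[OF d] r by simp
      have Wd: "majorized r \<delta> (\<lambda>h. W U m h - W V m h)" for m
      proof (cases m)
        case (Inl i)
        have "majorized r \<delta> (\<lambda>_ :: 'k ^ 'i. 0)"
          by (rule majorized_cong[OF majorized_const[where k = 0]]) (use r \<delta> in auto)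
        with Inl show ?thesis by (simp add: W_def)
      qed (use d in \<open>simp add: W_def\<close>)
      have Gd: "majorized r (C / \<rho> * \<delta>) (\<lambda>h. G U j l h - G V j l h)" for j
        unfolding G_def by (rule majorized_compose_diff[OF F _ _ W[OF U] W[OF V] Wd r(1)]) (use \<rho> in auto)
      have "majorized r (n * r * (C / \<rho> * \<delta>))
          (\<lambda>h. \<Sum>j\<in>UNIV. h $ j * integral {0..1} (\<lambda>t. G U j l (t *\<^sub>R h) - G V j l (t *\<^sub>R h)))"
        unfolding n_sum[symmetric]
        by (intro majorized_sum majorized_mult majorized_coord majorized_ray_integral[OF Gd] r) (use r in auto)
      moreover have "n * r * (C / \<rho> * \<delta>) \<le> \<delta> / 2"
      proof -
        have "n * r * (C / \<rho> * \<delta>) = n * r * C / \<rho> * \<delta>" by simp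
        also have "\<dots> \<le> \<rho> / 4 / \<rho> * \<delta>" using r \<rho> \<delta> by (intro mult_right_mono divide_right_mono) auto
        also have "\<dots> \<le> \<delta> / 2" using \<rho> \<delta> by simp
        finally show ?thesis .
      qed
      ultimately show ?thesis
      proof (rule majorized_cong)
        fix h :: "'k ^ 'i" assume h: "h \<in> pball r"
        show "(\<Sum>j\<in>UNIV. h $ j * integral {0..1} (\<lambda>t. G U j l (t *\<^sub>R h) - G V j l (t *\<^sub>R h))) = T U l h - T V l h"
          unfolding T_def sum_subtractf[symmetric] right_diff_distrib[symmetric]
          by (intro sum.cong refl arg_cong2[where f = "(*)"] integral_diff majorized_ray_integrable[OF G _ h] U V r)
      qed
    qed
  qed (use \<rho> in auto)
  then obtain V where V: "\<And>q. majorized r (\<rho> / 2) (V q)" and TV: "\<And>l h. h \<in> pball r \<Longrightarrow> T V l h = V l h"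
    by blast
  have anV: "an (V l) h" if "h \<in> pball (r / 2)" for l h
  proof -
    obtain c where "has_ps r (\<rho> / 2) c (V l)" using V by (auto simp: majorized_def)
    then have "has_ps (r / 2) (\<rho> / 2) (\<lambda>\<gamma>. taylor_coeff c \<gamma> h) (\<lambda>k. V l (h + k))"
      by (rule has_ps_recenter) (use r that in auto)
    then show ?thesis using r by (intro anI[of "r/2" "\<rho>/2"]) (auto simp: majorized_def)
  qed
  show thesis
  proof (rule that[of "r / 2" V])
    show "0 < r / 2" using r by simp
    show "an (V l) 0" for l by (rule anV) (use r in simp)
    show "V l 0 = 0" for l using TV[of 0 l] r by (simp add: T_def)
    fix l and h :: "'k ^ 'i" assume h: "h \<in> pball (r / 2)"
    have hr: "h \<in> pball r" by (rule pball_mono[OF _ h]) (use r in simp)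
    have "((\<lambda>s. \<Sum>j\<in>UNIV. h $ j * (s *\<^sub>R integral {0..1} (\<lambda>t. G V j l ((t * s) *\<^sub>R h)))) has_vector_derivative
        (\<Sum>j\<in>UNIV. h $ j * G V j l (1 *\<^sub>R h))) (at 1 within {0..1})"
      by (intro has_vector_derivative_sum has_vector_derivative_mult_right ray_integral_derivative
          majorized_ray_continuous[OF G[OF V] r(1) hr])
    then have 1: "((\<lambda>s. V l (s *\<^sub>R h)) has_vector_derivative (\<Sum>j\<in>UNIV. h $ j * G V j l (1 *\<^sub>R h))) (at 1 within {0..1})"
    proof (rule has_vector_derivative_transform[rotated 2])
      fix s :: real assume "s \<in> {0..1}"
      then have "s *\<^sub>R h \<in> pball r" using hr by (intro pball_scaleR) auto
      from TV[OF this, of l]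
      show "V l (s *\<^sub>R h) = (\<Sum>j\<in>UNIV. h $ j * (s *\<^sub>R integral {0..1} (\<lambda>t. G V j l ((t * s) *\<^sub>R h))))"
        by (simp add: T_def)
    qed simp
    have "((\<lambda>s. s *\<^sub>R h) has_derivative (\<lambda>s. s *\<^sub>R h)) (at 1 within {0..1})"
      by (auto intro!: derivative_eq_intros)
    from has_derivative_compose[OF this, of "V l" "\<lambda>k. \<Sum>i\<in>UNIV. pd i (V l) h * k $ i"]
    have 2: "((\<lambda>s. V l (s *\<^sub>R h)) has_vector_derivative (\<Sum>j\<in>UNIV. pd j (V l) h * h $ j)) (at 1 within {0..1})"
      using an_has_derivative[OF anV[OF h, of l]] by (simp add: has_vector_derivative_def scaleR_sum_right)
    have "(\<Sum>j\<in>UNIV. pd j (V l) h * h $ j) = (\<Sum>j\<in>UNIV. h $ j * G V j l (1 *\<^sub>R h))"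
      by (rule vector_derivative_unique_within[OF _ 2 1]) (simp add: at_within_Icc_at_left)
    moreover have "(\<chi> m. W V m h) = join h (\<chi> q. V q h)"
      by (auto simp: vec_eq_iff W_def join_def split: sum.split)
    ultimately show "(\<Sum>j\<in>UNIV. pd j (V l) h * h $ j) = (\<Sum>j\<in>UNIV. h $ j * F j l (join a b + join h (\<chi> q. V q h)))"
      by (simp add: G_def)
  qed
qed


text \<open>\<open>E\<close> measures how far the radial solution is from solving the whole system;
  its radial component vanishes. Differentiating this relation and exchanging the two indices by
  integrability gives a linear homogeneous system along each ray for \<open>t\<close> times
  \<open>E\<close> at \<open>t h\<close>. The initial value is 0, hence
  \<open>E = 0\<close>.\<close>

lemma frobenius:
  fixes F :: "'i::finite \<Rightarrow> 'r::finite \<Rightarrow> 'k::scalar_field ^ ('i + 'r) \<Rightarrow> 'k"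
  assumes an: "\<And>j l. an (F j l) (join a b)"
    and ci: "\<forall>\<^sub>F v in nhds (join a b). \<forall>j k l.
        pd (Inl j) (F k l) v + (\<Sum>q\<in>UNIV. F j q v * pd (Inr q) (F k l) v) =
        pd (Inl k) (F j l) v + (\<Sum>q\<in>UNIV. F k q v * pd (Inr q) (F j l) v)"
  obtains U where "U a = b" "\<And>l. an (\<lambda>z. U z $ l) a"
    "\<forall>\<^sub>F z in nhds a. \<forall>j l. pd j (\<lambda>z. U z $ l) z = F j l (join z (U z))"
proof -
  obtain V r where r: "0 < r" and anV: "\<And>l. an (V l) 0" and V0: "\<And>l. V l 0 = 0"
    and euler: "\<And>l h. h \<in> pball r \<Longrightarrow> (\<Sum>j\<in>UNIV. pd j (V l) h * h $ j) =
       (\<Sum>j\<in>UNIV. h $ j * F j l (join a b + join h (\<chi> q. V q h)))"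
  proof (rule ray_system[where F = F and a = a and b = b])
    show "an (F j l) (join a b)" for j l by (rule an)
  qed (rule that)
  define W where "W = (\<lambda>m h. case m of Inl i \<Rightarrow> a $ i + h $ i | Inr q \<Rightarrow> b $ q + V q h)"
  define J where "J = (\<lambda>h. \<chi> m. W m h)"
  have J_eq: "join a b + join h (\<chi> q. V q h) = J h" for h
    by (auto simp: vec_eq_iff J_def W_def join_def split: sum.split)
  have J0: "J 0 = join a b" by (auto simp: vec_eq_iff J_def W_def join_def V0 split: sum.split)
  have anW: "an (W m) h" if "\<And>l. an (V l) h" for m h
    using that by (cases m) (auto simp: W_def intro: an_add an_const an_nth)
  have "isCont J 0"
    by (rule an_isCont_vec) (simp add: J_def anW anV)
  then have J_lim: "(J \<longlongrightarrow> join a b) (nhds 0)" by (simp add: continuous_at J0 tendsto_nhds_iff)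
  define B where "B = 1 + (\<Sum>(j, l, q)\<in>UNIV. norm (pd (Inr q) (F j l) (join a b)))"
  have B_gt: "norm (pd (Inr q) (F j l) (join a b)) < B" for j l q
    using member_le_sum[of "(j, l, q)" UNIV "\<lambda>(j, l, q). norm (pd (Inr q) (F j l) (join a b))"]
    by (auto simp: B_def split_beta)
  have B0: "0 < B" using order_le_less_trans[OF norm_ge_zero B_gt] .
  have "\<forall>\<^sub>F v in nhds (join a b). norm (pd (Inr q) (F j l) v) < B" for j l q
  proof -
    have "isCont (\<lambda>v. norm (pd (Inr q) (F j l) v)) (join a b)"
      by (intro isCont_norm an_isCont an_pd an)
    then have "((\<lambda>v. norm (pd (Inr q) (F j l) v)) \<longlongrightarrow> norm (pd (Inr q) (F j l) (join a b))) (nhds (join a b))"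
      by (simp add: continuous_at tendsto_nhds_iff)
    from order_tendstoD(2)[OF this B_gt] show ?thesis .
  qed
  then have "\<forall>\<^sub>F v in nhds (join a b). (\<forall>j l. an (F j l) v) \<and> (\<forall>j l q. norm (pd (Inr q) (F j l) v) < B)"
    by (intro eventually_conj eventually_all_finite an_eventually an)
  from eventually_compose_filterlim[OF eventually_conj[OF this ci] J_lim]
  have "\<forall>\<^sub>F h in nhds 0. ((\<forall>j l. an (F j l) (J h)) \<and> (\<forall>j l q. norm (pd (Inr q) (F j l) (J h)) < B) \<and>
      (\<forall>j k l. pd (Inl j) (F k l) (J h) + (\<Sum>q\<in>UNIV. F j q (J h) * pd (Inr q) (F k l) (J h)) =
        pd (Inl k) (F j l) (J h) + (\<Sum>q\<in>UNIV. F k q (J h) * pd (Inr q) (F j l) (J h)))) \<and>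
      (\<forall>l. an (V l) h) \<and> h \<in> pball r"
    using r by (intro eventually_conj[OF _ eventually_conj[OF eventually_all_finite[OF an_eventually[OF anV]] eventually_pball]]) simp_all
  then obtain \<epsilon>0 where \<epsilon>0: "0 < \<epsilon>0" and good: "\<And>h. dist h 0 < \<epsilon>0 \<Longrightarrow>
      ((\<forall>j l. an (F j l) (J h)) \<and> (\<forall>j l q. norm (pd (Inr q) (F j l) (J h)) < B) \<and>
      (\<forall>j k l. pd (Inl j) (F k l) (J h) + (\<Sum>q\<in>UNIV. F j q (J h) * pd (Inr q) (F k l) (J h)) =
        pd (Inl k) (F j l) (J h) + (\<Sum>q\<in>UNIV. F k q (J h) * pd (Inr q) (F j l) (J h)))) \<and>
      (\<forall>l. an (V l) h) \<and> h \<in> pball r"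
    unfolding eventually_nhds_metric by blast
  define n where "n = real CARD('i) * real CARD('r) * B"
  have n: "0 < n" using B0 by (simp add: n_def)
  \<comment> \<open>On the ball of radius \<epsilon> the coefficients of the linear system are at
    most \<open>CARD('i) * (\<epsilon> * B)\<close>. The bound 1/2 on \<open>n * \<epsilon>\<close>
    is the smallness that \<open>small_linear_ode_zero\<close> asks for.\<close>
  define \<epsilon> where "\<epsilon> = min \<epsilon>0 (1 / (2 * n))"
  have \<epsilon>: "0 < \<epsilon>" "\<epsilon> \<le> \<epsilon>0" "n * \<epsilon> \<le> 1 / 2"
    using \<epsilon>0 n by (auto simp: \<epsilon>_def min_def field_simps)
  define O1 where "O1 = ball (0 :: 'k ^ 'i) \<epsilon>"
  have O1: "an (F j l) (J h)" "norm (pd (Inr q) (F j l) (J h)) \<le> B"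
      "pd (Inl j) (F k l) (J h) + (\<Sum>q\<in>UNIV. F j q (J h) * pd (Inr q) (F k l) (J h)) =
        pd (Inl k) (F j l) (J h) + (\<Sum>q\<in>UNIV. F k q (J h) * pd (Inr q) (F j l) (J h))"
      "an (V l) h" "h \<in> pball r" if "h \<in> O1" for h j k l q
    using good[of h] that \<epsilon> by (auto simp: O1_def dist_commute less_imp_le)
  have anJ: "an (\<lambda>h. F j l (J h)) h" if "h \<in> O1" for j l h
    unfolding J_def by (rule an_compose) (use O1[OF that] anW in \<open>auto simp: J_def\<close>)
  define E where "E = (\<lambda>j l h. pd j (V l) h - F j l (J h))"
  have anE: "an (E j l) h" if "h \<in> O1" for j l h
    unfolding E_def by (intro an_diff an_pd O1 anJ that)
  have Esum: "(\<Sum>k\<in>UNIV. h $ k * E k l h) = 0" if "h \<in> O1" for h l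
    using euler[OF O1(5)[OF that], of l] by (simp add: E_def J_eq right_diff_distrib sum_subtractf mult.commute)
  \<comment> \<open>\<open>E\<close> enters because the derivative of \<open>V q\<close> is
    \<open>F j q + E j q\<close>. The part without \<open>E\<close> is the expression that
    \<open>ci\<close> makes symmetric in \<open>j\<close> and \<open>k\<close>.\<close>
  have pdF: "pd j (\<lambda>h. F k l (J h)) h =
      pd (Inl j) (F k l) (J h) + (\<Sum>q\<in>UNIV. pd (Inr q) (F k l) (J h) * (F j q (J h) + E j q h))"
    if h: "h \<in> O1" for j k l h
  proof -
    have "pd j (\<lambda>h. F k l (\<chi> m. W m h)) h = (\<Sum>m\<in>UNIV. pd m (F k l) (\<chi> m. W m h) * pd j (W m) h)"
      by (rule pd_compose) (use O1[OF h] anW in \<open>auto simp: J_def\<close>)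
    moreover have "pd j (W (Inl i)) h = (if i = j then 1 else 0)" for i
      by (simp add: W_def pd_add an_const an_nth pd_nth)
    moreover have "pd j (W (Inr q)) h = F j q (J h) + E j q h" for q
      by (simp add: W_def pd_add an_const O1[OF h] E_def)
    ultimately show ?thesis
      by (simp add: sum_UNIV_Plus J_def if_distrib[where f = "\<lambda>x. _ * x"] cong: if_cong)
  qed
  \<comment> \<open>\<open>I\<close> is the derivative of \<open>Esum\<close>. Exchanging
    \<open>j\<close> and \<open>k\<close> in it leaves two error sums, and the one with
    \<open>E k q\<close> is killed by \<open>Esum\<close> once more.\<close>
  have II: "E j l h + (\<Sum>k\<in>UNIV. h $ k * pd k (E j l) h) =
      (\<Sum>q\<in>UNIV. (\<Sum>k\<in>UNIV. h $ k * pd (Inr q) (F k l) (J h)) * E j q h)" if h: "h \<in> O1" for j l h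
  proof -
    have "\<forall>\<^sub>F x in nhds h. x \<in> O1" using h by (intro eventually_nhds_in_open) (auto simp: O1_def)
    then have "pd j (\<lambda>h. \<Sum>k\<in>UNIV. h $ k * E k l h) h = pd j (\<lambda>_. 0) h"
      by (intro pd_cong an_sum an_mult an_nth anE h) (auto elim!: eventually_mono simp: Esum)
    then have I: "E j l h + (\<Sum>k\<in>UNIV. h $ k * pd j (E k l) h) = 0"
      by (simp add: pd_sum pd_mult an_mult an_nth anE h pd_nth sum.distrib if_distrib[where f = "\<lambda>x. x * _"] cong: if_cong)
    have swap: "pd j (E k l) h = pd k (E j l) h - (\<Sum>q\<in>UNIV. pd (Inr q) (F k l) (J h) * E j q h)
        + (\<Sum>q\<in>UNIV. pd (Inr q) (F j l) (J h) * E k q h)" for k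
    proof -
      have "pd j (E k l) h = pd j (pd k (V l)) h - pd j (\<lambda>h. F k l (J h)) h" for j k
        unfolding E_def by (intro pd_diff an_pd O1 anJ h)
      moreover have "pd j (pd k (V l)) h = pd k (pd j (V l)) h" by (rule pd_commute[OF O1(4)[OF h]])
      moreover have "pd j (\<lambda>h. F k l (J h)) h =
          (pd (Inl j) (F k l) (J h) + (\<Sum>q\<in>UNIV. F j q (J h) * pd (Inr q) (F k l) (J h))) +
          (\<Sum>q\<in>UNIV. pd (Inr q) (F k l) (J h) * E j q h)" for j k
        by (simp add: pdF[OF h] distrib_left sum.distrib mult.commute)
      ultimately show ?thesis
        by (simp only: O1(3)[OF h, of j k l]) (simp only: algebra_simps)
    qed
    have "(\<Sum>k\<in>UNIV. h $ k * (\<Sum>q\<in>UNIV. pd (Inr q) (F j l) (J h) * E k q h)) =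
        (\<Sum>q\<in>UNIV. pd (Inr q) (F j l) (J h) * (\<Sum>k\<in>UNIV. h $ k * E k q h))"
      unfolding sum_distrib_left by (subst sum.swap) (simp add: mult_ac)
    then have z: "(\<Sum>k\<in>UNIV. h $ k * (\<Sum>q\<in>UNIV. pd (Inr q) (F j l) (J h) * E k q h)) = 0"
      by (simp add: Esum[OF h])
    have s: "(\<Sum>k\<in>UNIV. h $ k * (\<Sum>q\<in>UNIV. pd (Inr q) (F k l) (J h) * E j q h)) =
        (\<Sum>q\<in>UNIV. (\<Sum>k\<in>UNIV. h $ k * pd (Inr q) (F k l) (J h)) * E j q h)"
      unfolding sum_distrib_left sum_distrib_right by (subst sum.swap) (simp add: mult_ac)
    have "(\<Sum>k\<in>UNIV. h $ k * pd j (E k l) h) = (\<Sum>k\<in>UNIV. h $ k * pd k (E j l) h)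
        - (\<Sum>q\<in>UNIV. (\<Sum>k\<in>UNIV. h $ k * pd (Inr q) (F k l) (J h)) * E j q h)"
      unfolding swap s[symmetric] distrib_left right_diff_distrib sum.distrib sum_subtractf z by simp
    with I show ?thesis by (simp add: algebra_simps)
  qed
  have E0: "E j l h = 0" if h: "h \<in> O1" for j l h
  proof -
    \<comment> \<open>The factor \<open>t\<close> absorbs the undifferentiated term of
      \<open>II\<close> and provides the zero initial value.\<close>
    define e where "e = (\<lambda>l (t::real). of_real t * E j l (t *\<^sub>R h))"
    define A where "A = (\<lambda>l q (t::real). \<Sum>k\<in>UNIV. h $ k * pd (Inr q) (F k l) (J (t *\<^sub>R h)))"
    have th: "t *\<^sub>R h \<in> O1" if "t \<in> {0..1}" for t
    proof -
      have "t * norm h \<le> norm h" using that by (intro mult_left_le_one_le) auto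
      then show ?thesis using h that by (simp add: O1_def)
    qed
    have "e l 1 = 0"
    proof (rule small_linear_ode_zero[where A = A and \<kappa> = "real CARD('i) * (\<epsilon> * B)"])
      show "e l 0 = 0" for l by (simp add: e_def)
      show "real CARD('r) * (real CARD('i) * (\<epsilon> * B)) \<le> 1 / 2"
        using \<epsilon>(3) by (simp add: n_def mult_ac)
      show "norm (A l q t) \<le> real CARD('i) * (\<epsilon> * B)" if "t \<in> {0..1}" for l q t
      proof -
        have "norm (h $ k) \<le> \<epsilon>" for k
          using h Finite_Cartesian_Product.norm_nth_le[of h k] by (simp add: O1_def)
        then have "norm (h $ k * pd (Inr q) (F k l) (J (t *\<^sub>R h))) \<le> \<epsilon> * B" for k
          unfolding norm_mult using O1(2)[OF th[OF that]] \<epsilon> by (intro mult_mono) auto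
        then show ?thesis unfolding A_def by (intro order_trans[OF norm_sum] sum_bounded_above) auto
      qed
      show "(e l has_vector_derivative (\<Sum>q\<in>UNIV. A l q t * e q t)) (at t)" if t: "t \<in> {0..1}" for l t
      proof -
        have "((\<lambda>s. s *\<^sub>R h) has_derivative (\<lambda>s. s *\<^sub>R h)) (at t)"
          by (auto intro!: derivative_eq_intros)
        from has_derivative_compose[OF this an_has_derivative[OF anE[OF th[OF t]]], of j l]
        have "((\<lambda>s. E j l (s *\<^sub>R h)) has_vector_derivative (\<Sum>k\<in>UNIV. pd k (E j l) (t *\<^sub>R h) * h $ k)) (at t)"
          by (simp add: has_vector_derivative_def scaleR_sum_right)
        then have "((\<lambda>s. s *\<^sub>R E j l (s *\<^sub>R h)) has_vector_derivative
            t *\<^sub>R (\<Sum>k\<in>UNIV. pd k (E j l) (t *\<^sub>R h) * h $ k) + 1 *\<^sub>R E j l (t *\<^sub>R h)) (at t)"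
          by (intro has_vector_derivative_scaleR) (auto intro!: derivative_eq_intros)
        moreover have "t *\<^sub>R (\<Sum>k\<in>UNIV. pd k (E j l) (t *\<^sub>R h) * h $ k) + 1 *\<^sub>R E j l (t *\<^sub>R h) =
            (\<Sum>q\<in>UNIV. A l q t * e q t)"
        proof -
          have "t *\<^sub>R (\<Sum>k\<in>UNIV. pd k (E j l) (t *\<^sub>R h) * h $ k) + 1 *\<^sub>R E j l (t *\<^sub>R h) =
              E j l (t *\<^sub>R h) + (\<Sum>k\<in>UNIV. (t *\<^sub>R h) $ k * pd k (E j l) (t *\<^sub>R h))"
            by (simp add: scaleR_sum_right mult.commute)
          also have "\<dots> = (\<Sum>q\<in>UNIV. (\<Sum>k\<in>UNIV. (t *\<^sub>R h) $ k * pd (Inr q) (F k l) (J (t *\<^sub>R h))) * E j q (t *\<^sub>R h))"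
            by (rule II[OF th[OF t]])
          also have "\<dots> = (\<Sum>q\<in>UNIV. A l q t * e q t)"
            by (auto simp: A_def e_def scaleR_conv_of_real[where 'a = 'k] sum_distrib_left sum_distrib_right mult_ac intro!: sum.cong)
          finally show ?thesis .
        qed
        ultimately show ?thesis by (simp add: e_def scaleR_conv_of_real[where 'a = 'k])
      qed
    qed simp
    then show ?thesis by (simp add: e_def)
  qed
  define U where "U = (\<lambda>z. b + (\<chi> l. V l (z - a)))"
  have U_nth: "U z $ l = b $ l + V l (z - a)" for z l by (simp add: U_def)
  show thesis
  proof (rule that[of U])
    show "U a = b" by (simp add: vec_eq_iff U_nth V0)
    show "an (\<lambda>z. U z $ l) a" for l
      unfolding U_nth by (intro an_add an_const) (simp add: an_shift anV)
    have "\<forall>\<^sub>F z in nhds a. z \<in> ball a \<epsilon>" using \<epsilon> by (intro eventually_nhds_in_open) auto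
    then show "\<forall>\<^sub>F z in nhds a. \<forall>j l. pd j (\<lambda>z. U z $ l) z = F j l (join z (U z))"
    proof (eventually_elim, intro allI)
      fix z j l assume "z \<in> ball a \<epsilon>"
      then have z: "z - a \<in> O1" by (simp add: O1_def dist_norm norm_minus_commute)
      have "pd j (\<lambda>z. U z $ l) z = pd j (V l) (z - a)"
        unfolding U_nth by (subst pd_add) (auto simp: an_const an_shift O1[OF z] pd_shift)
      also have "\<dots> = F j l (J (z - a))" using E0[OF z, of j l] by (simp add: E_def)
      also have "J (z - a) = join z (U z)"
        by (auto simp: vec_eq_iff J_def W_def join_def U_nth split: sum.split)
      finally show "pd j (\<lambda>z. U z $ l) z = F j l (join z (U z))" .
    qed
  qed
qed

section \<open>Projectively flat connections\<close>

definition unit_cov :: "'a \<Rightarrow> 'a \<Rightarrow> 'k::zero_neq_one" where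
  "unit_cov d = (\<lambda>x. if x = d then 1 else 0)"

lemma sum_unit_cov: "(\<Sum>x\<in>UNIV. unit_cov d x * g x) = (g d :: 'k::comm_ring_1)" for d :: "'a::finite"
  by (simp add: unit_cov_def if_distrib[where f = "\<lambda>x. x * _"] cong: if_cong)

lemma sum_bs2: "(\<Sum>x\<in>UNIV. (r * unit_cov d x + s * unit_cov f x) * g x) = (r * g d + s * g f :: 'k::comm_ring_1)" for d :: "'a::finite"
proof -
  have "(\<Sum>x\<in>UNIV. (r * unit_cov d x + s * unit_cov f x) * g x) = r * (\<Sum>x\<in>UNIV. unit_cov d x * g x) + s * (\<Sum>x\<in>UNIV. unit_cov f x * g x)"
    by (simp add: distrib_right sum.distrib sum_distrib_left mult.assoc)
  then show ?thesis by (simp add: sum_unit_cov)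
qed

text \<open>The place where the dimension enters: both the Weyl and the Cotton argument use an index
  apart from two given ones.\<close>

lemma ex_not_in_pair: "CARD('a::finite) \<ge> 3 \<Longrightarrow> \<exists>d :: 'a. d \<noteq> a \<and> d \<noteq> c"
proof -
  assume "CARD('a) \<ge> 3"
  moreover have "card {a, c} \<le> 2" by (simp add: card_insert_if)
  ultimately have "{a, c} \<noteq> UNIV" by force
  then show ?thesis by blast
qed

text \<open>If \<open>T(v, w)\<close> preserves every hyperplane containing \<open>v\<close> and \<open>w\<close>, then \<open>T\<close> has no
  Weyl part.\<close>

lemma weyl_zero:
  fixes T :: "'a::finite \<Rightarrow> 'a \<Rightarrow> 'a \<Rightarrow> 'a \<Rightarrow> 'k::{field_char_0}"
  assumes card: "CARD('a) \<ge> 3"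
    and anti: "\<And>d a b c. T d a b c = - T d a c b"
    and bianchi: "\<And>d a b c. T d a b c + T d b c a + T d c a b = 0"
    and ric: "\<And>a c. (\<Sum>d\<in>UNIV. T d a d c) = (\<Sum>d\<in>UNIV. T d c d a)"
    and ker: "\<And>\<xi> u v w :: 'a \<Rightarrow> 'k. (\<Sum>x\<in>UNIV. \<xi> x * u x) = 0 \<Longrightarrow> (\<Sum>x\<in>UNIV. \<xi> x * v x) = 0 \<Longrightarrow>
        (\<Sum>x\<in>UNIV. \<xi> x * w x) = 0 \<Longrightarrow>
        (\<Sum>d\<in>UNIV. \<xi> d * (\<Sum>a\<in>UNIV. u a * (\<Sum>b\<in>UNIV. v b * (\<Sum>c\<in>UNIV. w c * T d a b c)))) = 0"
  defines "P \<equiv> \<lambda>a c. (\<Sum>d\<in>UNIV. T d a d c) / of_nat (CARD('a) - 1)"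
  shows "T d a b c = (if d = b then P a c else 0) - (if d = c then P a b else 0)"
proof -
  \<comment> \<open>Testing on basis vectors kills every component whose upper index is not among
    the lower ones.\<close>
  have T0: "T d a b c = 0" if "d \<noteq> a" "d \<noteq> b" "d \<noteq> c" for d a b c
    using ker[of "unit_cov d" "unit_cov a" "unit_cov b" "unit_cov c"] that by (simp add: sum_unit_cov) (simp add: unit_cov_def)
  have Tbb: "T d a b b = 0" for d a b using anti[of d a b b] by simp
  \<comment> \<open>Polarisation: the covector \<open>e_d - e_f\<close> annihilates
    \<open>e_d + e_f\<close>, so these components do not depend on \<open>d\<close>. The same test
    vectors in the slot of \<open>b\<close> give \<open>r1\<close>.\<close>
  have w1: "T d d b c = T f f b c" if "d \<noteq> b" "d \<noteq> c" "f \<noteq> b" "f \<noteq> c" for d f b c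
  proof (cases "d = f")
    case False
    have "T d d b c + T d f b c + (- T f d b c - T f f b c) = 0"
      using ker[of "\<lambda>x. 1 * unit_cov d x + (-1) * unit_cov f x" "\<lambda>x. 1 * unit_cov d x + 1 * unit_cov f x" "unit_cov b" "unit_cov c"] that False
      by (simp only: sum_bs2 sum_unit_cov) (simp add: unit_cov_def)
    then show ?thesis using T0[of d f b c] T0[of f d b c] that False by simp
  qed simp
  have r1: "T d a d c = T f a f c" if "d \<noteq> a" "d \<noteq> c" "f \<noteq> a" "f \<noteq> c" for d f a c
  proof (cases "d = f")
    case False
    have "T d a d c + T d a f c + (- T f a d c - T f a f c) = 0"
      using ker[of "\<lambda>x. 1 * unit_cov d x + (-1) * unit_cov f x" "unit_cov a" "\<lambda>x. 1 * unit_cov d x + 1 * unit_cov f x" "unit_cov c"] that False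
      by (simp only: sum_bs2 sum_unit_cov) (simp add: unit_cov_def)
    then show ?thesis using T0[of d a f c] T0[of f a d c] that False by simp
  qed simp
  \<comment> \<open>Here \<open>u\<close> and \<open>v\<close> are both \<open>s e_d + e_f\<close>,
    annihilated by \<open>e_d - s e_f\<close>. The outcome is quadratic in \<open>s\<close> without
    constant term; its values at 1 and 2 isolate the coefficient of
    \<open>s\<^sup>2\<close>.\<close>
  have k1: "T d d d c = T f d f c + T f f d c" if "d \<noteq> c" "f \<noteq> d" "f \<noteq> c" for d f c
  proof -
    have *: "s\<^sup>2 * (T d d d c - T f d f c - T f f d c) + s * (T d d f c + T d f d c - T f f f c) = 0" for s
    proof -
      have "s * (s * T d d d c + 1 * T d d f c) + 1 * (s * T d f d c + 1 * T d f f c)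
          + (- s) * (s * (s * T f d d c + 1 * T f d f c) + 1 * (s * T f f d c + 1 * T f f f c)) = 0"
        using ker[of "\<lambda>x. 1 * unit_cov d x + (-s) * unit_cov f x" "\<lambda>x. s * unit_cov d x + 1 * unit_cov f x" "\<lambda>x. s * unit_cov d x + 1 * unit_cov f x" "unit_cov c"] that
        by (simp only: sum_bs2 sum_unit_cov) (simp add: unit_cov_def)
      then show ?thesis using T0[of d f f c] T0[of f d d c] that by (simp add: algebra_simps power2_eq_square)
    qed
    define X Y where "X = T d d d c - T f d f c - T f f d c" and "Y = T d d f c + T d f d c - T f f f c"
    have "2 * X = (2\<^sup>2 * X + 2 * Y) - 2 * (1\<^sup>2 * X + 1 * Y)" by (simp add: algebra_simps)
    also have "\<dots> = 0" using *[of 1] *[of 2] unfolding X_def Y_def by simp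
    finally have "X = 0" by simp
    then show ?thesis by (simp add: X_def algebra_simps)
  qed
  define pk where "pk = (\<lambda>a c :: 'a. SOME d. d \<noteq> a \<and> d \<noteq> c)"
  have pk: "pk a c \<noteq> a" "pk a c \<noteq> c" for a c
    using someI_ex[OF ex_not_in_pair[OF card, of a c]] by (auto simp: pk_def)
  \<comment> \<open>By \<open>r1\<close> and \<open>w1\<close>, \<rho> and \<omega> are common
    values; \<open>pk\<close> merely picks an admissible index at which to read them.\<close>
  define \<rho> where "\<rho> = (\<lambda>a c. T (pk a c) a (pk a c) c)"
  define \<omega> where "\<omega> = (\<lambda>b c. T (pk b c) (pk b c) b c)"
  have \<rho>: "T d a d c = \<rho> a c" if "d \<noteq> a" "d \<noteq> c" for d a c
    unfolding \<rho>_def using that pk by (intro r1) auto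
  have \<omega>: "T d d b c = \<omega> b c" if "d \<noteq> b" "d \<noteq> c" for d b c
    unfolding \<omega>_def using that pk by (intro w1) auto
  have Tddd: "T d d d c = \<rho> d c + \<omega> d c" if "d \<noteq> c" for d c
    using k1[OF that pk(1)[of d c] pk(2)[of d c]] \<rho>[OF pk] \<omega>[OF pk] by simp
  have b1: "\<omega> b c = \<rho> b c - \<rho> c b" for b c
  proof -
    have "T (pk b c) b c (pk b c) = - \<rho> b c"
      using anti[of "pk b c" b c "pk b c"] \<rho>[OF pk, of b c] by simp
    then show ?thesis
      using bianchi[of "pk b c" "pk b c" b c] \<omega>[OF pk, of b c] \<rho>[of "pk b c" c b] pk[of b c] by (simp add: algebra_simps)
  qed
  have m: "of_nat (CARD('a) - 1) = (of_nat CARD('a) - 1 :: 'k)" "of_nat (CARD('a) - 1) \<noteq> (0 :: 'k)"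
    "of_nat CARD('a) + 1 \<noteq> (0 :: 'k)"
  proof -
    show "of_nat (CARD('a) - 1) = (of_nat CARD('a) - 1 :: 'k)" using card by (simp add: of_nat_diff)
    show "of_nat (CARD('a) - 1) \<noteq> (0 :: 'k)" using card by simp
    have "of_nat (Suc CARD('a)) \<noteq> (0 :: 'k)" by (simp only: of_nat_eq_0_iff)
    then show "of_nat CARD('a) + 1 \<noteq> (0 :: 'k)" by (simp add: add.commute)
  qed
  have Ric: "(\<Sum>d\<in>UNIV. T d a d c) = (of_nat CARD('a) - 1) * \<rho> a c + \<omega> a c" for a c
  proof -
    have "T d a d c = \<rho> a c + (if d = a then \<omega> a c else 0) - (if d = c then \<rho> a c else 0)" for d
    proof (cases "a = c")
      case True
      then have "\<omega> a c = 0" by (simp add: b1)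
      then show ?thesis using True \<rho>[of d a a] by (auto simp: Tbb)
    next
      case False
      then show ?thesis using \<rho>[of d a c] Tddd[of a c] by (auto simp: Tbb)
    qed
    then have "(\<Sum>d\<in>UNIV. T d a d c) =
        (\<Sum>d\<in>UNIV. \<rho> a c + (if d = a then \<omega> a c else 0) - (if d = c then \<rho> a c else 0))"
      by (intro sum.cong refl)
    then show ?thesis by (simp add: sum.distrib sum_subtractf algebra_simps)
  qed
  \<comment> \<open>By \<open>b1\<close>, \<open>\<omega> a c\<close> is the difference of
    \<open>\<rho> a c\<close> and \<open>\<rho> c a\<close>. The symmetry of the Ricci trace then
    reads \<open>(of_nat CARD('a) + 1) * \<omega> a c = 0\<close>.\<close>
  have \<omega>0: "\<omega> a c = 0" for a c
  proof -
    have "(of_nat CARD('a) - 1) * (\<rho> a c - \<rho> c a) + (\<omega> a c - \<omega> c a) = 0"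
      using ric[of a c] unfolding Ric by (simp add: algebra_simps)
    then have "(of_nat CARD('a) + 1) * \<omega> a c = 0" by (simp add: b1 algebra_simps)
    then show ?thesis using m by simp
  qed
  have P: "P a c = \<rho> a c" for a c using m by (simp add: P_def Ric \<omega>0)
  have A: "T d a d c = P a c" if "d \<noteq> c" for d a c
    using that \<rho>[of d a c] Tddd[of d c] by (cases "d = a") (auto simp: P \<omega>0)
  show ?thesis
  proof (cases "b = c")
    case False
    then show ?thesis using A[of d c a] A[of d b a] anti[of d a b d] T0[of d a b c] \<omega>[of d b c] \<omega>0
      by (cases "d = b"; cases "d = c"; cases "d = a") auto
  qed (simp add: Tbb)
qed

section \<open>Curvature, Bianchi identities and flat coordinates\<close>

definition mat_mult :: "('a::finite \<Rightarrow> 'a \<Rightarrow> 'k::comm_ring_1) \<Rightarrow> ('a \<Rightarrow> 'a \<Rightarrow> 'k) \<Rightarrow> 'a \<Rightarrow> 'a \<Rightarrow> 'k" where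
  "mat_mult A B = (\<lambda>d a. \<Sum>f\<in>UNIV. A d f * B f a)"

lemma mat_mult_assoc: "mat_mult (mat_mult A B) C = mat_mult A (mat_mult B C)"
  unfolding mat_mult_def sum_distrib_left sum_distrib_right by (intro ext, subst sum.swap) (simp add: mult.assoc)

lemma mat_mult_left: "mat_mult (\<lambda>d a. A d a + A' d a) B d a = mat_mult A B d a + mat_mult A' B d a"
   "mat_mult (\<lambda>d a. A d a - A' d a) B d a = mat_mult A B d a - mat_mult A' B d a"
  by (simp_all add: mat_mult_def algebra_simps sum.distrib sum_subtractf)

lemma mat_mult_right: "mat_mult B (\<lambda>d a. A d a + A' d a) d a = mat_mult B A d a + mat_mult B A' d a"
   "mat_mult B (\<lambda>d a. A d a - A' d a) d a = mat_mult B A d a - mat_mult B A' d a"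
  by (simp_all add: mat_mult_def algebra_simps sum.distrib sum_subtractf)

text \<open>The first two indices are those of the curvature endomorphism, upper index first; the
  last two are the indices of the 2-form.\<close>

definition curv :: "('a::finite \<Rightarrow> 'a \<Rightarrow> 'a \<Rightarrow> 'k::scalar_field ^ 'a \<Rightarrow> 'k) \<Rightarrow> 'a \<Rightarrow> 'a \<Rightarrow> 'a \<Rightarrow> 'a \<Rightarrow> 'k ^ 'a \<Rightarrow> 'k" where
  "curv \<Gamma> d a c b z = pd c (\<Gamma> d a b) z - pd b (\<Gamma> d a c) z
     + (\<Sum>f\<in>UNIV. \<Gamma> d c f z * \<Gamma> f a b z) - (\<Sum>f\<in>UNIV. \<Gamma> d b f z * \<Gamma> f a c z)"

lemma sum_UNIV_option: "(\<Sum>q\<in>UNIV. g q) = g None + (\<Sum>a\<in>UNIV. g (Some a))"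
  for g :: "'a::finite option \<Rightarrow> 'b::comm_monoid_add"
  by (simp add: UNIV_option_conv sum.reindex)

text \<open>Coefficients that depend on the base variables only, regarded as functions on base times
  fibre as \<open>frobenius\<close> expects them.\<close>

lemma
  fixes g :: "'k::scalar_field ^ 'i::finite \<Rightarrow> 'k" and v :: "'k ^ ('i + 'r::finite)"
  assumes g: "an g (\<chi> i. v $ Inl i)"
  shows an_base: "an (\<lambda>v. g (\<chi> i. v $ Inl i)) v"
    and pd_base: "pd (Inl i) (\<lambda>v. g (\<chi> i. v $ Inl i)) v = pd i g (\<chi> i. v $ Inl i)"
    and pd_base_fibre: "pd (Inr q) (\<lambda>v. g (\<chi> i. v $ Inl i)) v = 0"
proof -
  show "an (\<lambda>v. g (\<chi> i. v $ Inl i)) v" by (intro an_compose g an_nth)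
  show "pd (Inl i) (\<lambda>v. g (\<chi> i. v $ Inl i)) v = pd i g (\<chi> i. v $ Inl i)"
    by (subst pd_compose[OF g an_nth]) (simp add: pd_nth if_distrib[where f = "\<lambda>x. _ * x"] cong: if_cong)
  show "pd (Inr q) (\<lambda>v. g (\<chi> i. v $ Inl i)) v = 0"
    by (subst pd_compose[OF g an_nth]) (simp add: pd_nth)
qed

text \<open>\<open>trace\<close> fixes the representative in the projective class and thereby makes
  the Ricci tensor symmetric. \<open>ker\<close> is what complete integrability contributes.\<close>

locale flat_projective =
  fixes \<Gamma> :: "'a::finite \<Rightarrow> 'a \<Rightarrow> 'a \<Rightarrow> 'k::scalar_field ^ 'a \<Rightarrow> 'k" and O1 :: "('k ^ 'a) set"
  assumes card: "CARD('a) \<ge> 3"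
    and O1: "open O1"
    and an\<Gamma>: "z \<in> O1 \<Longrightarrow> an (\<Gamma> c a b) z"
    and sym: "\<Gamma> c a b = \<Gamma> c b a"
    and trace: "z \<in> O1 \<Longrightarrow> (\<Sum>c\<in>UNIV. \<Gamma> c a c z) = 0"
    and ker: "\<And>\<xi> u v w :: 'a \<Rightarrow> 'k. z \<in> O1 \<Longrightarrow>
        (\<Sum>x\<in>UNIV. \<xi> x * u x) = 0 \<Longrightarrow> (\<Sum>x\<in>UNIV. \<xi> x * v x) = 0 \<Longrightarrow> (\<Sum>x\<in>UNIV. \<xi> x * w x) = 0 \<Longrightarrow>
        (\<Sum>d\<in>UNIV. \<xi> d * (\<Sum>a\<in>UNIV. u a * (\<Sum>b\<in>UNIV. v b * (\<Sum>c\<in>UNIV. w c * curv \<Gamma> d a b c z)))) = 0"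
begin

text \<open>The projective Schouten tensor.\<close>

definition P :: "'a \<Rightarrow> 'a \<Rightarrow> 'k ^ 'a \<Rightarrow> 'k" where
  "P a b = (\<lambda>z. ((\<Sum>d\<in>UNIV. pd d (\<Gamma> d a b) z) - (\<Sum>d\<in>UNIV. \<Sum>f\<in>UNIV. \<Gamma> d b f z * \<Gamma> f a d z)) * inverse (of_nat (CARD('a) - 1)))"

lemma an_P: "z \<in> O1 \<Longrightarrow> an (P a b) z"
  unfolding P_def by (intro an_mult an_diff an_sum an_pd an\<Gamma> an_const)

lemma pd_eq_on_O1:
  assumes "z \<in> O1" "\<And>x. x \<in> O1 \<Longrightarrow> f x = g x" "an f z"
  shows "pd i f z = pd i g z"
  using assms O1 by (intro pd_cong) (auto simp: eventually_nhds)

text \<open>Two of the four terms of the trace contain the trace of \<Gamma> and vanish; the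
  remaining two are the formula for \<open>P\<close>.\<close>

lemma ricci:
  assumes z: "z \<in> O1"
  shows "(\<Sum>d\<in>UNIV. curv \<Gamma> d a d b z) / of_nat (CARD('a) - 1) = P a b z"
proof -
  have "(\<Sum>d\<in>UNIV. pd b (\<Gamma> d a d) z) = pd b (\<lambda>z. \<Sum>d\<in>UNIV. \<Gamma> d a d z) z"
    by (rule pd_sum[symmetric]) (rule an\<Gamma>[OF z])
  also have "\<dots> = pd b (\<lambda>_. 0) z"
    by (rule pd_eq_on_O1[OF z trace an_sum[OF an\<Gamma>[OF z]]])
  finally have 1: "(\<Sum>d\<in>UNIV. pd b (\<Gamma> d a d) z) = 0" by simp
  have "(\<Sum>d\<in>UNIV. \<Sum>f\<in>UNIV. \<Gamma> d d f z * \<Gamma> f a b z) = (\<Sum>f\<in>UNIV. (\<Sum>d\<in>UNIV. \<Gamma> d f d z) * \<Gamma> f a b z)"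
    unfolding sum_distrib_right by (subst sum.swap) (simp add: sym[of _ _ ])
  then have 2: "(\<Sum>d\<in>UNIV. \<Sum>f\<in>UNIV. \<Gamma> d d f z * \<Gamma> f a b z) = 0" by (simp add: trace[OF z])
  show ?thesis by (simp add: curv_def P_def sum.distrib sum_subtractf 1 2 divide_inverse)
qed

lemma P_sym: "P a b z = P b a z"
proof -
  have "(\<Sum>d\<in>UNIV. \<Sum>f\<in>UNIV. \<Gamma> d b f z * \<Gamma> f a d z) = (\<Sum>d\<in>UNIV. \<Sum>f\<in>UNIV. \<Gamma> d a f z * \<Gamma> f b d z)"
    by (subst sum.swap) (simp add: mult.commute)
  then show ?thesis by (simp add: P_def sym[of _ a b])
qed

lemma curv_eq:
  assumes z: "z \<in> O1"
  shows "curv \<Gamma> d a b c z = (if d = b then P a c z else 0) - (if d = c then P a b z else 0)"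
proof -
  have "curv \<Gamma> d a b c z = (if d = b then (\<Sum>d\<in>UNIV. curv \<Gamma> d a d c z) / of_nat (CARD('a) - 1) else 0)
      - (if d = c then (\<Sum>d\<in>UNIV. curv \<Gamma> d a d b z) / of_nat (CARD('a) - 1) else 0)"
  proof (rule weyl_zero[OF card])
    show "curv \<Gamma> d a b c z = - curv \<Gamma> d a c b z" for d a b c by (simp add: curv_def)
    show "curv \<Gamma> d a b c z + curv \<Gamma> d b c a z + curv \<Gamma> d c a b z = 0" for d a b c
      by (simp add: curv_def sym[of _ b a] sym[of _ c a] sym[of _ c b])
    show "(\<Sum>d\<in>UNIV. curv \<Gamma> d a d c z) = (\<Sum>d\<in>UNIV. curv \<Gamma> d c d a z)" for a c
    proof -
      have "of_nat (CARD('a) - 1) \<noteq> (0 :: 'k)" using card by simp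
      moreover have "(\<Sum>d\<in>UNIV. curv \<Gamma> d a d c z) / of_nat (CARD('a) - 1)
          = (\<Sum>d\<in>UNIV. curv \<Gamma> d c d a z) / of_nat (CARD('a) - 1)"
        unfolding ricci[OF z] by (rule P_sym)
      ultimately show ?thesis by (simp only: divide_cancel_right simp_thms)
    qed
  qed (rule ker[OF z])
  then show ?thesis by (simp only: ricci[OF z])
qed

text \<open>With connection and curvature read as matrices, the second derivatives commute and the
  triple products cancel in pairs. The Christoffel terms acting on the 2-form indices are left out
  of the covariant derivatives: they cancel in the cyclic sum because \<Gamma> is symmetric.\<close>

lemma second_bianchi:
  assumes z: "z \<in> O1"
  shows "(pd e (curv \<Gamma> d a c b) z + (\<Sum>f\<in>UNIV. \<Gamma> d e f z * curv \<Gamma> f a c b z) - (\<Sum>f\<in>UNIV. curv \<Gamma> d f c b z * \<Gamma> f e a z))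
    + (pd c (curv \<Gamma> d a b e) z + (\<Sum>f\<in>UNIV. \<Gamma> d c f z * curv \<Gamma> f a b e z) - (\<Sum>f\<in>UNIV. curv \<Gamma> d f b e z * \<Gamma> f c a z))
    + (pd b (curv \<Gamma> d a e c) z + (\<Sum>f\<in>UNIV. \<Gamma> d b f z * curv \<Gamma> f a e c z) - (\<Sum>f\<in>UNIV. curv \<Gamma> d f e c z * \<Gamma> f b a z)) = 0"
proof -
  define A where "A = (\<lambda>c d a. \<Gamma> d c a z)"
  define B where "B = (\<lambda>e c d a. pd e (\<Gamma> d c a) z)"
  have R: "curv \<Gamma> d a c b z = B c b d a - B b c d a + mat_mult (A c) (A b) d a - mat_mult (A b) (A c) d a" for d a c b
    by (simp add: curv_def A_def B_def mat_mult_def sym[of _ a])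
  have pdR: "pd e (curv \<Gamma> d a c b) z = pd e (pd c (\<Gamma> d a b)) z - pd e (pd b (\<Gamma> d a c)) z
      + mat_mult (B e c) (A b) d a + mat_mult (A c) (B e b) d a - mat_mult (B e b) (A c) d a - mat_mult (A b) (B e c) d a" for e d a c b
  proof -
    have "pd e (curv \<Gamma> d a c b) z = pd e (\<lambda>z. pd c (\<Gamma> d a b) z - pd b (\<Gamma> d a c) z
     + (\<Sum>f\<in>UNIV. \<Gamma> d c f z * \<Gamma> f a b z) - (\<Sum>f\<in>UNIV. \<Gamma> d b f z * \<Gamma> f a c z)) z"
      by (rule arg_cong[where f = "\<lambda>f. pd e f z"]) (simp add: curv_def fun_eq_iff)
    also have "\<dots> = pd e (pd c (\<Gamma> d a b)) z - pd e (pd b (\<Gamma> d a c)) z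
        + (\<Sum>f\<in>UNIV. pd e (\<Gamma> d c f) z * \<Gamma> f a b z + \<Gamma> d c f z * pd e (\<Gamma> f a b) z)
        - (\<Sum>f\<in>UNIV. pd e (\<Gamma> d b f) z * \<Gamma> f a c z + \<Gamma> d b f z * pd e (\<Gamma> f a c) z)"
      by (simp add: pd_diff pd_add pd_sum pd_mult an_diff an_add an_sum an_mult an_pd an\<Gamma>[OF z])
    also have "\<dots> = pd e (pd c (\<Gamma> d a b)) z - pd e (pd b (\<Gamma> d a c)) z
      + mat_mult (B e c) (A b) d a + mat_mult (A c) (B e b) d a - mat_mult (B e b) (A c) d a - mat_mult (A b) (B e c) d a"
      by (simp add: A_def B_def mat_mult_def sum.distrib sym[of _ a])
    finally show ?thesis .
  qed
  have 1: "(\<Sum>f\<in>UNIV. \<Gamma> d e f z * curv \<Gamma> f a c b z) = mat_mult (A e) (B c b) d a - mat_mult (A e) (B b c) d a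
      + mat_mult (A e) (mat_mult (A c) (A b)) d a - mat_mult (A e) (mat_mult (A b) (A c)) d a" for d e a c b
  proof -
    have "(\<Sum>f\<in>UNIV. \<Gamma> d e f z * curv \<Gamma> f a c b z) = mat_mult (A e) (\<lambda>d a. B c b d a - B b c d a + mat_mult (A c) (A b) d a - mat_mult (A b) (A c) d a) d a"
      unfolding R by (subst mat_mult_def) (simp add: A_def)
    then show ?thesis by (simp only: mat_mult_right)
  qed
  have 2: "(\<Sum>f\<in>UNIV. curv \<Gamma> d f c b z * \<Gamma> f e a z) = mat_mult (B c b) (A e) d a - mat_mult (B b c) (A e) d a
      + mat_mult (A c) (mat_mult (A b) (A e)) d a - mat_mult (A b) (mat_mult (A c) (A e)) d a" for d e a c b
  proof -
    have "(\<Sum>f\<in>UNIV. curv \<Gamma> d f c b z * \<Gamma> f e a z) = mat_mult (\<lambda>d a. B c b d a - B b c d a + mat_mult (A c) (A b) d a - mat_mult (A b) (A c) d a) (A e) d a"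
      unfolding R by (subst mat_mult_def) (simp add: A_def)
    then show ?thesis by (simp only: mat_mult_left mat_mult_assoc)
  qed
  have comm: "pd i (pd j (\<Gamma> d a b)) z = pd j (pd i (\<Gamma> d a b)) z" for i j d a b
    by (rule pd_commute[OF an\<Gamma>[OF z]])
  show ?thesis
    unfolding pdR 1 2 by (simp add: comm[of c e] comm[of b c] comm[of b e])
qed

text \<open>Choose \<open>c\<close> apart from \<open>e\<close> and \<open>b\<close> and take the
  component \<open>d = c\<close> of the second Bianchi identity. By \<open>curv_eq\<close> the three
  differentiated curvatures are \<open>P a b\<close>, 0 and \<open>- P a e\<close>, and what is left
  is the Cotton tensor.\<close>

lemma cotton_zero:
  assumes z: "z \<in> O1"
  shows "pd e (P a b) z - pd b (P a e) z + (\<Sum>f\<in>UNIV. \<Gamma> f a b z * P f e z) - (\<Sum>f\<in>UNIV. \<Gamma> f a e z * P f b z) = 0"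
proof (cases "e = b")
  case False
  obtain c where c: "c \<noteq> e" "c \<noteq> b" using ex_not_in_pair[OF card] by blast
  have anc: "an (curv \<Gamma> d a c b) z" for d a c b
    unfolding curv_def[abs_def] by (intro an_diff an_add an_sum an_mult an_pd an\<Gamma>[OF z])
  have "pd e (curv \<Gamma> c a c b) z = pd e (P a b) z"
    by (rule pd_eq_on_O1[OF z _ anc]) (use c in \<open>simp add: curv_eq\<close>)
  moreover have "pd c (curv \<Gamma> c a b e) z = pd c (\<lambda>_. 0) z"
    by (rule pd_eq_on_O1[OF z _ anc]) (use c in \<open>simp add: curv_eq\<close>)
  moreover have "pd b (curv \<Gamma> c a e c) z = pd b (\<lambda>z. - P a e z) z"
    by (rule pd_eq_on_O1[OF z _ anc]) (use c in \<open>simp add: curv_eq\<close>)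
  ultimately have 1: "pd e (curv \<Gamma> c a c b) z = pd e (P a b) z" "pd c (curv \<Gamma> c a b e) z = 0"
     "pd b (curv \<Gamma> c a e c) z = - pd b (P a e) z" by (simp_all add: pd_minus an_P z)
  have 2: "(\<Sum>f\<in>UNIV. g f * curv \<Gamma> f a c b z) = g c * P a b z - g b * P a c z" for g a c b
    by (simp add: curv_eq[OF z] right_diff_distrib sum_subtractf if_distrib[where f = "\<lambda>x. _ * x"] cong: if_cong)
  have 3: "(\<Sum>f\<in>UNIV. curv \<Gamma> c f c b z * \<Gamma> f e a z) = (\<Sum>f\<in>UNIV. \<Gamma> f a e z * P f b z)"
      "(\<Sum>f\<in>UNIV. curv \<Gamma> c f b e z * \<Gamma> f c a z) = 0"
      "(\<Sum>f\<in>UNIV. curv \<Gamma> c f e c z * \<Gamma> f b a z) = - (\<Sum>f\<in>UNIV. \<Gamma> f a b z * P f e z)"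
    using c by (simp_all add: curv_eq[OF z] sym[of _ e a] sym[of _ b a] mult.commute sum_negf)
  show ?thesis
    using second_bianchi[OF z, of e c a c b] unfolding 1 2 3
    by (simp add: sym[of _ c e] sym[of _ b e] sym[of _ b c] algebra_simps)
qed simp


text \<open>The derivatives of \<open>u\<close> become further unknowns, at the indices
  \<open>Some a\<close>, with \<open>None\<close> for \<open>u\<close> itself. Compatibility at
  \<open>None\<close> is the symmetry of \<Gamma> and \<open>P\<close>. At \<open>Some a\<close> the
  terms with derivatives of \<open>u\<close> match by \<open>curv_eq\<close>, those with
  \<open>u\<close> by \<open>cotton_zero\<close>.\<close>

lemma linear_solution:
  assumes z0: "z0 \<in> O1"
  shows "\<exists>u. an u z0 \<and> u z0 = \<alpha> \<and> (\<forall>a. pd a u z0 = \<beta> a) \<and>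
    (\<forall>\<^sub>F z in nhds z0. \<forall>a b. pd b (pd a u) z = (\<Sum>c\<in>UNIV. \<Gamma> c a b z * pd c u z) - P a b z * u z)"
proof -
  define zp where "zp = (\<lambda>v :: 'k ^ ('a + 'a option). \<chi> i. v $ Inl i)"
  define F where "F = (\<lambda>j l (v :: 'k ^ ('a + 'a option)). case l of None \<Rightarrow> v $ Inr (Some j)
     | Some a \<Rightarrow> (\<Sum>c\<in>UNIV. \<Gamma> c a j (zp v) * v $ Inr (Some c)) - P a j (zp v) * v $ Inr None)"
  define b :: "'k ^ 'a option" where "b = (\<chi> q. case q of None \<Rightarrow> \<alpha> | Some a \<Rightarrow> \<beta> a)"
  have an1: "an (\<lambda>v. \<Gamma> c a j (zp v)) v" "an (\<lambda>v. P a j (zp v)) v" if "zp v \<in> O1" for c a j v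
    unfolding zp_def by (rule an_base, use that in \<open>simp add: an\<Gamma> an_P zp_def\<close>)+
  have anF: "an (F j l) v" if "zp v \<in> O1" for j l v
    unfolding F_def by (cases l) (auto intro!: an_diff an_sum an_mult an_nth an1 that)
  have pd1: "pd (Inl i) (\<lambda>v. \<Gamma> c a j (zp v)) v = pd i (\<Gamma> c a j) (zp v)" "pd (Inr q) (\<lambda>v. \<Gamma> c a j (zp v)) v = 0"
      "pd (Inl i) (\<lambda>v. P a j (zp v)) v = pd i (P a j) (zp v)" "pd (Inr q) (\<lambda>v. P a j (zp v)) v = 0"
    if "zp v \<in> O1" for c a j v i q
    using that an\<Gamma>[of "zp v" c a j] an_P[of "zp v" a j] unfolding zp_def by (simp_all add: pd_base pd_base_fibre)
  have zp_join: "zp (join z u) = z" for z u by (simp add: zp_def vec_eq_iff)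
  have pdF_None: "pd m (F j None) v = (if m = Inr (Some j) then 1 else 0)" for m j v
    by (simp add: F_def pd_nth)
  have pdF_Some: "pd (Inl i) (F j (Some a)) v = (\<Sum>c\<in>UNIV. pd i (\<Gamma> c a j) (zp v) * v $ Inr (Some c)) - pd i (P a j) (zp v) * v $ Inr None"
      "pd (Inr None) (F j (Some a)) v = - P a j (zp v)"
      "pd (Inr (Some c)) (F j (Some a)) v = \<Gamma> c a j (zp v)" if "zp v \<in> O1" for i j a v c
    using that by (simp_all add: F_def pd_diff pd_sum pd_mult an_sum an_mult an_nth an1 pd1 pd_nth
        if_distrib[where f = "\<lambda>x. _ * x"] cong: if_cong)
  have ci: "pd (Inl j) (F k l) v + (\<Sum>q\<in>UNIV. F j q v * pd (Inr q) (F k l) v) =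
        pd (Inl k) (F j l) v + (\<Sum>q\<in>UNIV. F k q v * pd (Inr q) (F j l) v)" if v: "zp v \<in> O1" for j k l v
  proof (cases l)
    case None
    have "(\<Sum>q\<in>UNIV. F j q v * pd (Inr q) (F k None) v) = F j (Some k) v" for j k
      by (simp add: pdF_None if_distrib[where f = "\<lambda>x. _ * x"] cong: if_cong)
    moreover have "F j (Some k) v = F k (Some j) v"
      by (simp add: F_def sym[of _ j k] P_sym[of j k])
    ultimately show ?thesis by (simp add: None pdF_None)
  next
    case (Some a)
    define u where "u = (\<lambda>d. v $ Inr (Some d))"
    define D where "D = (\<lambda>j k. \<Sum>d\<in>UNIV. pd j (\<Gamma> d a k) (zp v) * u d)"
    define GG where "GG = (\<lambda>j k. \<Sum>d\<in>UNIV. (\<Sum>f\<in>UNIV. \<Gamma> d j f (zp v) * \<Gamma> f a k (zp v)) * u d)"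
    define PG where "PG = (\<lambda>j k. \<Sum>c\<in>UNIV. \<Gamma> c a k (zp v) * P c j (zp v))"
    have *: "pd (Inl j) (F k l) v + (\<Sum>q\<in>UNIV. F j q v * pd (Inr q) (F k l) v) =
       D j k - pd j (P a k) (zp v) * v $ Inr None - u j * P a k (zp v) + GG j k - PG j k * v $ Inr None" for j k
    proof -
      have "(\<Sum>c\<in>UNIV. F j (Some c) v * \<Gamma> c a k (zp v)) = GG j k - PG j k * v $ Inr None"
      proof -
        have "(\<Sum>c\<in>UNIV. F j (Some c) v * \<Gamma> c a k (zp v)) =
           (\<Sum>c\<in>UNIV. \<Sum>d\<in>UNIV. \<Gamma> d c j (zp v) * u d * \<Gamma> c a k (zp v)) - PG j k * v $ Inr None"
          by (simp add: F_def PG_def u_def left_diff_distrib right_diff_distrib sum_subtractf sum_distrib_left sum_distrib_right mult_ac)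
        also have "(\<Sum>c\<in>UNIV. \<Sum>d\<in>UNIV. \<Gamma> d c j (zp v) * u d * \<Gamma> c a k (zp v)) = GG j k"
          unfolding GG_def sum_distrib_right by (subst sum.swap) (simp add: sym[of _ _ j] mult_ac)
        finally show ?thesis .
      qed
      moreover have "F j None v = u j" by (simp add: F_def u_def)
      ultimately show ?thesis
        by (simp add: Some sum_UNIV_option pdF_Some[OF v] D_def u_def)
    qed
    have 3: "(\<Sum>d\<in>UNIV. curv \<Gamma> d a j k (zp v) * u d) = P a k (zp v) * u j - P a j (zp v) * u k"
      by (simp add: curv_eq[OF v] left_diff_distrib sum_subtractf if_distrib[where f = "\<lambda>x. x * _"] cong: if_cong)
    have "(\<Sum>d\<in>UNIV. curv \<Gamma> d a j k (zp v) * u d) = D j k - D k j + GG j k - GG k j"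
      by (simp add: curv_def D_def GG_def left_diff_distrib distrib_right sum_subtractf sum.distrib)
    with 3 have e: "D j k - D k j + GG j k - GG k j = P a k (zp v) * u j - P a j (zp v) * u k" by simp
    have "D j k + GG j k - u j * P a k (zp v) = (D j k - D k j + GG j k - GG k j) + (D k j + GG k j) - u j * P a k (zp v)"
      by simp
    then have 1: "D j k + GG j k - u j * P a k (zp v) = D k j + GG k j - u k * P a j (zp v)"
      unfolding e by (simp add: algebra_simps)
    have "pd j (P a k) (zp v) - pd k (P a j) (zp v) + PG j k - PG k j = 0"
      using cotton_zero[OF v, of j a k] by (simp add: PG_def)
    then have "pd j (P a k) (zp v) + PG j k = pd k (P a j) (zp v) + PG k j" by (simp add: algebra_simps)
    then have 2: "(pd j (P a k) (zp v) + PG j k) * v $ Inr None = (pd k (P a j) (zp v) + PG k j) * v $ Inr None" by simp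
    have "pd (Inl j) (F k l) v + (\<Sum>q\<in>UNIV. F j q v * pd (Inr q) (F k l) v) =
       (D j k + GG j k - u j * P a k (zp v)) - (pd j (P a k) (zp v) + PG j k) * v $ Inr None" for j k
      unfolding * by (simp add: algebra_simps)
    then show ?thesis by (simp only: 1 2)
  qed
  have "isCont zp (join z0 b)" by (rule an_isCont_vec) (simp add: zp_def an_nth)
  then have "(zp \<longlongrightarrow> z0) (nhds (join z0 b))" by (simp add: continuous_at zp_join tendsto_nhds_iff)
  from topological_tendstoD[OF this O1 z0] have ev: "\<forall>\<^sub>F v in nhds (join z0 b). zp v \<in> O1" .
  obtain U where U: "U z0 = b" "\<And>l. an (\<lambda>z. U z $ l) z0"
    "\<forall>\<^sub>F z in nhds z0. \<forall>j l. pd j (\<lambda>z. U z $ l) z = F j l (join z (U z))"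
  proof (rule frobenius[where F = F and a = z0 and b = b])
    show "an (F j l) (join z0 b)" for j l by (rule anF) (simp add: zp_join z0)
    show "\<forall>\<^sub>F v in nhds (join z0 b). \<forall>j k l.
        pd (Inl j) (F k l) v + (\<Sum>q\<in>UNIV. F j q v * pd (Inr q) (F k l) v) =
        pd (Inl k) (F j l) v + (\<Sum>q\<in>UNIV. F k q v * pd (Inr q) (F j l) v)"
      using ev by (rule eventually_mono) (use ci in blast)
  qed (rule that)
  have "\<forall>\<^sub>F z in nhds z0. (\<forall>j l. pd j (\<lambda>z. U z $ l) z = F j l (join z (U z))) \<and> (\<forall>l. an (\<lambda>z. U z $ l) z)"
    by (intro eventually_conj U eventually_all_finite an_eventually)
  then obtain S where S: "open S" "z0 \<in> S" "\<And>z j l. z \<in> S \<Longrightarrow> pd j (\<lambda>z. U z $ l) z = F j l (join z (U z))"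
    "\<And>z l. z \<in> S \<Longrightarrow> an (\<lambda>z. U z $ l) z" unfolding eventually_nhds by blast
  define u where "u = (\<lambda>z. U z $ None)"
  have pdu: "pd a u z = U z $ Some a" if "z \<in> S" for a z
    using S(3)[OF that, of a None] by (simp add: u_def F_def)
  have "pd b (pd a u) z = (\<Sum>c\<in>UNIV. \<Gamma> c a b z * pd c u z) - P a b z * u z" if z: "z \<in> S" for a b z
  proof -
    have "pd b (pd a u) z = pd b (\<lambda>z. U z $ Some a) z"
      by (rule pd_cong[symmetric]) (use S z pdu in \<open>auto simp: eventually_nhds\<close>)
    also have "\<dots> = F b (Some a) (join z (U z))" by (rule S(3)[OF z])
    also have "\<dots> = (\<Sum>c\<in>UNIV. \<Gamma> c a b z * pd c u z) - P a b z * u z"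
      by (simp add: F_def zp_join pdu[OF z]) (simp add: u_def)
    finally show ?thesis .
  qed
  then have "\<forall>\<^sub>F z in nhds z0. \<forall>a b. pd b (pd a u) z = (\<Sum>c\<in>UNIV. \<Gamma> c a b z * pd c u z) - P a b z * u z"
    using S(1,2) unfolding eventually_nhds by blast
  moreover have "an u z0" "u z0 = \<alpha>" "\<And>a. pd a u z0 = \<beta> a"
    using U(2) U(1) pdu[OF S(2)] by (simp_all add: u_def b_def)
  ultimately show ?thesis by blast
qed

text \<open>At \<open>z0\<close> the solutions \<open>w\<close> and \<open>u i\<close> have the
  1-jets of the constant 1 and of the centred coordinates. In the quotients the term with
  \<open>P\<close> cancels; there remain terms with the logarithmic derivative \<theta> of
  \<open>w\<close>, which amount to a projective change of \<Gamma>.\<close>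

lemma flat_coordinates:
  assumes z0: "z0 \<in> O1"
  obtains \<Phi> \<theta> where "\<And>i. an (\<lambda>z. \<Phi> z $ i) z0"
    "\<And>i j. pd j (\<lambda>z. \<Phi> z $ i) z0 = (if i = j then 1 else 0)"
    "\<forall>\<^sub>F z in nhds z0. \<forall>i a b. pd b (pd a (\<lambda>z. \<Phi> z $ i)) z =
       (\<Sum>c\<in>UNIV. \<Gamma> c a b z * pd c (\<lambda>z. \<Phi> z $ i) z) - \<theta> b z * pd a (\<lambda>z. \<Phi> z $ i) z - \<theta> a z * pd b (\<lambda>z. \<Phi> z $ i) z"
proof -
  let ?eq = "\<lambda>u z. \<forall>a b. pd b (pd a u) z = (\<Sum>c\<in>UNIV. \<Gamma> c a b z * pd c u z) - P a b z * u z"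
  obtain w where w: "an w z0" "w z0 = 1" "\<And>a. pd a w z0 = 0" "\<forall>\<^sub>F z in nhds z0. ?eq w z"
    using linear_solution[OF z0, of 1 "\<lambda>_. 0"] by blast
  have "\<exists>u. \<forall>i. an (u i) z0 \<and> u i z0 = 0 \<and> (\<forall>a. pd a (u i) z0 = (if i = a then 1 else 0)) \<and> (\<forall>\<^sub>F z in nhds z0. ?eq (u i) z)"
    by (intro choice allI linear_solution[OF z0])
  then obtain u where u: "\<And>i. an (u i) z0" "\<And>i. u i z0 = 0" "\<And>i a. pd a (u i) z0 = (if i = a then 1 else 0)"
    "\<And>i. \<forall>\<^sub>F z in nhds z0. ?eq (u i) z" by blast
  have "(w \<longlongrightarrow> w z0) (nhds z0)" using an_isCont[OF w(1)] by (simp add: continuous_at tendsto_nhds_iff)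
  then have "\<forall>\<^sub>F z in nhds z0. w z \<noteq> 0" by (rule tendsto_imp_eventually_ne) (simp add: w)
  then have "\<forall>\<^sub>F z in nhds z0. w z \<noteq> 0 \<and> ?eq w z \<and> an w z \<and> (\<forall>i. ?eq (u i) z) \<and> (\<forall>i. an (u i) z)"
    by (intro eventually_conj eventually_all_finite[where P = "\<lambda>z i. ?eq (u i) z"] eventually_all_finite[where P = "\<lambda>z i. an (u i) z"] an_eventually w(1) w(4) u(1) u(4))
  then obtain S where S0: "open S" "z0 \<in> S"
    "\<forall>z\<in>S. w z \<noteq> 0 \<and> ?eq w z \<and> an w z \<and> (\<forall>i. ?eq (u i) z) \<and> (\<forall>i. an (u i) z)"
    unfolding eventually_nhds by (elim exE conjE)
  note S = S0(1,2) bspec[OF S0(3), THEN conjunct1] bspec[OF S0(3), THEN conjunct2, THEN conjunct1]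
    bspec[OF S0(3), THEN conjunct2, THEN conjunct2, THEN conjunct1]
    bspec[OF S0(3), THEN conjunct2, THEN conjunct2, THEN conjunct2, THEN conjunct1, THEN spec]
    bspec[OF S0(3), THEN conjunct2, THEN conjunct2, THEN conjunct2, THEN conjunct2, THEN spec]
  define \<Phi> where "\<Phi> = (\<lambda>z. \<chi> i. u i z * inverse (w z))"
  define \<theta> where "\<theta> = (\<lambda>a z. pd a w z * inverse (w z))"
  define v where "v = (\<lambda>i z. \<Phi> z $ i)"
  have v: "v i = (\<lambda>z. u i z * inverse (w z))" for i by (simp add: v_def \<Phi>_def)
  have anv: "an (v i) z" if "z \<in> S" for i z
    unfolding v by (intro an_mult an_inverse S that)
  have uv: "u i z = v i z * w z" if "z \<in> S" for i z using S(3)[OF that] by (simp add: v)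
  \<comment> \<open>Differentiating \<open>u = v * w\<close> and solving for the derivatives of
    \<open>v\<close> is simpler than applying the quotient rule twice.\<close>
  have pdu: "pd a (u i) z = pd a (v i) z * w z + v i z * pd a w z" if z: "z \<in> S" for a i z
  proof -
    have "pd a (u i) z = pd a (\<lambda>z. v i z * w z) z"
      by (rule pd_cong[OF _ S(7)[OF z]]) (use S z uv in \<open>auto simp: eventually_nhds\<close>)
    then show ?thesis by (simp add: pd_mult anv S z)
  qed
  have pdpdu: "pd b (pd a (u i)) z = pd b (pd a (v i)) z * w z + pd a (v i) z * pd b w z
      + pd b (v i) z * pd a w z + v i z * pd b (pd a w) z" if z: "z \<in> S" for a b i z
  proof -
    have "pd b (pd a (u i)) z = pd b (\<lambda>z. pd a (v i) z * w z + v i z * pd a w z) z"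
      by (rule pd_cong[OF _ an_pd[OF S(7)[OF z]]]) (use S z pdu in \<open>auto simp: eventually_nhds\<close>)
    then show ?thesis by (simp add: pd_mult pd_add anv an_mult an_pd S z)
  qed
  have main: "pd b (pd a (v i)) z = (\<Sum>c\<in>UNIV. \<Gamma> c a b z * pd c (v i) z) - \<theta> b z * pd a (v i) z - \<theta> a z * pd b (v i) z"
    if z: "z \<in> S" for a b i z
  proof -
    have "(\<Sum>c\<in>UNIV. \<Gamma> c a b z * pd c (u i) z) = (\<Sum>c\<in>UNIV. \<Gamma> c a b z * pd c (v i) z) * w z + v i z * (\<Sum>c\<in>UNIV. \<Gamma> c a b z * pd c w z)"
      by (simp add: pdu[OF z] distrib_left sum.distrib sum_distrib_left sum_distrib_right mult_ac)
    with spec[OF spec[OF S(6)[OF z, of i], of a], of b] spec[OF spec[OF S(4)[OF z], of a], of b] uv[OF z, of i]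
    have "pd b (pd a (v i)) z * w z + pd a (v i) z * pd b w z + pd b (v i) z * pd a w z
       = (\<Sum>c\<in>UNIV. \<Gamma> c a b z * pd c (v i) z) * w z"
      by (simp add: pdpdu[OF z] algebra_simps)
    moreover have \<theta>w: "\<theta> a z * w z = pd a w z" for a using S(3)[OF z] by (simp add: \<theta>_def)
    have "((\<Sum>c\<in>UNIV. \<Gamma> c a b z * pd c (v i) z) - \<theta> b z * pd a (v i) z - \<theta> a z * pd b (v i) z) * w z =
        (\<Sum>c\<in>UNIV. \<Gamma> c a b z * pd c (v i) z) * w z - pd a (v i) z * pd b w z - pd b (v i) z * pd a w z"
      unfolding \<theta>w[symmetric] by (simp add: algebra_simps)
    ultimately have "pd b (pd a (v i)) z * w z = ((\<Sum>c\<in>UNIV. \<Gamma> c a b z * pd c (v i) z) - \<theta> b z * pd a (v i) z - \<theta> a z * pd b (v i) z) * w z"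
      by (simp add: algebra_simps)
    then show ?thesis using S(3)[OF z] by simp
  qed
  show thesis
  proof (rule that[of \<Phi> \<theta>])
    show "an (\<lambda>z. \<Phi> z $ i) z0" for i using anv[OF S(2), of i] by (simp add: v_def)
    show "pd j (\<lambda>z. \<Phi> z $ i) z0 = (if i = j then 1 else 0)" for i j
      using pdu[OF S(2), of j i] by (simp add: w u v_def)
    show "\<forall>\<^sub>F z in nhds z0. \<forall>i a b. pd b (pd a (\<lambda>z. \<Phi> z $ i)) z =
       (\<Sum>c\<in>UNIV. \<Gamma> c a b z * pd c (\<lambda>z. \<Phi> z $ i) z) - \<theta> b z * pd a (\<lambda>z. \<Phi> z $ i) z - \<theta> a z * pd b (\<lambda>z. \<Phi> z $ i) z"
      using main S(1,2) unfolding eventually_nhds v_def by blast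
  qed
qed

end

section \<open>Points, jets and solutions\<close>

lemma pball_subset_ball:
  assumes "0 < d"
  obtains r where "0 < r" "\<And>h :: 'k::scalar_field ^ 'i::finite. h \<in> pball r \<Longrightarrow> norm h < d"
proof -
  define r where "r = d / (2 * real CARD('i))"
  have r: "0 < r" using assms by (simp add: r_def)
  have "norm h < d" if "h \<in> pball r" for h :: "'k ^ 'i"
  proof -
    have "norm h \<le> (\<Sum>i\<in>UNIV. norm (h $ i))" by (simp add: norm_vec_def L2_set_le_sum)
    also have "\<dots> \<le> real CARD('i) * r" using pballD[OF that] by (intro sum_bounded_above)
    also have "\<dots> < d" using assms by (simp add: r_def)
    finally show ?thesis .
  qed
  with r that show thesis by blast
qed

text \<open>\<open>K_analytic_at\<close> asks only for convergence near the point. At the vector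
  with all coordinates equal to \<open>r\<close>, convergence is absolute by
  \<open>scalar_field_abs_summable\<close>, which is a finite majorant norm at radius
  \<open>r\<close>. \<open>bld\<close> rebuilds a point from its coordinates.\<close>

lemma K_analytic_at_iff_an:
  fixes crd :: "'i::finite \<Rightarrow> 'v::metric_space \<Rightarrow> 'k::scalar_field" and bld :: "'k ^ 'i \<Rightarrow> 'v"
  assumes crd: "\<And>i w. crd i (bld w) = w $ i" and bld: "\<And>v. bld (\<chi> i. crd i v) = v"
    and cont: "continuous_on UNIV bld" "continuous_on UNIV (\<lambda>v. \<chi> i. crd i v)"
  shows "K_analytic_at crd f a \<longleftrightarrow> an (\<lambda>w. f (bld w)) (\<chi> i. crd i a)"
proof
  let ?a = "\<chi> i. crd i a"
  assume "K_analytic_at crd f a"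
  then obtain c where c: "\<forall>\<^sub>F v in nhds a. ((\<lambda>\<alpha>. c \<alpha> * (\<Prod>i\<in>UNIV. (crd i v - crd i a) ^ \<alpha> i)) has_sum f v) UNIV"
    by (auto simp: K_analytic_at_def)
  have "isCont bld ?a" using cont(1) by (simp add: continuous_on_eq_continuous_at)
  then have "(bld \<longlongrightarrow> bld ?a) (nhds ?a)" by (simp only: continuous_at tendsto_nhds_iff)
  then have "(bld \<longlongrightarrow> a) (nhds ?a)" by (simp add: bld)
  from eventually_compose_filterlim[OF c this]
  obtain d where d: "0 < d" "\<And>w. dist w ?a < d \<Longrightarrow>
      ((\<lambda>\<alpha>. c \<alpha> * (\<Prod>i\<in>UNIV. (w $ i - ?a $ i) ^ \<alpha> i)) has_sum f (bld w)) UNIV"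
    by (auto simp: eventually_nhds_metric crd)
  obtain r where r: "0 < r" "\<And>h :: 'k ^ 'i. h \<in> pball r \<Longrightarrow> norm h < d"
    using pball_subset_ball[OF d(1)] by metis
  have ps: "((\<lambda>\<alpha>. c \<alpha> * mon \<alpha> h) has_sum f (bld (?a + h))) UNIV" if "h \<in> pball r" for h
    using d(2)[of "?a + h"] r(2)[OF that] by (simp add: dist_norm mon_def)
  have "(\<chi> i. of_real r) \<in> pball r" using r by (simp add: pball_def)
  from scalar_field_abs_summable[OF has_sum_imp_summable[OF ps[OF this]]]
  have "(\<lambda>\<alpha>. norm (c \<alpha>) * r ^ deg \<alpha>) summable_on UNIV"
    using r by (simp add: norm_mult mon_const norm_power)
  then have "has_ps r (\<Sum>\<^sub>\<infinity>\<alpha>. norm (c \<alpha>) * r ^ deg \<alpha>) c (\<lambda>h. f (bld (?a + h)))"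
    unfolding has_ps_def using ps by (auto intro: has_sum_infsum)
  then show "an (\<lambda>w. f (bld w)) ?a"
    using r by (intro anI[of r]) (auto simp: majorized_def)
next
  let ?a = "\<chi> i. crd i a"
  assume "an (\<lambda>w. f (bld w)) ?a"
  then obtain r C c where r: "0 < r" and "has_ps r C c (\<lambda>h. f (bld (?a + h)))"
    by (auto simp: an_def majorized_def)
  then have ps: "((\<lambda>\<alpha>. c \<alpha> * mon \<alpha> h) has_sum f (bld (?a + h))) UNIV" if "h \<in> pball r" for h
    using that by (auto simp: has_ps_def)
  have "isCont (\<lambda>v. (\<chi> i. crd i v) - ?a) a"
    using cont(2) by (intro continuous_intros) (simp add: continuous_on_eq_continuous_at)
  then have "((\<lambda>v. (\<chi> i. crd i v) - ?a) \<longlongrightarrow> 0) (nhds a)" by (simp add: continuous_at tendsto_nhds_iff)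
  from eventually_compose_filterlim[OF eventually_pball[OF r] this]
  show "K_analytic_at crd f a"
    unfolding K_analytic_at_def
  proof (intro exI[of _ c], elim eventually_mono)
    fix v assume "(\<chi> i. crd i v) - ?a \<in> pball r"
    from ps[OF this] show "((\<lambda>\<alpha>. c \<alpha> * (\<Prod>i\<in>UNIV. (crd i v - crd i a) ^ \<alpha> i)) has_sum f v) UNIV"
      by (simp add: mon_def bld)
  qed
qed

section \<open>Points and jets as coordinate vectors\<close>

definition pt :: "'k ^ 'n option \<Rightarrow> ('k, 'n::finite) point" where
  "pt w = (\<chi> j. w $ Some j, w $ None)"

definition vc :: "('k, 'n::finite) point \<Rightarrow> 'k ^ 'n option" where
  "vc v = (\<chi> i. point_coord i v)"

definition jt :: "'k ^ ('n option + 'n) \<Rightarrow> ('k, 'n::finite) jet" where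
  "jt w = (\<chi> j. w $ Inl (Some j), w $ Inl None, \<chi> j. w $ Inr j)"

lemma point_coord_eq: "point_coord i v = (case i of None \<Rightarrow> snd v | Some j \<Rightarrow> fst v $ j)"
  by (cases v; cases i) auto

lemma jet_coord_eq: "jet_coord m s = (case m of Inl i \<Rightarrow> point_coord i (fst s, fst (snd s)) | Inr j \<Rightarrow> snd (snd s) $ j)"
  by (cases s; cases m) auto

lemma point_coord_pt [simp]: "point_coord i (pt w) = w $ i"
  by (auto simp: point_coord_eq pt_def split: option.split)

lemma pt_vc [simp]: "pt (vc v) = v" and vc_pt [simp]: "vc (pt w) = w"
  by (auto simp: point_coord_eq pt_def vc_def vec_eq_iff prod_eq_iff split: option.split)

lemma vc_nth [simp]: "vc v $ i = point_coord i v"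
  by (simp add: vc_def)

lemma jet_coord_jt: "jet_coord m (jt w) = w $ m"
  by (auto simp: jet_coord_eq point_coord_eq jt_def split: option.split sum.split)

lemma jt_join: "jt (join z p) = (fst (pt z), snd (pt z), p)"
  by (simp add: jt_def pt_def vec_eq_iff)

lemma continuous_pt: "continuous_on UNIV (pt :: 'k::scalar_field ^ 'n::finite option \<Rightarrow> _)"
  unfolding pt_def by (intro continuous_intros)

lemma continuous_vc: "continuous_on UNIV (vc :: ('k::scalar_field, 'n::finite) point \<Rightarrow> _)"
  unfolding vc_def point_coord_eq
proof (intro continuous_on_vec_lambda)
  show "continuous_on UNIV (\<lambda>v :: ('k, 'n) point. case i of None \<Rightarrow> snd v | Some j \<Rightarrow> fst v $ j)" for i
    by (cases i) (auto intro!: continuous_intros)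
qed

lemma continuous_jt: "continuous_on UNIV (jt :: 'k::scalar_field ^ ('n::finite option + 'n) \<Rightarrow> _)"
  unfolding jt_def by (intro continuous_intros)

lemma continuous_jet_coords: "continuous_on UNIV (\<lambda>s :: ('k::scalar_field, 'n::finite) jet. \<chi> m. jet_coord m s)"
proof (intro continuous_on_vec_lambda)
  show "continuous_on UNIV (\<lambda>s :: ('k, 'n) jet. jet_coord m s)" for m
    unfolding jet_coord_eq point_coord_eq
    by (cases m; cases "projl m") (auto intro!: continuous_intros)
qed

lemma jt_jet_coords: "jt (\<chi> m. jet_coord m s) = s"
  by (simp add: jt_def jet_coord_eq vec_eq_iff prod_eq_iff)

lemma K_analytic_point: "K_analytic_at point_coord f a \<longleftrightarrow> an (\<lambda>w. f (pt w)) (vc a)"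
  for f :: "('k::scalar_field, 'n::finite) point \<Rightarrow> 'k"
  unfolding vc_def
  by (rule K_analytic_at_iff_an) (auto simp: continuous_pt continuous_vc simp flip: vc_def)

lemma K_analytic_jet: "K_analytic_at jet_coord f s \<longleftrightarrow> an (\<lambda>w. f (jt w)) (\<chi> m. jet_coord m s)"
  for f :: "('k::scalar_field, 'n::finite) jet \<Rightarrow> 'k"
  by (rule K_analytic_at_iff_an) (auto simp: continuous_jt continuous_jet_coords jet_coord_jt jt_jet_coords)

lemma analytic_on_points_iff: "analytic_on_points f W \<longleftrightarrow> (\<forall>z. pt z \<in> W \<longrightarrow> an (\<lambda>w. f (pt w)) z)"
  for f :: "('k::scalar_field, 'n::finite) point \<Rightarrow> 'k"
  unfolding analytic_on_points_def K_analytic_point by (metis pt_vc vc_pt)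

lemma analytic_on_jets_iff: "analytic_on_jets f N \<longleftrightarrow> (\<forall>w. jt w \<in> N \<longrightarrow> an (\<lambda>w. f (jt w)) w)"
  for f :: "('k::scalar_field, 'n::finite) jet \<Rightarrow> 'k"
proof -
  have "(\<chi> m. jet_coord m (jt w)) = w" for w :: "'k ^ ('n option + 'n)" by (simp add: jet_coord_jt)
  then show ?thesis unfolding analytic_on_jets_def K_analytic_jet by (metis jt_jet_coords)
qed

lemma partials_pd:
  fixes f :: "('k::scalar_field, 'n::finite) jet \<Rightarrow> 'k"
  shows "partial_x j f (jt w) = pd (Inl (Some j)) (\<lambda>w. f (jt w)) w"
    and "partial_y f (jt w) = pd (Inl None) (\<lambda>w. f (jt w)) w"
    and "partial_p l f (jt w) = pd (Inr l) (\<lambda>w. f (jt w)) w"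
proof -
  have "jt (w + axis (Inl (Some j)) t) = ((\<chi> j. w $ Inl (Some j)) + axis j t, w $ Inl None, \<chi> j. w $ Inr j)"
    "jt (w + axis (Inl None) t) = (\<chi> j. w $ Inl (Some j), w $ Inl None + t, \<chi> j. w $ Inr j)"
    "jt (w + axis (Inr l) t) = (\<chi> j. w $ Inl (Some j), w $ Inl None, (\<chi> j. w $ Inr j) + axis l t)" for t
    by (auto simp: jt_def vec_eq_iff axis_def)
  then show "partial_x j f (jt w) = pd (Inl (Some j)) (\<lambda>w. f (jt w)) w"
    "partial_y f (jt w) = pd (Inl None) (\<lambda>w. f (jt w)) w" "partial_p l f (jt w) = pd (Inr l) (\<lambda>w. f (jt w)) w"
    by (simp_all add: partial_x_def partial_y_def partial_p_def pd_def) (simp_all add: jt_def)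
qed

lemma total_diff_pd:
  fixes f :: "('k::scalar_field, 'n::finite) jet \<Rightarrow> 'k"
  shows "total_diff F k f (jt w) = pd (Inl (Some k)) (\<lambda>w. f (jt w)) w + w $ Inr k * pd (Inl None) (\<lambda>w. f (jt w)) w
    + (\<Sum>l\<in>UNIV. F k l (jt w) * pd (Inr l) (\<lambda>w. f (jt w)) w)"
  using partials_pd(1)[of k f w] partials_pd(2)[of f w] partials_pd(3)[of _ f w]
  by (simp add: total_diff_def jt_def)

text \<open>Frobenius for the unknowns \<open>y\<close>, at the index \<open>None\<close>, and
  \<open>p\<close>, at the indices \<open>Some j\<close>. The equations for \<open>y\<close> are
  compatible because \<open>F\<close> is symmetric, those for \<open>p\<close> because the system is
  completely integrable.\<close>

lemma solution_exists:
  fixes F :: "('k::scalar_field, 'n::finite) system"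
  assumes sys: "analytic_system F \<Omega>" and ci: "completely_integrable F \<Omega>"
    and N: "open N" "N \<subseteq> \<Omega>" "(x0, y0, p0) \<in> N"
  obtains U y p where "open U" "x0 \<in> U" "y x0 = y0" "p x0 = p0"
    "\<And>x. x \<in> U \<Longrightarrow> (x, y x, p x) \<in> N"
    "\<And>x. x \<in> U \<Longrightarrow> (y has_derivative (\<lambda>h. \<Sum>j\<in>UNIV. p x $ j * h $ j)) (at x)"
    "\<And>x j1. x \<in> U \<Longrightarrow> ((\<lambda>z. p z $ j1) has_derivative
                   (\<lambda>h. \<Sum>j2\<in>UNIV. F j1 j2 (x, y x, p x) * h $ j2)) (at x)"
proof -
  \<comment> \<open>Jets group the coordinates as \<open>x, y\<close> against \<open>p\<close>,
    Frobenius as \<open>x\<close> against \<open>y, p\<close>; \<sigma> relabels one as the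
    other.\<close>
  define \<sigma> :: "'n option + 'n \<Rightarrow> 'n + 'n option" where
    "\<sigma> = (\<lambda>m. case m of Inl i \<Rightarrow> (case i of None \<Rightarrow> Inr None | Some j \<Rightarrow> Inl j) | Inr j \<Rightarrow> Inr (Some j))"
  define cv where "cv = (\<lambda>v :: 'k ^ ('n + 'n option). \<chi> m. v $ \<sigma> m)"
  define FF where "FF = (\<lambda>i j w. F i j (jt w))"
  define S where "S = {v. jt (cv v) \<in> N}"
  have cvS: "jt (cv v) \<in> \<Omega>" if "v \<in> S" for v using that N by (auto simp: S_def)
  have anFF: "an (FF i j) (cv v)" if "v \<in> S" for i j v
    using sys cvS[OF that] by (auto simp: analytic_system_def analytic_on_jets_iff FF_def)
  have FF_sym: "FF i j (cv v) = FF j i (cv v)" if "v \<in> S" for i j v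
    using sys cvS[OF that] by (auto simp: analytic_system_def FF_def)
  have ci': "pd (Inl (Some k)) (FF i j) (cv v) + cv v $ Inr k * pd (Inl None) (FF i j) (cv v)
      + (\<Sum>l\<in>UNIV. FF k l (cv v) * pd (Inr l) (FF i j) (cv v)) =
      pd (Inl (Some j)) (FF i k) (cv v) + cv v $ Inr j * pd (Inl None) (FF i k) (cv v)
      + (\<Sum>l\<in>UNIV. FF j l (cv v) * pd (Inr l) (FF i k) (cv v))" if "v \<in> S" for i j k v
    using ci cvS[OF that] unfolding completely_integrable_def FF_def total_diff_pd[symmetric] by blast
  define R where "R = (\<lambda>j l (v :: 'k ^ ('n + 'n option)). case l of None \<Rightarrow> v $ Inr (Some j) | Some i \<Rightarrow> FF i j (cv v))"
  have an_comp: "an (\<lambda>v. FF i j (cv v)) v" if "v \<in> S" for i j v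
    unfolding cv_def by (rule an_compose) (use anFF[OF that] in \<open>auto simp: cv_def an_nth\<close>)
  have anR: "an (R j l) v" if "v \<in> S" for j l v
    unfolding R_def by (cases l) (auto intro: an_nth an_comp that)
  have pd_comp: "pd m (\<lambda>v. FF i j (cv v)) v = (\<Sum>m'\<in>UNIV. pd m' (FF i j) (cv v) * (if m = \<sigma> m' then 1 else 0))"
    if "v \<in> S" for m i j v
    unfolding cv_def by (subst pd_compose) (use anFF[OF that] in \<open>auto simp: cv_def an_nth pd_nth\<close>)
  have pd_comp': "pd (Inl k) (\<lambda>v. FF i j (cv v)) v = pd (Inl (Some k)) (FF i j) (cv v)"
     "pd (Inr None) (\<lambda>v. FF i j (cv v)) v = pd (Inl None) (FF i j) (cv v)"
     "pd (Inr (Some l)) (\<lambda>v. FF i j (cv v)) v = pd (Inr l) (FF i j) (cv v)" if "v \<in> S" for i j k l v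
    by (simp_all add: pd_comp[OF that] sum_UNIV_Plus sum_UNIV_option \<sigma>_def if_distrib[where f = "\<lambda>x. _ * x"] cong: if_cong)
  have ciR: "pd (Inl j) (R k l) v + (\<Sum>q\<in>UNIV. R j q v * pd (Inr q) (R k l) v) =
        pd (Inl k) (R j l) v + (\<Sum>q\<in>UNIV. R k q v * pd (Inr q) (R j l) v)" if v: "v \<in> S" for j k l v
  proof (cases l)
    case None
    have "(\<Sum>q\<in>UNIV. R j q v * pd (Inr q) (R k None) v) = FF k j (cv v)" for j k
      by (simp add: R_def pd_nth sum_UNIV_option if_distrib[where f = "\<lambda>x. _ * x"] cong: if_cong)
    then show ?thesis using FF_sym[OF v, of j k] by (simp add: None) (simp add: R_def pd_nth)
  next
    case (Some i)
    have "pd (Inl j) (R k l) v + (\<Sum>q\<in>UNIV. R j q v * pd (Inr q) (R k l) v) =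
      pd (Inl (Some j)) (FF i k) (cv v) + cv v $ Inr j * pd (Inl None) (FF i k) (cv v)
      + (\<Sum>l\<in>UNIV. FF j l (cv v) * pd (Inr l) (FF i k) (cv v))" for j k
    proof -
      have "R k l = (\<lambda>v. FF i k (cv v))" by (simp add: R_def Some)
      moreover have "cv v $ Inr j = v $ Inr (Some j)" by (simp add: cv_def \<sigma>_def)
      ultimately show ?thesis
        by (simp add: sum_UNIV_option pd_comp'[OF v] FF_sym[OF v, of j] add.assoc) (simp add: R_def)
    qed
    then show ?thesis using ci'[OF v, of j i k] by simp
  qed
  have "continuous_on UNIV (\<lambda>v. jt (cv v))"
    by (rule continuous_on_compose2[OF continuous_jt]) (auto simp: cv_def intro!: continuous_intros)
  then have oS: "open S"
    unfolding S_def using open_vimage[OF N(1)] by (simp add: vimage_def)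
  define b :: "'k ^ 'n option" where "b = (\<chi> q. case q of None \<Rightarrow> y0 | Some j \<Rightarrow> p0 $ j)"
  have cv_join: "jt (cv (join x u)) = (x, u $ None, \<chi> j. u $ Some j)" for x u
    by (simp add: jt_def cv_def \<sigma>_def vec_eq_iff)
  have base: "join x0 b \<in> S" using N(3) by (simp add: S_def cv_join b_def)
  obtain u where u: "u x0 = b" "\<And>l. an (\<lambda>z. u z $ l) x0"
    "\<forall>\<^sub>F z in nhds x0. \<forall>j l. pd j (\<lambda>z. u z $ l) z = R j l (join z (u z))"
  proof (rule frobenius[where F = R and a = x0 and b = b])
    show "an (R j l) (join x0 b)" for j l by (rule anR[OF base])
    show "\<forall>\<^sub>F v in nhds (join x0 b). \<forall>j k l.
        pd (Inl j) (R k l) v + (\<Sum>q\<in>UNIV. R j q v * pd (Inr q) (R k l) v) =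
        pd (Inl k) (R j l) v + (\<Sum>q\<in>UNIV. R k q v * pd (Inr q) (R j l) v)"
      using eventually_nhds_in_open[OF oS base] by (rule eventually_mono) (use ciR in blast)
  qed (rule that)
  have "isCont (\<lambda>z. join z (u z)) x0"
  proof (rule an_isCont_vec)
    show "an (\<lambda>v. join v (u v) $ i) x0" for i
      by (cases i) (auto simp: an_nth u)
  qed
  then have "((\<lambda>z. join z (u z)) \<longlongrightarrow> join x0 b) (nhds x0)" by (simp add: continuous_at u tendsto_nhds_iff)
  from topological_tendstoD[OF this oS base]
  have "\<forall>\<^sub>F z in nhds x0. join z (u z) \<in> S" .
  then have "\<forall>\<^sub>F z in nhds x0. (\<forall>j l. pd j (\<lambda>z. u z $ l) z = R j l (join z (u z))) \<and> (\<forall>l. an (\<lambda>z. u z $ l) z) \<and> join z (u z) \<in> S"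
    by (intro eventually_conj u eventually_all_finite an_eventually)
  then obtain U where U: "open U" "x0 \<in> U" "\<And>z j l. z \<in> U \<Longrightarrow> pd j (\<lambda>z. u z $ l) z = R j l (join z (u z))"
    "\<And>z l. z \<in> U \<Longrightarrow> an (\<lambda>z. u z $ l) z" "\<And>z. z \<in> U \<Longrightarrow> join z (u z) \<in> S" unfolding eventually_nhds by blast
  define y where "y = (\<lambda>x. u x $ None)"
  define p where "p = (\<lambda>x. \<chi> j. u x $ Some j)"
  have jtu: "jt (cv (join x (u x))) = (x, y x, p x)" for x by (simp add: cv_join y_def p_def)
  show thesis
  proof (rule that[of U y p])
    show "y x0 = y0" "p x0 = p0" by (simp_all add: y_def p_def u b_def vec_eq_iff)
    fix x assume x: "x \<in> U"
    show "(x, y x, p x) \<in> N" using U(5)[OF x] by (simp add: S_def jtu)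
    have D: "((\<lambda>z. u z $ l) has_derivative (\<lambda>h. \<Sum>j\<in>UNIV. R j l (join x (u x)) * h $ j)) (at x)" for l
      using an_has_derivative[OF U(4)[OF x]] by (simp add: U(3)[OF x])
    show "(y has_derivative (\<lambda>h. \<Sum>j\<in>UNIV. p x $ j * h $ j)) (at x)"
      using D[of None] by (simp add: y_def p_def R_def)
    show "((\<lambda>z. p z $ j1) has_derivative (\<lambda>h. \<Sum>j2\<in>UNIV. F j1 j2 (x, y x, p x) * h $ j2)) (at x)" for j1
      using D[of "Some j1"] by (simp add: R_def FF_def jtu) (simp add: p_def)
  qed (use U in auto)
qed

section \<open>Integrability and curvature\<close>

lemma sum_mult_swap:
  "(\<Sum>x\<in>A. g x * (\<Sum>y\<in>B. h y * X x y)) = (\<Sum>y\<in>B. h y * (\<Sum>x\<in>A. g x * X x y))"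
  for g :: "_ \<Rightarrow> 'k::comm_ring_1"
  unfolding sum_distrib_left by (subst sum.swap) (simp add: mult.left_commute)

lemma sum_mult_lin:
  "(\<Sum>a\<in>A. (\<Sum>i\<in>I. s i * U i a) * X a) = (\<Sum>i\<in>I. s i * (\<Sum>a\<in>A. U i a * X a))"
  for s :: "_ \<Rightarrow> 'k::comm_ring_1"
  unfolding sum_distrib_left sum_distrib_right by (subst sum.swap) (simp add: mult.assoc)

lemma sum_mult_swap3:
  "(\<Sum>a\<in>A. u a * (\<Sum>c\<in>B. w c * (\<Sum>f\<in>D. H f * Y f a c))) =
   (\<Sum>f\<in>D. H f * (\<Sum>a\<in>A. u a * (\<Sum>c\<in>B. w c * Y f a c)))"
  for H :: "_ \<Rightarrow> 'k::comm_ring_1"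
  by (simp only: sum_mult_swap[where g = w and h = H] sum_mult_swap[where g = u and h = H])

definition con3 :: "('a::finite \<Rightarrow> 'a \<Rightarrow> 'a \<Rightarrow> 'k::comm_ring_1) \<Rightarrow> ('a \<Rightarrow> 'k) \<Rightarrow> ('a \<Rightarrow> 'k) \<Rightarrow> ('a \<Rightarrow> 'k) \<Rightarrow> 'k" where
  "con3 \<Gamma> \<xi> u v = (\<Sum>c\<in>UNIV. \<xi> c * (\<Sum>a\<in>UNIV. u a * (\<Sum>b\<in>UNIV. v b * \<Gamma> c a b)))"

definition con4 :: "('a::finite \<Rightarrow> 'a \<Rightarrow> 'a \<Rightarrow> 'a \<Rightarrow> 'k::comm_ring_1) \<Rightarrow> ('a \<Rightarrow> 'k) \<Rightarrow> ('a \<Rightarrow> 'k) \<Rightarrow> ('a \<Rightarrow> 'k) \<Rightarrow> ('a \<Rightarrow> 'k) \<Rightarrow> 'k" where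
  "con4 T \<xi> u v w = (\<Sum>d\<in>UNIV. \<xi> d * (\<Sum>a\<in>UNIV. u a * (\<Sum>b\<in>UNIV. v b * (\<Sum>c\<in>UNIV. w c * T d a b c))))"

definition con2 :: "('a::finite \<Rightarrow> 'a \<Rightarrow> 'a \<Rightarrow> 'k::comm_ring_1) \<Rightarrow> ('a \<Rightarrow> 'k) \<Rightarrow> ('a \<Rightarrow> 'k) \<Rightarrow> 'a \<Rightarrow> 'k" where
  "con2 \<Gamma> u v c = (\<Sum>a\<in>UNIV. u a * (\<Sum>b\<in>UNIV. v b * \<Gamma> c a b))"

lemma con3_con2: "con3 \<Gamma> \<xi> u v = (\<Sum>c\<in>UNIV. \<xi> c * con2 \<Gamma> u v c)"
  by (simp add: con3_def con2_def)

lemma con3_sym: "(\<And>c a b. \<Gamma> c a b = \<Gamma> c b a) \<Longrightarrow> con3 \<Gamma> \<xi> u v = con3 \<Gamma> \<xi> v u"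
  unfolding con3_def by (subst sum_mult_swap[of u]) simp

lemma con3_lin:
  "con3 \<Gamma> \<xi> u (\<lambda>b. \<Sum>i\<in>I. s i * V i b) = (\<Sum>i\<in>I. s i * con3 \<Gamma> \<xi> u (V i))"
  "con3 \<Gamma> \<xi> u (\<lambda>b. v b + w b) = con3 \<Gamma> \<xi> u v + con3 \<Gamma> \<xi> u w"
  "con3 \<Gamma> \<xi> u (\<lambda>b. r * v b) = r * con3 \<Gamma> \<xi> u v"
proof -
  show "con3 \<Gamma> \<xi> u (\<lambda>b. \<Sum>i\<in>I. s i * V i b) = (\<Sum>i\<in>I. s i * con3 \<Gamma> \<xi> u (V i))"
    unfolding con3_def sum_mult_lin by (simp only: sum_mult_swap[where g = u and h = s] sum_mult_swap[where g = \<xi> and h = s])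
  show "con3 \<Gamma> \<xi> u (\<lambda>b. v b + w b) = con3 \<Gamma> \<xi> u v + con3 \<Gamma> \<xi> u w"
    by (simp add: con3_def distrib_right distrib_left sum.distrib)
  show "con3 \<Gamma> \<xi> u (\<lambda>b. r * v b) = r * con3 \<Gamma> \<xi> u v"
    by (simp add: con3_def sum_distrib_left mult_ac)
qed

lemma con4_lin:
  "con4 T \<xi> (\<lambda>b. \<Sum>i\<in>I. s i * V i b) v w = (\<Sum>i\<in>I. s i * con4 T \<xi> (V i) v w)"
  "con4 T \<xi> u (\<lambda>b. \<Sum>i\<in>I. s i * V i b) w = (\<Sum>i\<in>I. s i * con4 T \<xi> u (V i) w)"
  "con4 T \<xi> u v (\<lambda>b. \<Sum>i\<in>I. s i * V i b) = (\<Sum>i\<in>I. s i * con4 T \<xi> u v (V i))"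
  "con4 T (\<lambda>d. r * \<xi> d) u v w = r * con4 T \<xi> u v w"
  unfolding con4_def sum_mult_lin
  by (simp_all only: sum_mult_swap[where g = v and h = s] sum_mult_swap[where g = u and h = s] sum_mult_swap[where g = \<xi> and h = s])
    (simp add: sum_distrib_left mult.assoc)

text \<open>In the quadratic terms the inner connection is summed first: \<open>con2\<close> is the
  vector that it makes of two arguments, and the outer connection is then contracted with
  it.\<close>

lemma con4_curv:
  "con4 (\<lambda>d a b c. curv \<Gamma> d a b c z) \<xi> u v w =
     con3 (\<lambda>d a c. \<Sum>b\<in>UNIV. v b * pd b (\<Gamma> d a c) z) \<xi> u w
   - con3 (\<lambda>d a b. \<Sum>c\<in>UNIV. w c * pd c (\<Gamma> d a b) z) \<xi> u v
   + con3 (\<lambda>c a b. \<Gamma> c a b z) \<xi> v (con2 (\<lambda>c a b. \<Gamma> c a b z) u w)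
   - con3 (\<lambda>c a b. \<Gamma> c a b z) \<xi> w (con2 (\<lambda>c a b. \<Gamma> c a b z) u v)"
proof -
  let ?G = "\<lambda>c a b. \<Gamma> c a b z"
  have 1: "con4 (\<lambda>d a b c. pd b (\<Gamma> d a c) z) \<xi> u v w = con3 (\<lambda>d a c. \<Sum>b\<in>UNIV. v b * pd b (\<Gamma> d a c) z) \<xi> u w"
    unfolding con4_def con3_def by (subst sum_mult_swap[of v]) simp
  have 2: "con4 (\<lambda>d a b c. pd c (\<Gamma> d a b) z) \<xi> u v w = con3 (\<lambda>d a b. \<Sum>c\<in>UNIV. w c * pd c (\<Gamma> d a b) z) \<xi> u v"
    unfolding con4_def con3_def by simp
  have 3: "(\<Sum>a\<in>UNIV. u a * (\<Sum>b\<in>UNIV. v b * (\<Sum>c\<in>UNIV. w c * (\<Sum>f\<in>UNIV. \<Gamma> d b f z * \<Gamma> f a c z))))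
      = (\<Sum>b\<in>UNIV. v b * (\<Sum>f\<in>UNIV. con2 ?G u w f * \<Gamma> d b f z))" for d v w
  proof -
    have "(\<Sum>a\<in>UNIV. u a * (\<Sum>c\<in>UNIV. w c * (\<Sum>f\<in>UNIV. \<Gamma> d b f z * \<Gamma> f a c z)))
       = (\<Sum>f\<in>UNIV. \<Gamma> d b f z * con2 ?G u w f)" for b
      unfolding con2_def by (rule sum_mult_swap3)
    then show ?thesis
      by (subst sum_mult_swap) (simp add: mult.commute)
  qed
  have 4: "con4 (\<lambda>d a b c. \<Sum>f\<in>UNIV. \<Gamma> d b f z * \<Gamma> f a c z) \<xi> u v w = con3 ?G \<xi> v (con2 ?G u w)"
    unfolding con4_def con3_def 3 ..
  have 5: "con4 (\<lambda>d a b c. \<Sum>f\<in>UNIV. \<Gamma> d c f z * \<Gamma> f a b z) \<xi> u v w = con3 ?G \<xi> w (con2 ?G u v)"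
  proof -
    have "con4 (\<lambda>d a b c. \<Sum>f\<in>UNIV. \<Gamma> d c f z * \<Gamma> f a b z) \<xi> u v w = con4 (\<lambda>d a b c. \<Sum>f\<in>UNIV. \<Gamma> d b f z * \<Gamma> f a c z) \<xi> u w v"
      unfolding con4_def by (subst sum_mult_swap[of v]) simp
    also have "\<dots> = con3 ?G \<xi> w (con2 ?G u v)" unfolding con4_def con3_def 3 ..
    finally show ?thesis .
  qed
  have "con4 (\<lambda>d a b c. curv \<Gamma> d a b c z) \<xi> u v w = con4 (\<lambda>d a b c. pd b (\<Gamma> d a c) z) \<xi> u v w
      - con4 (\<lambda>d a b c. pd c (\<Gamma> d a b) z) \<xi> u v w + con4 (\<lambda>d a b c. \<Sum>f\<in>UNIV. \<Gamma> d b f z * \<Gamma> f a c z) \<xi> u v w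
      - con4 (\<lambda>d a b c. \<Sum>f\<in>UNIV. \<Gamma> d c f z * \<Gamma> f a b z) \<xi> u v w"
    unfolding con4_def curv_def distrib_left right_diff_distrib sum.distrib sum_subtractf by simp
  then show ?thesis unfolding 1 2 4 5 .
qed

section \<open>Polynomial dependence on the slope\<close>

definition polyfun :: "('k::comm_ring_1 \<Rightarrow> 'k) \<Rightarrow> bool" where
  "polyfun f \<longleftrightarrow> (\<exists>P. \<forall>t. f t = poly P t)"

lemma polyfun_const: "polyfun (\<lambda>_. c)"
  unfolding polyfun_def by (rule exI[of _ "[:c:]"]) simp

lemma polyfun_linear: "polyfun (\<lambda>t. a + t * b)"
  unfolding polyfun_def by (rule exI[of _ "[:a, b:]"]) simp

lemma polyfun_mult: "polyfun f \<Longrightarrow> polyfun g \<Longrightarrow> polyfun (\<lambda>t. f t * g t)"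
  unfolding polyfun_def by (metis poly_mult)

lemma polyfun_sum: "(\<And>i. i \<in> I \<Longrightarrow> polyfun (f i)) \<Longrightarrow> polyfun (\<lambda>t. \<Sum>i\<in>I. f i t)"
  unfolding polyfun_def
proof -
  assume "\<And>i. i \<in> I \<Longrightarrow> \<exists>P. \<forall>t. f i t = poly P t"
  then obtain P where "\<And>i t. i \<in> I \<Longrightarrow> f i t = poly (P i) t" by metis
  then have "\<forall>t. (\<Sum>i\<in>I. f i t) = poly (\<Sum>i\<in>I. P i) t" by (simp add: poly_sum)
  then show "\<exists>P. \<forall>t. (\<Sum>i\<in>I. f i t) = poly P t" ..
qed

lemma polyfun_con4:
  assumes "\<And>d. polyfun (\<lambda>t. \<xi> t d)" "\<And>d. polyfun (\<lambda>t. u t d)" "\<And>d. polyfun (\<lambda>t. v t d)" "\<And>d. polyfun (\<lambda>t. w t d)"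
  shows "polyfun (\<lambda>t. con4 T (\<xi> t) (u t) (v t) (w t))"
  unfolding con4_def by (intro polyfun_sum polyfun_mult assms polyfun_const)

text \<open>A nonzero polynomial has finitely many roots, and a punctured disc is infinite. Besides
  continuation away from a neighbourhood, the puncture allows the value at 0 to be reached as a
  limit; \<open>con4_kernel\<close> uses both.\<close>

lemma polyfun_zero:
  fixes f :: "'k::real_normed_field \<Rightarrow> 'k"
  assumes f: "polyfun f" and e: "0 < e" and z: "\<And>t. t \<noteq> 0 \<Longrightarrow> norm t < e \<Longrightarrow> f t = 0"
  shows "f t = 0"
proof -
  obtain P where P: "\<And>t. f t = poly P t" using f by (auto simp: polyfun_def)
  have "P = 0"
  proof (rule ccontr)
    assume "P \<noteq> 0"
    then have "finite {t. poly P t = 0}" by (rule poly_roots_finite)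
    moreover have "(of_real :: real \<Rightarrow> 'k) ` {0<..<e} \<subseteq> {t. poly P t = 0}" using z P by auto
    ultimately have "finite ((of_real :: real \<Rightarrow> 'k) ` {0<..<e})" by (rule finite_subset[rotated])
    then have "finite {0<..<e}" by (rule finite_imageD) (auto intro: inj_onI)
    with e show False by (simp add: infinite_Ioo)
  qed
  then show ?thesis by (simp add: P)
qed

text \<open>The covector \<open>dy - p dx\<close> of a jet and the vectors \<open>\<partial>/\<partial>x\<^sup>i + p\<^sub>i \<partial>/\<partial>y\<close> that span its kernel;
  the index \<open>None\<close> stands for \<open>y\<close>.\<close>

definition xi :: "'k::comm_ring_1 ^ 'n \<Rightarrow> 'n option \<Rightarrow> 'k" where
  "xi p = (\<lambda>c. case c of None \<Rightarrow> 1 | Some k \<Rightarrow> - p $ k)"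

definition tv :: "'k::comm_ring_1 ^ 'n \<Rightarrow> 'n \<Rightarrow> 'n option \<Rightarrow> 'k" where
  "tv p i = (\<lambda>a. case a of None \<Rightarrow> p $ i | Some j \<Rightarrow> if j = i then 1 else 0)"

lemma sum_if_mult: "(\<Sum>x\<in>UNIV. (if x = i then 1 else 0) * g x) = g i" "(\<Sum>x\<in>UNIV. g x * (if x = i then 1 else 0)) = g i"
  "(\<Sum>x\<in>UNIV. (if i = x then 1 else 0) * g x) = g i" "(\<Sum>x\<in>UNIV. g x * (if i = x then 1 else 0)) = g i"
  for g :: "'a::finite \<Rightarrow> 'k::comm_ring_1"
  by (simp_all add: if_distrib[where f = "\<lambda>x. _ * x"] if_distrib[where f = "\<lambda>x. x * _"] cong: if_cong)

lemma sum_tv: "(\<Sum>b\<in>UNIV. tv p j b * g b) = p $ j * g None + g (Some j)"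
  by (simp add: sum_UNIV_option tv_def sum_if_mult)

lemma xi_tv: "(\<Sum>c\<in>UNIV. xi p c * tv p i c) = 0"
  by (simp add: sum_UNIV_option xi_def tv_def sum_if_mult sum_negf if_distrib[where f = "\<lambda>x. _ * x"] cong: if_cong)

text \<open>The vectors \<open>tv p l\<close> match all components of \<open>u\<close> except the
  one along \<open>y\<close>, and \<open>xi p\<close> measures what is left there.\<close>

lemma kernel_decomp:
  fixes p :: "'k::comm_ring_1 ^ 'n::finite"
  shows "u a = (\<Sum>l\<in>UNIV. u (Some l) * tv p l a) + (\<Sum>c\<in>UNIV. xi p c * u c) * unit_cov None a"
  by (cases a) (simp_all add: sum_UNIV_option xi_def tv_def unit_cov_def sum_if_mult sum_negf mult.commute)

text \<open>The hypothesis is polynomial in \<open>p\<close>, hence holds for all \<open>p\<close>. A covector with \<open>\<xi> None \<noteq> 0\<close> is a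
  multiple of some \<open>xi p\<close>, and the remaining ones are limits of such covectors along a line.\<close>

lemma con4_kernel:
  fixes T :: "'n::finite option \<Rightarrow> 'n option \<Rightarrow> 'n option \<Rightarrow> 'n option \<Rightarrow> 'k::real_normed_field"
  assumes e: "0 < e" and T: "\<And>p i j k. norm (p - p0) < e \<Longrightarrow> con4 T (xi p) (tv p i) (tv p j) (tv p k) = 0"
    and \<xi>: "(\<Sum>x\<in>UNIV. \<xi> x * u x) = 0" "(\<Sum>x\<in>UNIV. \<xi> x * v x) = 0" "(\<Sum>x\<in>UNIV. \<xi> x * w x) = 0"
  shows "con4 T \<xi> u v w = 0"
proof -
  have all: "con4 T (xi p) (tv p i) (tv p j) (tv p k) = 0" for p i j k
  proof -
    \<comment> \<open>Along the line from \<open>p0\<close> to \<open>p\<close> the contraction is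
      polynomial in the parameter. It vanishes for small parameters, hence also at 1.\<close>
    define q where "q = p - p0"
    define g where "g = (\<lambda>t. con4 T (xi (p0 + t *s q)) (tv (p0 + t *s q) i) (tv (p0 + t *s q) j) (tv (p0 + t *s q) k))"
    have "polyfun (\<lambda>t. xi (p0 + t *s q) c)" for c
      using polyfun_linear[of 1 0] polyfun_linear[of "- p0 $ the c" "- q $ the c"] by (cases c) (simp_all add: xi_def)
    moreover have "polyfun (\<lambda>t. tv (p0 + t *s q) i c)" for c i
      using polyfun_linear[of "p0 $ i" "q $ i"] by (cases c) (auto simp: tv_def intro: polyfun_const)
    ultimately have "polyfun g" unfolding g_def by (intro polyfun_con4)
    have "norm (t *s q) = norm t * norm q" for t
      by (simp add: norm_vec_def norm_mult L2_set_def power_mult_distrib sum_distrib_left[symmetric] real_sqrt_mult)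
    then have "g t = 0" if "norm t < e / (norm q + 1)" for t
    proof -
      have "norm t * norm q \<le> norm t * (norm q + 1)" by (intro mult_left_mono) auto
      also have "\<dots> < e" using that by (simp add: pos_less_divide_eq add_nonneg_pos)
      finally show ?thesis unfolding g_def by (intro T) (simp add: \<open>\<And>t. norm (t *s q) = norm t * norm q\<close>)
    qed
    moreover have "0 < e / (norm q + 1)" using e by (intro divide_pos_pos add_nonneg_pos) auto
    ultimately have "g 1 = 0"
      using polyfun_zero[OF \<open>polyfun g\<close>, of "e / (norm q + 1)" 1] by simp
    then show ?thesis by (simp add: g_def q_def)
  qed
  have nz: "con4 T \<xi> u v w = 0" if \<xi>N: "\<xi> None \<noteq> 0" and \<xi>: "(\<Sum>x\<in>UNIV. \<xi> x * u x) = 0" "(\<Sum>x\<in>UNIV. \<xi> x * v x) = 0" "(\<Sum>x\<in>UNIV. \<xi> x * w x) = 0"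
    for \<xi> u v w
  proof -
    define p :: "'k ^ 'n" where "p = (\<chi> k. - \<xi> (Some k) / \<xi> None)"
    have \<xi>p: "\<xi> = (\<lambda>c. \<xi> None * xi p c)"
      using \<xi>N by (auto simp: fun_eq_iff xi_def p_def split: option.split)
    have dec: "u = (\<lambda>a. \<Sum>l\<in>UNIV. u (Some l) * tv p l a)" if "(\<Sum>x\<in>UNIV. \<xi> x * u x) = 0" for u
    proof -
      have "\<xi> None * (\<Sum>c\<in>UNIV. xi p c * u c) = 0"
        using that by (subst (asm) \<xi>p) (simp add: sum_distrib_left mult.assoc)
      then have "(\<Sum>c\<in>UNIV. xi p c * u c) = 0" using \<xi>N by simp
      then have "u a = (\<Sum>l\<in>UNIV. u (Some l) * tv p l a)" for a using kernel_decomp[of u a p] by simp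
      then show ?thesis by (rule ext)
    qed
    show ?thesis
      by (subst \<xi>p, subst dec[OF \<xi>(1)], subst dec[OF \<xi>(2)], subst dec[OF \<xi>(3)]) (simp only: con4_lin all mult_zero_right sum.neutral_const)
  qed
  show ?thesis
  proof (cases "\<xi> None = 0 \<and> \<xi> \<noteq> (\<lambda>_. 0)")
    case True
    then obtain d where d: "\<xi> d \<noteq> 0" "d \<noteq> None" by (metis (no_types, lifting) ext)
    \<comment> \<open>\<open>b\<close> pairs to 1 with \<xi> and has no \<open>y\<close> component.
      \<xi> is tilted to \<open>X t\<close> by a multiple of \<open>dy\<close>, and \<open>Y\<close>
      corrects the vectors along \<open>b\<close> so that they stay in the kernel; for nonzero
      \<open>t\<close> the case \<open>nz\<close> applies.\<close>
    define b where "b = (\<lambda>x. unit_cov d x * inverse (\<xi> d))"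
    have \<xi>b: "(\<Sum>x\<in>UNIV. \<xi> x * b x) = 1"
      using d(1) sum_unit_cov[of d "\<lambda>x. \<xi> x * inverse (\<xi> d)"] by (simp add: b_def mult_ac)
    have bN: "b None = 0" using d(2)[symmetric] by (simp add: b_def unit_cov_def)
    define X where "X = (\<lambda>t x. \<xi> x + t * unit_cov None x)"
    define Y where "Y = (\<lambda>u t x. u x + t * (- u None * b x))"
    have XY: "(\<Sum>x\<in>UNIV. X t x * Y u t x) = 0" if "(\<Sum>x\<in>UNIV. \<xi> x * u x) = 0" for t u
    proof -
      have "(\<Sum>x\<in>UNIV. X t x * Y u t x) = (\<Sum>x\<in>UNIV. \<xi> x * u x) - t * u None * (\<Sum>x\<in>UNIV. \<xi> x * b x)
          + t * (\<Sum>x\<in>UNIV. unit_cov None x * u x) - t * t * u None * (\<Sum>x\<in>UNIV. unit_cov None x * b x)"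
        by (simp add: X_def Y_def algebra_simps sum.distrib sum_subtractf sum_distrib_left)
      then show ?thesis by (simp add: that \<xi>b sum_unit_cov bN)
    qed
    have pf: "polyfun (\<lambda>t. con4 T (X t) (Y u t) (Y v t) (Y w t))"
      unfolding X_def Y_def by (intro polyfun_con4 polyfun_linear)
    have zz: "con4 T (X t) (Y u t) (Y v t) (Y w t) = 0" if "t \<noteq> 0" for t
      by (rule nz) (use that True XY \<xi> in \<open>auto simp: X_def unit_cov_def\<close>)
    have "con4 T (X 0) (Y u 0) (Y v 0) (Y w 0) = 0"
      by (rule polyfun_zero[OF pf zero_less_one]) (rule zz)
    then show ?thesis by (simp add: X_def Y_def)
  next
    case False
    then show ?thesis using nz[of \<xi> u v w] \<xi> by (auto simp: con4_def)
  qed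
qed

definition quad :: "('n::finite option \<Rightarrow> 'n option \<Rightarrow> 'n option \<Rightarrow> 'k::comm_ring_1) \<Rightarrow> 'k ^ 'n \<Rightarrow> 'n \<Rightarrow> 'n \<Rightarrow> 'k" where
  "quad \<Gamma> p i j = - con3 \<Gamma> (xi p) (tv p i) (tv p j)"

text \<open>Each added term contracts to a multiple of \<open>xi p\<close> applied to
  \<open>tv p i\<close> or to \<open>tv p j\<close>, which is 0.\<close>

lemma quad_projective:
  "quad (\<lambda>c a b. \<Gamma> c a b + (if c = a then \<alpha> b else 0) + (if c = b then \<alpha> a else 0)) p i j = quad \<Gamma> p i j"
proof -
  have 1: "con3 (\<lambda>c a b. if c = a then \<alpha> b else 0) (xi p) u v = (\<Sum>c\<in>UNIV. xi p c * u c) * (\<Sum>b\<in>UNIV. v b * \<alpha> b)" for u v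
  proof -
    have "(\<Sum>a\<in>UNIV. u a * (\<Sum>b\<in>UNIV. v b * (if c = a then \<alpha> b else 0))) =
        (\<Sum>a\<in>UNIV. (if c = a then 1 else 0) * (u a * (\<Sum>b\<in>UNIV. v b * \<alpha> b)))" for c
      by (intro sum.cong) auto
    then have "(\<Sum>a\<in>UNIV. u a * (\<Sum>b\<in>UNIV. v b * (if c = a then \<alpha> b else 0))) = u c * (\<Sum>b\<in>UNIV. v b * \<alpha> b)" for c
      by (simp only: sum_if_mult)
    then show ?thesis unfolding con3_def by (simp add: sum_distrib_right mult.assoc)
  qed
  have 2: "con3 (\<lambda>c a b. if c = b then \<alpha> a else 0) (xi p) u v = con3 (\<lambda>c a b. if c = a then \<alpha> b else 0) (xi p) v u" for u v
    unfolding con3_def by (subst sum_mult_swap[of u]) simp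
  have "con3 (\<lambda>c a b. \<Gamma> c a b + (if c = a then \<alpha> b else 0) + (if c = b then \<alpha> a else 0)) (xi p) (tv p i) (tv p j)
     = con3 \<Gamma> (xi p) (tv p i) (tv p j) + con3 (\<lambda>c a b. if c = a then \<alpha> b else 0) (xi p) (tv p i) (tv p j)
      + con3 (\<lambda>c a b. if c = b then \<alpha> a else 0) (xi p) (tv p i) (tv p j)"
    unfolding con3_def distrib_left sum.distrib by simp
  then show ?thesis by (simp add: quad_def 1 2 xi_tv)
qed

text \<open>The linear terms with \<open>\<Gamma> None (Some j) None\<close> carry no summation
  index; Kronecker deltas bring them under the sum over \<open>k\<close>. The term with
  \<open>\<Gamma> None None None\<close> is symmetric in \<open>i\<close> and \<open>j\<close> and
  is split evenly between the two \<open>L\<close> terms.\<close>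

lemma quad_cubic:
  fixes \<Gamma> :: "'n::finite option \<Rightarrow> 'n option \<Rightarrow> 'n option \<Rightarrow> 'k::field_char_0"
  assumes sym: "\<And>c a b. \<Gamma> c a b = \<Gamma> c b a"
  shows "quad \<Gamma> p i j = - \<Gamma> None (Some i) (Some j) + (\<Sum>k\<in>UNIV. p $ k *
     ((\<Gamma> (Some k) (Some i) (Some j) - (if k = i then \<Gamma> None (Some j) None else 0) - (if k = j then \<Gamma> None (Some i) None else 0))
      + 1/2 * p $ i * (2 * \<Gamma> (Some k) (Some j) None - (if k = j then \<Gamma> None None None else 0))
      + 1/2 * p $ j * (2 * \<Gamma> (Some k) (Some i) None - (if k = i then \<Gamma> None None None else 0))
      + p $ i * p $ j * \<Gamma> (Some k) None None))"
proof -
  define cc where "cc = (\<lambda>c. \<Gamma> c (Some i) (Some j) + p $ i * \<Gamma> c (Some j) None + p $ j * \<Gamma> c (Some i) None + p $ i * p $ j * \<Gamma> c None None)"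
  have "con2 \<Gamma> (tv p i) (tv p j) c = cc c" for c
    by (simp only: con2_def sum_tv cc_def sym[of c None "Some i"] sym[of c None "Some j"]) (simp add: algebra_simps)
  define S where "S = (\<Sum>k\<in>UNIV. p $ k * cc (Some k))"
  define t where "t = 1/2 * p $ i * p $ j * \<Gamma> None None None"
  have tt: "t + t = p $ i * p $ j * \<Gamma> None None None" by (simp add: t_def)
  have q: "quad \<Gamma> p i j = S - cc None"
    using \<open>\<And>c. con2 \<Gamma> (tv p i) (tv p j) c = cc c\<close>
    by (simp add: quad_def con3_con2 sum_UNIV_option xi_def sum_negf S_def)
  have "(\<Sum>k\<in>UNIV. p $ k *
     ((\<Gamma> (Some k) (Some i) (Some j) - (if k = i then \<Gamma> None (Some j) None else 0) - (if k = j then \<Gamma> None (Some i) None else 0))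
      + 1/2 * p $ i * (2 * \<Gamma> (Some k) (Some j) None - (if k = j then \<Gamma> None None None else 0))
      + 1/2 * p $ j * (2 * \<Gamma> (Some k) (Some i) None - (if k = i then \<Gamma> None None None else 0))
      + p $ i * p $ j * \<Gamma> (Some k) None None)) =
    (\<Sum>k\<in>UNIV. p $ k * cc (Some k) - (if k = i then p $ i * \<Gamma> None (Some j) None else 0) - (if k = j then p $ j * \<Gamma> None (Some i) None else 0)
      - (if k = j then t else 0) - (if k = i then t else 0))"
    by (intro sum.cong) (auto simp: cc_def t_def algebra_simps)
  also have "\<dots> = S - p $ i * \<Gamma> None (Some j) None - p $ j * \<Gamma> None (Some i) None - (t + t)"
    by (simp add: sum_subtractf S_def)
  finally show ?thesis unfolding q tt by (simp add: cc_def algebra_simps)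
qed

lemma con3_deriv:
  fixes \<Gamma> :: "'k::real_normed_field \<Rightarrow> 'a::finite \<Rightarrow> 'a \<Rightarrow> 'a \<Rightarrow> 'k"
  assumes \<Gamma>: "\<And>c a b. ((\<lambda>t. \<Gamma> t c a b) has_field_derivative \<Gamma>' c a b) (at t0)"
    and \<xi>: "\<And>c. ((\<lambda>t. \<xi> t c) has_field_derivative \<xi>' c) (at t0)"
    and u: "\<And>c. ((\<lambda>t. u t c) has_field_derivative u' c) (at t0)"
    and v: "\<And>c. ((\<lambda>t. v t c) has_field_derivative v' c) (at t0)"
  shows "((\<lambda>t. con3 (\<Gamma> t) (\<xi> t) (u t) (v t)) has_field_derivative
    con3 (\<Gamma> t0) \<xi>' (u t0) (v t0) + con3 \<Gamma>' (\<xi> t0) (u t0) (v t0) +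
    con3 (\<Gamma> t0) (\<xi> t0) u' (v t0) + con3 (\<Gamma> t0) (\<xi> t0) (u t0) v') (at t0)"
proof -
  have 1: "((\<lambda>t. \<Sum>b\<in>UNIV. v t b * \<Gamma> t c a b) has_field_derivative (\<Sum>b\<in>UNIV. v' b * \<Gamma> t0 c a b + \<Gamma>' c a b * v t0 b)) (at t0)" for c a
    by (intro DERIV_sum DERIV_mult v \<Gamma>)
  have 2: "((\<lambda>t. \<Sum>a\<in>UNIV. u t a * (\<Sum>b\<in>UNIV. v t b * \<Gamma> t c a b)) has_field_derivative
     (\<Sum>a\<in>UNIV. u' a * (\<Sum>b\<in>UNIV. v t0 b * \<Gamma> t0 c a b) + (\<Sum>b\<in>UNIV. v' b * \<Gamma> t0 c a b + \<Gamma>' c a b * v t0 b) * u t0 a)) (at t0)" for c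
    by (intro DERIV_sum DERIV_mult u 1)
  have 3: "((\<lambda>t. con3 (\<Gamma> t) (\<xi> t) (u t) (v t)) has_field_derivative
    (\<Sum>c\<in>UNIV. \<xi>' c * (\<Sum>a\<in>UNIV. u t0 a * (\<Sum>b\<in>UNIV. v t0 b * \<Gamma> t0 c a b)) +
     (\<Sum>a\<in>UNIV. u' a * (\<Sum>b\<in>UNIV. v t0 b * \<Gamma> t0 c a b) + (\<Sum>b\<in>UNIV. v' b * \<Gamma> t0 c a b + \<Gamma>' c a b * v t0 b) * u t0 a) * \<xi> t0 c)) (at t0)"
    unfolding con3_def by (intro DERIV_sum DERIV_mult \<xi> 2)
  show ?thesis
    by (rule DERIV_cong[OF 3]) (simp add: con3_def distrib_left distrib_right sum.distrib sum_distrib_left sum_distrib_right mult_ac)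
qed

lemma DERIV_vec_line:
  "an f w \<Longrightarrow> ((\<lambda>t. f (w + t *s d)) has_field_derivative (\<Sum>m\<in>UNIV. pd m f w * d $ m)) (at 0)"
proof -
  assume f: "an f w"
  have eq: "w + t *s d = (\<chi> m. w $ m + t * d $ m)" for t by (simp add: vec_eq_iff)
  have "((\<lambda>t. w $ m + t * d $ m) has_derivative (\<lambda>t. t * d $ m)) (at 0)" for m
    by (auto intro!: derivative_eq_intros)
  from has_derivative_compose_vec[of f "\<lambda>m t. w $ m + t * d $ m" 0, OF _ this] f
  have "((\<lambda>t. f (w + t *s d)) has_derivative (\<lambda>t. \<Sum>m\<in>UNIV. pd m f w * (t * d $ m))) (at 0)"
    by (simp add: eq vec_lambda_eta)
  then show ?thesis
    unfolding has_field_derivative_def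
    by (rule has_derivative_eq_rhs) (simp add: fun_eq_iff sum_distrib_left sum_distrib_right mult_ac)
qed

text \<open>The total derivative is the derivative of \<open>F\<close> along the jet direction given
  by \<open>tv p k\<close> and the values \<open>F k l\<close>; it is evaluated through the formula
  \<open>quad\<close>. The terms with \<open>B\<close> add up to an expression symmetric in all
  three indices and drop out of the integrability condition, which leaves the contracted
  curvature.\<close>

lemma curvature_condition:
  fixes F :: "('k::scalar_field, 'n::finite) system"
    and \<Gamma> :: "'n option \<Rightarrow> 'n option \<Rightarrow> 'n option \<Rightarrow> 'k ^ 'n option \<Rightarrow> 'k"
  assumes sys: "analytic_system F \<Omega>" and ci: "completely_integrable F \<Omega>"
    and N: "open N" "N \<subseteq> \<Omega>" and sym: "\<And>c a b. \<Gamma> c a b = \<Gamma> c b a"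
    and F: "\<And>z p i j. jt (join z p) \<in> N \<Longrightarrow> F i j (jt (join z p)) = quad (\<lambda>c a b. \<Gamma> c a b z) p i j"
    and an\<Gamma>: "\<And>z p c a b. jt (join z p) \<in> N \<Longrightarrow> an (\<Gamma> c a b) z"
    and zp: "jt (join z p) \<in> N"
  shows "con4 (\<lambda>d a b c. curv \<Gamma> d a b c z) (xi p) (tv p i) (tv p k) (tv p j) = 0"
proof -
  define w where "w = join z p"
  define FF where "FF = (\<lambda>i j w. F i j (jt w))"
  define G where "G = (\<lambda>c a b. \<Gamma> c a b z)"
  define dp where "dp = (\<lambda>k. \<chi> l. FF k l w)"
  define dz where "dz = (\<lambda>k. \<chi> a. tv p k a)"
  have w\<Omega>: "jt w \<in> \<Omega>" using zp N by (auto simp: w_def)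
  have anFF: "an (FF i j) w" for i j
    using sys w\<Omega> by (auto simp: analytic_system_def analytic_on_jets_iff FF_def)
  have FF_sym: "FF i j w = FF j i w" for i j
    using sys w\<Omega> by (auto simp: analytic_system_def FF_def)
  have FFq: "FF i j w = - con3 G (xi p) (tv p i) (tv p j)" for i j
    using F[OF zp, of i j] by (simp add: FF_def w_def quad_def G_def)
  have G_sym: "G c a b = G c b a" for c a b by (simp add: G_def sym[of c a])
  \<comment> \<open>\<open>B\<close> arises because moving along a jet direction changes the vectors
    \<open>tv\<close> by multiples of the \<open>y\<close> direction.\<close>
  define B where "B = (\<lambda>k. con3 G (xi p) (tv p k) (unit_cov None))"
  define C' where "C' = (\<lambda>k i j. con3 (\<lambda>c a b. \<Sum>e\<in>UNIV. tv p k e * pd e (\<Gamma> c a b) z) (xi p) (tv p i) (tv p j))"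
  define Q where "Q = (\<lambda>k i j. con3 G (xi p) (tv p k) (con2 G (tv p i) (tv p j)))"
  have TD: "total_diff F k (F i j) (jt w) = - (Q k i j + FF i j w * B k + C' k i j + FF k i w * B j + FF k j w * B i)" for i j k
  proof -
    have "((\<lambda>t. FF i j (w + t *s join (dz k) (dp k))) has_field_derivative
        (\<Sum>m\<in>UNIV. pd m (FF i j) w * join (dz k) (dp k) $ m)) (at 0)"
      by (rule DERIV_vec_line[OF anFF])
    moreover have "(\<Sum>m\<in>UNIV. pd m (FF i j) w * join (dz k) (dp k) $ m) = total_diff F k (F i j) (jt w)"
      by (simp add: total_diff_pd sum_UNIV_Plus sum_UNIV_option dz_def dp_def FF_def tv_def sum_if_mult)
        (simp add: w_def mult.commute)
    ultimately have 1: "((\<lambda>t. FF i j (w + t *s join (dz k) (dp k))) has_field_derivative total_diff F k (F i j) (jt w)) (at 0)"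
      by simp
    have line: "w + t *s join (dz k) (dp k) = join (z + t *s dz k) (p + t *s dp k)" for t
      by (auto simp: w_def join_def vec_eq_iff split: sum.split)
    define g where "g = (\<lambda>t. - con3 (\<lambda>c a b. \<Gamma> c a b (z + t *s dz k)) (xi (p + t *s dp k)) (tv (p + t *s dp k) i) (tv (p + t *s dp k) j))"
    have cont: "continuous_on UNIV (\<lambda>t. jt (w + t *s join (dz k) (dp k)))"
    proof (rule continuous_on_compose2[OF continuous_jt])
      have "w + t *s d = (\<chi> m. w $ m + t * d $ m)" for t d by (simp add: vec_eq_iff)
      then show "continuous_on UNIV (\<lambda>t. w + t *s join (dz k) (dp k))" by (auto intro!: continuous_intros)
    qed auto
    have "open ((\<lambda>t. jt (w + t *s join (dz k) (dp k))) -` N)" by (rule open_vimage[OF N(1) cont])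
    moreover have "0 \<in> (\<lambda>t. jt (w + t *s join (dz k) (dp k))) -` N" using zp by (simp add: w_def)
    moreover have "FF i j (w + t *s join (dz k) (dp k)) = g t" if "t \<in> (\<lambda>t. jt (w + t *s join (dz k) (dp k))) -` N" for t
      using that F[of "z + t *s dz k" "p + t *s dp k" i j] by (simp add: FF_def g_def quad_def line)
    ultimately have 2: "(g has_field_derivative total_diff F k (F i j) (jt w)) (at 0)"
      using has_field_derivative_transform_within_open[OF 1] by blast
    have D\<Gamma>: "((\<lambda>t. \<Gamma> c a b (z + t *s dz k)) has_field_derivative (\<Sum>e\<in>UNIV. tv p k e * pd e (\<Gamma> c a b) z)) (at 0)" for c a b
      using DERIV_vec_line[OF an\<Gamma>[OF zp], of c a b "dz k"] by (simp add: dz_def mult.commute)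
    have D\<xi>: "((\<lambda>t. xi (p + t *s dp k) c) has_field_derivative (case c of None \<Rightarrow> 0 | Some l \<Rightarrow> - FF k l w)) (at 0)" for c
      by (cases c) (auto simp: xi_def dp_def intro!: derivative_eq_intros)
    have Dtv: "((\<lambda>t. tv (p + t *s dp k) i c) has_field_derivative FF k i w * unit_cov None c) (at 0)" for c i
      by (cases c) (auto simp: tv_def dp_def unit_cov_def intro!: derivative_eq_intros)
    have 3: "(g has_field_derivative - (con3 G (\<lambda>c. case c of None \<Rightarrow> 0 | Some l \<Rightarrow> - FF k l w) (tv p i) (tv p j) + C' k i j
        + con3 G (xi p) (\<lambda>c. FF k i w * unit_cov None c) (tv p j) + con3 G (xi p) (tv p i) (\<lambda>c. FF k j w * unit_cov None c))) (at 0)"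
      using DERIV_minus[OF con3_deriv[OF D\<Gamma> D\<xi> Dtv Dtv]] by (simp add: g_def G_def C'_def)
    have "con3 G (\<lambda>c. case c of None \<Rightarrow> 0 | Some l \<Rightarrow> - FF k l w) (tv p i) (tv p j) =
        (\<Sum>l\<in>UNIV. con2 G (tv p i) (tv p j) (Some l) * con3 G (xi p) (tv p k) (tv p l))"
      by (subst con3_con2) (simp add: sum_UNIV_option FFq mult.commute)
    \<comment> \<open>Split the vector obtained from \<open>G\<close> on \<open>tv p i\<close> and
      \<open>tv p j\<close> by \<open>kernel_decomp\<close>. Its part in the kernel of
      \<open>xi p\<close> reproduces the term from the derivative of the covector; its
      \<open>y\<close> part gives a multiple of \<open>B k\<close>.\<close>
    moreover have "Q k i j = (\<Sum>l\<in>UNIV. con2 G (tv p i) (tv p j) (Some l) * con3 G (xi p) (tv p k) (tv p l))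
        + con3 G (xi p) (tv p i) (tv p j) * B k"
    proof -
      have "con2 G (tv p i) (tv p j) = (\<lambda>a. (\<Sum>l\<in>UNIV. con2 G (tv p i) (tv p j) (Some l) * tv p l a) + con3 G (xi p) (tv p i) (tv p j) * unit_cov None a)"
        by (rule ext, subst con3_con2) (rule kernel_decomp)
      then have "Q k i j = con3 G (xi p) (tv p k) (\<lambda>a. (\<Sum>l\<in>UNIV. con2 G (tv p i) (tv p j) (Some l) * tv p l a) + con3 G (xi p) (tv p i) (tv p j) * unit_cov None a)"
        unfolding Q_def by (rule arg_cong)
      then show ?thesis by (simp only: con3_lin B_def)
    qed
    moreover have "con3 G (xi p) (\<lambda>c. FF k i w * unit_cov None c) (tv p j) = FF k i w * B j"
      by (subst con3_sym[OF G_sym]) (simp only: con3_lin B_def)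
    moreover have "con3 G (xi p) (tv p i) (\<lambda>c. FF k j w * unit_cov None c) = FF k j w * B i"
      by (simp only: con3_lin B_def)
    ultimately have "con3 G (\<lambda>c. case c of None \<Rightarrow> 0 | Some l \<Rightarrow> - FF k l w) (tv p i) (tv p j) + C' k i j
        + con3 G (xi p) (\<lambda>c. FF k i w * unit_cov None c) (tv p j) + con3 G (xi p) (tv p i) (\<lambda>c. FF k j w * unit_cov None c)
        = Q k i j + FF i j w * B k + C' k i j + FF k i w * B j + FF k j w * B i"
      by (simp add: FFq)
    with DERIV_unique[OF 2 3] show ?thesis by simp
  qed
  have "total_diff F k (F i j) (jt w) = total_diff F j (F i k) (jt w)"
    using ci w\<Omega> by (auto simp: completely_integrable_def)
  then have "Q k i j + C' k i j - Q j i k - C' j i k = 0"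
    unfolding TD FF_sym[of k i] FF_sym[of k j] FF_sym[of j i] by (simp add: algebra_simps)
  moreover have "con4 (\<lambda>d a b c. curv \<Gamma> d a b c z) (xi p) (tv p i) (tv p k) (tv p j) = C' k i j - C' j i k + Q k i j - Q j i k"
    unfolding con4_curv C'_def Q_def G_def by simp
  ultimately show ?thesis by (simp add: algebra_simps)
qed

section \<open>Changes of coordinates\<close>

definition has_partials :: "('k::scalar_field ^ 'n::finite \<Rightarrow> 'k) \<Rightarrow> ('n \<Rightarrow> 'k) \<Rightarrow> 'k ^ 'n \<Rightarrow> bool" where
  "has_partials f D x \<longleftrightarrow> (f has_derivative (\<lambda>h. \<Sum>i\<in>UNIV. D i * h $ i)) (at x)"

lemma has_partials_const: "has_partials (\<lambda>_. c) (\<lambda>_. 0) x"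
  by (simp add: has_partials_def)

lemma has_partials_uminus: "has_partials f D x \<Longrightarrow> has_partials (\<lambda>x. - f x) (\<lambda>i. - D i) x"
  unfolding has_partials_def by (rule has_derivative_eq_rhs, rule has_derivative_minus) (simp_all add: sum_negf)

lemma has_partials_mult:
  assumes "has_partials f D x" "has_partials g D' x"
  shows "has_partials (\<lambda>x. f x * g x) (\<lambda>i. D i * g x + f x * D' i) x"
proof -
  have "((\<lambda>x. f x * g x) has_derivative (\<lambda>h. f x * (\<Sum>i\<in>UNIV. D' i * h $ i) + (\<Sum>i\<in>UNIV. D i * h $ i) * g x)) (at x)"
    using assms unfolding has_partials_def by (rule has_derivative_mult)
  moreover have "f x * (\<Sum>i\<in>UNIV. D' i * h $ i) + (\<Sum>i\<in>UNIV. D i * h $ i) * g x =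
      (\<Sum>i\<in>UNIV. (D i * g x + f x * D' i) * h $ i)" for h
    unfolding sum_distrib_left sum_distrib_right sum.distrib[symmetric] by (intro sum.cong) (simp_all add: algebra_simps)
  ultimately show ?thesis by (simp add: has_partials_def)
qed

lemma has_partials_sum: "(\<And>j. j \<in> J \<Longrightarrow> has_partials (f j) (D j) x) \<Longrightarrow> has_partials (\<lambda>x. \<Sum>j\<in>J. f j x) (\<lambda>i. \<Sum>j\<in>J. D j i) x"
  unfolding has_partials_def
  by (rule has_derivative_eq_rhs, rule has_derivative_sum) (auto simp: sum_distrib_right fun_eq_iff intro: sum.swap)

lemma has_partials_inverse: "has_partials f D x \<Longrightarrow> f x \<noteq> 0 \<Longrightarrow> has_partials (\<lambda>x. inverse (f x)) (\<lambda>i. - (inverse (f x) * D i * inverse (f x))) x"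
  unfolding has_partials_def
  by (rule has_derivative_eq_rhs, rule Deriv.has_derivative_inverse)
    (auto simp: sum_distrib_left sum_distrib_right sum_negf mult_ac fun_eq_iff)

lemma has_partials_compose:
  fixes U :: "'m::finite \<Rightarrow> 'k::scalar_field ^ 'n::finite \<Rightarrow> 'k"
  assumes "an f (\<chi> m. U m x)" "\<And>m. has_partials (U m) (D m) x"
  shows "has_partials (\<lambda>x. f (\<chi> m. U m x)) (\<lambda>i. \<Sum>m\<in>UNIV. pd m f (\<chi> m. U m x) * D m i) x"
proof -
  have "((\<lambda>h. f (\<chi> j. U j h)) has_derivative (\<lambda>k. \<Sum>j\<in>UNIV. pd j f (\<chi> j. U j x) * (\<Sum>i\<in>UNIV. D j i * k $ i))) (at x)"
    by (rule has_derivative_compose_vec[where f = f and U = U, OF assms(1)]) (use assms(2) in \<open>simp add: has_partials_def\<close>)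
  moreover have "(\<Sum>j\<in>UNIV. pd j f (\<chi> j. U j x) * (\<Sum>i\<in>UNIV. D j i * k $ i)) =
      (\<Sum>i\<in>UNIV. (\<Sum>j\<in>UNIV. pd j f (\<chi> j. U j x) * D j i) * k $ i)" for k
    unfolding sum_distrib_left sum_distrib_right by (subst sum.swap) (simp add: mult.assoc)
  ultimately show ?thesis by (simp add: has_partials_def)
qed

lemma has_partials_nth: "has_partials (\<lambda>x. x $ j) (\<lambda>i. if i = j then 1 else 0) x"
  using an_has_derivative[OF an_nth[of j x]] by (simp add: has_partials_def pd_nth)

lemma has_partials_unique:
  assumes "has_partials f D x" "has_partials f D' x"
  shows "D i = D' i"
proof -
  have "(\<lambda>h. \<Sum>i\<in>UNIV. D i * h $ i) = (\<lambda>h. \<Sum>i\<in>UNIV. D' i * h $ i)"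
    using assms unfolding has_partials_def by (rule has_derivative_unique)
  from fun_cong[OF this, of "axis i 1"] show ?thesis
    by (simp add: axis_def sum_if_mult)
qed

lemma has_partials_transform:
  assumes "has_partials f D x" "open U" "x \<in> U" "\<And>x. x \<in> U \<Longrightarrow> f x = g x"
  shows "has_partials g D x"
  using assms unfolding has_partials_def by (rule has_derivative_transform_within_open)

lemma has_partials_isCont: "has_partials f D x \<Longrightarrow> isCont f x"
  unfolding has_partials_def by (rule has_derivative_continuous)

lemma has_partials_compose_map:
  assumes "has_partials f D (g X)" "(g has_derivative g') (at X)"
  shows "((\<lambda>X. f (g X)) has_derivative (\<lambda>H. \<Sum>i\<in>UNIV. D i * g' H $ i)) (at X)"
  using has_derivative_compose[OF assms(2), of f] assms(1) by (simp add: has_partials_def)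

text \<open>The data are symmetric under exchange of (\<Phi>, \<open>W\<close>) and (\<Psi>,
  \<open>W'\<close>), so that \<open>dual\<close> yields each result for the inverse map
  too.\<close>

locale coord_change =
  fixes \<Phi> \<Psi> :: "'k::scalar_field ^ 'n::finite option \<Rightarrow> 'k ^ 'n option" and W W' :: "('k ^ 'n option) set"
  assumes open_W: "open W" and open_W': "open W'"
    and \<Phi>_W: "z \<in> W \<Longrightarrow> \<Phi> z \<in> W'" and \<Psi>_\<Phi>: "z \<in> W \<Longrightarrow> \<Psi> (\<Phi> z) = z"
    and \<Psi>_W': "w \<in> W' \<Longrightarrow> \<Psi> w \<in> W" and \<Phi>_\<Psi>: "w \<in> W' \<Longrightarrow> \<Phi> (\<Psi> w) = w"
    and an_\<Phi>: "z \<in> W \<Longrightarrow> an (\<lambda>z. \<Phi> z $ A) z"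
    and an_\<Psi>: "w \<in> W' \<Longrightarrow> an (\<lambda>w. \<Psi> w $ A) w"
begin

lemma dual: "coord_change \<Psi> \<Phi> W' W"
  by unfold_locales (fact open_W open_W' \<Phi>_W \<Psi>_\<Phi> \<Psi>_W' \<Phi>_\<Psi> an_\<Phi> an_\<Psi>)+

definition J :: "'n option \<Rightarrow> 'n option \<Rightarrow> 'k ^ 'n option \<Rightarrow> 'k" where
  "J A a = pd a (\<lambda>z. \<Phi> z $ A)"

text \<open>The inverse Jacobian sits at \<open>\<Phi> z\<close> but is indexed by \<open>z\<close>,
  so that \<open>J\<close> and \<open>K\<close> are inverse matrices at one and the same
  point.\<close>

definition K :: "'n option \<Rightarrow> 'n option \<Rightarrow> 'k ^ 'n option \<Rightarrow> 'k" where
  "K a A z = pd A (\<lambda>w. \<Psi> w $ a) (\<Phi> z)"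

lemma an_J: "z \<in> W \<Longrightarrow> an (J A a) z"
  unfolding J_def by (intro an_pd an_\<Phi>)

lemma an_K: "z \<in> W \<Longrightarrow> an (K a A) z"
proof -
  assume z: "z \<in> W"
  have "an (\<lambda>z. pd A (\<lambda>w. \<Psi> w $ a) (\<chi> B. \<Phi> z $ B)) z"
    by (rule an_compose) (auto simp: vec_lambda_eta intro!: an_pd an_\<Psi> an_\<Phi> \<Phi>_W z)
  then show ?thesis by (simp add: K_def[abs_def] vec_lambda_eta)
qed

lemma KJ: 
  assumes z: "z \<in> W"
  shows "(\<Sum>A\<in>UNIV. K c A z * J A a z) = (if a = c then 1 else 0)"
proof -
  have "pd a (\<lambda>z. \<Psi> (\<chi> A. \<Phi> z $ A) $ c) z = (\<Sum>A\<in>UNIV. K c A z * J A a z)"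
    by (subst pd_compose[of "\<lambda>w. \<Psi> w $ c"]) (auto simp: vec_lambda_eta K_def J_def intro!: an_\<Psi> an_\<Phi> \<Phi>_W z)
  moreover have "pd a (\<lambda>z. z $ c) z = pd a (\<lambda>z. \<Psi> (\<chi> A. \<Phi> z $ A) $ c) z"
    by (rule pd_cong[OF _ an_nth]) (use z open_W \<Psi>_\<Phi> in \<open>auto simp: eventually_nhds vec_lambda_eta\<close>)
  ultimately show ?thesis by (simp add: pd_nth)
qed

lemma JK: 
  assumes z: "z \<in> W"
  shows "(\<Sum>a\<in>UNIV. J B a z * K a A z) = (if A = B then 1 else 0)"
  using coord_change.KJ[OF dual, of "\<Phi> z" B A] z
  by (simp add: coord_change.K_def[OF dual] coord_change.J_def[OF dual] J_def K_def \<Phi>_W \<Psi>_\<Phi>)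

text \<open>Components of the image of the tangent vector \<open>tv p j\<close> under the derivative
  of \<Phi>.\<close>

definition E :: "'n option \<Rightarrow> 'n \<Rightarrow> 'k ^ 'n option \<Rightarrow> 'k ^ 'n \<Rightarrow> 'k" where
  "E A j z p = (\<Sum>a\<in>UNIV. J A a z * tv p j a)"

text \<open>The covector \<open>xi p\<close> at \<open>z\<close>, transported to \<open>\<Phi> z\<close>.\<close>

definition eta :: "'n option \<Rightarrow> 'k ^ 'n option \<Rightarrow> 'k ^ 'n \<Rightarrow> 'k" where
  "eta A z p = (\<Sum>c\<in>UNIV. xi p c * K c A z)"

lemma eta_J: 
  assumes "z \<in> W"
  shows "(\<Sum>A\<in>UNIV. eta A z p * J A a z) = xi p a"
proof -
  have "(\<Sum>A\<in>UNIV. eta A z p * J A a z) = (\<Sum>c\<in>UNIV. xi p c * (\<Sum>A\<in>UNIV. K c A z * J A a z))"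
    unfolding eta_def by (rule sum_mult_lin)
  then show ?thesis by (simp add: KJ[OF assms] sum_if_mult)
qed

lemma J_E: "(\<Sum>A\<in>UNIV. \<beta> A * E A j z p) = (\<Sum>a\<in>UNIV. (\<Sum>A\<in>UNIV. \<beta> A * J A a z) * tv p j a)"
  unfolding E_def by (rule sum_mult_lin[symmetric])

lemma eta_E: "z \<in> W \<Longrightarrow> (\<Sum>A\<in>UNIV. eta A z p * E A j z p) = 0"
  by (simp add: J_E eta_J xi_tv)

text \<open>\<open>eta\<close> annihilates the images of the tangent vectors. If its
  \<open>y\<close> component is nonzero, the image hyperplane is not vertical, and there the
  \<open>y\<close> component of a vector is determined by the others.\<close>

lemma E_None:
  assumes "z \<in> W" "eta None z p \<noteq> 0"
  shows "E None j z p = (\<Sum>k\<in>UNIV. - (eta (Some k) z p / eta None z p) * E (Some k) j z p)"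
proof -
  have "eta None z p * E None j z p = - (\<Sum>k\<in>UNIV. eta (Some k) z p * E (Some k) j z p)"
    using eta_E[OF assms(1), of p j] by (simp add: sum_UNIV_option eq_neg_iff_add_eq_0)
  then show ?thesis using assms(2) by (simp add: sum_negf sum_divide_distrib[symmetric] field_simps)
qed

text \<open>The derivative of \<Phi> is injective, and by \<open>E_None\<close> an image vector is
  determined by its \<open>x\<close> components. This transversality is what makes the image of a
  graph a graph.\<close>

lemma E_inj:
  assumes z: "z \<in> W" and e: "eta None z p \<noteq> 0" and h: "\<And>k. (\<Sum>j\<in>UNIV. E (Some k) j z p * h $ j) = 0"
  shows "h = 0"
proof -
  have "(\<Sum>j\<in>UNIV. E None j z p * h $ j) = (\<Sum>k\<in>UNIV. - (eta (Some k) z p / eta None z p) * (\<Sum>j\<in>UNIV. E (Some k) j z p * h $ j))"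
    unfolding E_None[OF z e] by (rule sum_mult_lin)
  then have "(\<Sum>j\<in>UNIV. E A j z p * h $ j) = 0" for A using h by (cases A) simp_all
  moreover have "(\<Sum>j\<in>UNIV. E A j z p * h $ j) = (\<Sum>a\<in>UNIV. J A a z * (\<Sum>j\<in>UNIV. tv p j a * h $ j))" for A
    unfolding E_def by (rule sum_mult_lin)
  ultimately have 0: "(\<Sum>a\<in>UNIV. J A a z * (\<Sum>j\<in>UNIV. tv p j a * h $ j)) = 0" for A by simp
  have "(\<Sum>j\<in>UNIV. tv p j c * h $ j) = 0" for c
  proof -
    have "(\<Sum>a\<in>UNIV. (\<Sum>A\<in>UNIV. K c A z * J A a z) * (\<Sum>j\<in>UNIV. tv p j a * h $ j))
       = (\<Sum>A\<in>UNIV. K c A z * (\<Sum>a\<in>UNIV. J A a z * (\<Sum>j\<in>UNIV. tv p j a * h $ j)))"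
      by (rule sum_mult_lin)
    then show ?thesis by (simp add: 0 KJ[OF z] sum_if_mult)
  qed
  from this[of "Some _"] show ?thesis by (simp add: tv_def vec_eq_iff sum_if_mult)
qed

lemma has_partials_graph:
  assumes "has_partials y (\<lambda>j. p $ j) x"
  shows "has_partials (\<lambda>x. vc (x, y x) $ a) (\<lambda>i. tv p i a) x"
  using assms has_partials_nth by (cases a) (simp_all add: tv_def eq_commute)

text \<open>Differentiate \<open>\<beta> \<cdot> D\<Phi> \<cdot> e\<^sub>j = 0\<close>, where \<open>e\<^sub>j\<close> are the tangent vectors of the graph.\<close>

lemma second_order:
  assumes U: "open U" "x \<in> U" and zW: "\<And>x. x \<in> U \<Longrightarrow> vc (x, y x) \<in> W"
    and y: "\<And>x. x \<in> U \<Longrightarrow> has_partials y (\<lambda>j. p x $ j) x"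
    and q: "\<And>j. has_partials (\<lambda>x. p x $ j) (q j) x" and \<beta>: "\<And>A. has_partials (\<beta> A) (\<beta>' A) x"
    and van: "\<And>x j. x \<in> U \<Longrightarrow> (\<Sum>A\<in>UNIV. \<beta> A x * E A j (vc (x, y x)) (p x)) = 0"
  shows "(\<Sum>A\<in>UNIV. \<beta>' A i * E A j (vc (x, y x)) (p x))
    + (\<Sum>A\<in>UNIV. \<beta> A x * (\<Sum>a\<in>UNIV. (\<Sum>b\<in>UNIV. pd b (J A a) (vc (x, y x)) * tv (p x) i b) * tv (p x) j a))
    + (\<Sum>A\<in>UNIV. \<beta> A x * J A None (vc (x, y x))) * q j i = 0"
proof -
  let ?z = "\<lambda>x. vc (x, y x)"
  have kJ: "has_partials (\<lambda>x. J A a (?z x)) (\<lambda>i. \<Sum>b\<in>UNIV. pd b (J A a) (?z x) * tv (p x) i b) x" for A a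
    using has_partials_compose[of "J A a" "\<lambda>m x. ?z x $ m" x "\<lambda>m i. tv (p x) i m"] an_J[OF zW[OF U(2)]] has_partials_graph[OF y[OF U(2)]]
    by (simp only: vec_lambda_eta)
  have ktv: "has_partials (\<lambda>x. tv (p x) j a) (\<lambda>i. if a = None then q j i else 0) x" for a
    using q[of j] by (cases a) (auto simp: tv_def intro: has_partials_const)
  have kE: "has_partials (\<lambda>x. E A j (?z x) (p x)) (\<lambda>i. \<Sum>a\<in>UNIV. (\<Sum>b\<in>UNIV. pd b (J A a) (?z x) * tv (p x) i b) * tv (p x) j a
      + J A a (?z x) * (if a = None then q j i else 0)) x" for A
    unfolding E_def by (intro has_partials_sum has_partials_mult kJ ktv)
  have "has_partials (\<lambda>x. \<Sum>A\<in>UNIV. \<beta> A x * E A j (?z x) (p x)) (\<lambda>i. \<Sum>A\<in>UNIV. \<beta>' A i * E A j (?z x) (p x) + \<beta> A x *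
     (\<Sum>a\<in>UNIV. (\<Sum>b\<in>UNIV. pd b (J A a) (?z x) * tv (p x) i b) * tv (p x) j a + J A a (?z x) * (if a = None then q j i else 0))) x"
    by (intro has_partials_sum has_partials_mult \<beta> kE)
  moreover have "has_partials (\<lambda>x. \<Sum>A\<in>UNIV. \<beta> A x * E A j (?z x) (p x)) (\<lambda>_. 0) x"
    by (rule has_partials_transform[OF has_partials_const U]) (simp add: van)
  ultimately have "(\<Sum>A\<in>UNIV. \<beta>' A i * E A j (?z x) (p x) + \<beta> A x *
     (\<Sum>a\<in>UNIV. (\<Sum>b\<in>UNIV. pd b (J A a) (?z x) * tv (p x) i b) * tv (p x) j a + J A a (?z x) * (if a = None then q j i else 0))) = 0"
    by (rule has_partials_unique)
  moreover have "(\<Sum>a\<in>UNIV. J A a (?z x) * (if a = None then q j i else 0)) = J A None (?z x) * q j i" for A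
    by (simp add: sum_UNIV_option)
  ultimately show ?thesis
    by (simp add: sum.distrib distrib_left sum_distrib_right mult.assoc add.assoc)
qed

text \<open>By \<open>star\<close> the second derivatives of \<Phi> are \<Gamma> followed by the
  Jacobian. Moving the Jacobian onto \<beta> leaves \<open>xi p\<close> contracted with \<Gamma>, up
  to the factor \<open>l\<close>.\<close>

lemma second_order_quad:
  assumes z: "z \<in> W" and star: "\<And>A a b. pd b (J A a) z = (\<Sum>c\<in>UNIV. \<Gamma> c a b * J A c z)"
    and \<beta>: "\<And>c. (\<Sum>A\<in>UNIV. \<beta> A * J A c z) = l * xi p c"
  shows "(\<Sum>A\<in>UNIV. \<beta> A * (\<Sum>a\<in>UNIV. (\<Sum>b\<in>UNIV. pd b (J A a) z * tv p i b) * tv p j a)) = - l * quad \<Gamma> p j i"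
proof -
  have 1: "(\<Sum>a\<in>UNIV. (\<Sum>b\<in>UNIV. pd b (J A a) z * tv p i b) * tv p j a) = (\<Sum>c\<in>UNIV. con2 \<Gamma> (tv p j) (tv p i) c * J A c z)" for A
  proof -
    have "(\<Sum>a\<in>UNIV. (\<Sum>b\<in>UNIV. pd b (J A a) z * tv p i b) * tv p j a)
       = (\<Sum>a\<in>UNIV. tv p j a * (\<Sum>b\<in>UNIV. tv p i b * (\<Sum>c\<in>UNIV. J A c z * \<Gamma> c a b)))"
      by (simp add: star mult.commute)
    also have "\<dots> = (\<Sum>c\<in>UNIV. J A c z * con2 \<Gamma> (tv p j) (tv p i) c)"
      unfolding con2_def by (rule sum_mult_swap3)
    finally show ?thesis by (simp add: mult.commute)
  qed
  have "(\<Sum>A\<in>UNIV. \<beta> A * (\<Sum>c\<in>UNIV. con2 \<Gamma> (tv p j) (tv p i) c * J A c z))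
     = (\<Sum>c\<in>UNIV. con2 \<Gamma> (tv p j) (tv p i) c * (\<Sum>A\<in>UNIV. \<beta> A * J A c z))"
    by (rule sum_mult_swap)
  also have "\<dots> = l * con3 \<Gamma> (xi p) (tv p j) (tv p i)"
    unfolding \<beta> con3_con2 sum_distrib_left by (simp add: mult_ac)
  finally show ?thesis unfolding 1 by (simp add: quad_def)
qed

text \<open>The \<open>x\<close> part \<open>f\<close> of the image has injective derivative by
  \<open>E_inj\<close>. Here \<open>y\<close> is known only to be continuously differentiable, so
  the inverse function theorem for such maps is used instead of \<open>analytic_inverse\<close>. The
  derivative of the inverse is passed on through the linear equation that it satisfies.\<close>

lemma graph_transform:
  assumes U: "open U" "x0 \<in> U" and zW: "\<And>x. x \<in> U \<Longrightarrow> vc (x, y x) \<in> W"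
    and y: "\<And>x. x \<in> U \<Longrightarrow> has_partials y (\<lambda>j. p x $ j) x" and p: "\<And>x j. x \<in> U \<Longrightarrow> isCont (\<lambda>x. p x $ j) x"
    and e: "\<And>x. x \<in> U \<Longrightarrow> eta None (vc (x, y x)) (p x) \<noteq> 0"
  obtains U1 V Y g where "open U1" "x0 \<in> U1" "U1 \<subseteq> U" "open V"
    "(\<lambda>v. pt (\<Phi> (vc v))) ` graph_on U1 y = graph_on V Y"
    "\<And>X. X \<in> V \<Longrightarrow> g X \<in> U1" "\<And>X. X \<in> V \<Longrightarrow> vc (X, Y X) = \<Phi> (vc (g X, y (g X)))"
    "\<And>X. X \<in> V \<Longrightarrow> has_partials Y (\<lambda>k. - (eta (Some k) (vc (g X, y (g X))) (p (g X)) / eta None (vc (g X, y (g X))) (p (g X)))) X"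
    "\<And>X. X \<in> V \<Longrightarrow> \<exists>D. (g has_derivative D) (at X) \<and> (\<forall>H k. (\<Sum>j\<in>UNIV. E (Some k) j (vc (g X, y (g X))) (p (g X)) * D H $ j) = H $ k)"
proof -
  let ?z = "\<lambda>x. vc (x, y x)"
  define f where "f = (\<lambda>x. \<chi> k. \<Phi> (?z x) $ Some k)"
  have k\<Phi>: "has_partials (\<lambda>x. \<Phi> (?z x) $ A) (\<lambda>i. E A i (?z x) (p x)) x" if "x \<in> U" for A x
    using has_partials_compose[of "\<lambda>z. \<Phi> z $ A" "\<lambda>m x. ?z x $ m" x "\<lambda>m i. tv (p x) i m"] an_\<Phi>[OF zW[OF that]] has_partials_graph[OF y[OF that]]
    by (simp only: vec_lambda_eta E_def J_def)
  define L where "L = (\<lambda>x h. \<chi> k. \<Sum>j\<in>UNIV. E (Some k) j (?z x) (p x) * h $ j)"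
  have fL: "(f has_derivative L x) (at x)" if "x \<in> U" for x
    unfolding f_def L_def by (rule has_derivative_vec_lambda) (use k\<Phi>[OF that] in \<open>simp add: has_partials_def\<close>)
  define f' where "f' = (\<lambda>x. Blinfun (L x))"
  have bl: "bounded_linear (L x)" for x
    unfolding L_def linear_conv_bounded_linear[symmetric]
    by (rule linearI) (simp_all add: vec_eq_iff distrib_left sum.distrib scaleR_sum_right)
  have f': "blinfun_apply (f' x) = L x" for x unfolding f'_def by (rule bounded_linear_Blinfun_apply[OF bl])
  have "isCont (\<lambda>x. E A j (?z x) (p x)) x" if x: "x \<in> U" for A j x
  proof -
    have "isCont ?z x"
    proof -
      have "isCont (\<lambda>x. ?z x $ a) x" for a by (rule has_partials_isCont[OF has_partials_graph[OF y[OF x]]])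
      then have "isCont (\<lambda>x. \<chi> a. ?z x $ a) x" unfolding continuous_at by (intro tendsto_vec_lambda)
      then show ?thesis by (simp only: vec_lambda_eta)
    qed
    then have "isCont (\<lambda>x. J A a (?z x)) x" for a
      using isCont_o2[where f = ?z and g = "J A a" and a = x] an_isCont[OF an_J[OF zW[OF x]]] by blast
    moreover have "isCont (\<lambda>x. tv (p x) j a) x" for a using p[OF x] by (cases a) (simp_all add: tv_def)
    ultimately show ?thesis unfolding E_def by (intro continuous_intros)
  qed
  then have "continuous_on U (\<lambda>x. E A j (?z x) (p x))" for A j
    by (intro continuous_at_imp_continuous_on ballI)
  then have "continuous_on U (\<lambda>x. L x h)" for h
    unfolding L_def by (intro continuous_on_vec_lambda continuous_intros)
  then have cf': "continuous_on U f'" by (intro continuous_on_blinfun_componentwise) (simp add: f')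
  have "inj (L x0)"
  proof (subst linear_injective_0)
    show "linear (L x0)" using bl linear_conv_bounded_linear by blast
    show "\<forall>h. L x0 h = 0 \<longrightarrow> h = 0"
      using E_inj[OF zW[OF U(2)] e[OF U(2)]] by (auto simp: L_def vec_eq_iff)
  qed
  with bl[of x0] obtain L' where L': "linear L'" "\<And>h. L' (L x0 h) = h"
    using linear_injective_isomorphism[of "L x0"] linear_conv_bounded_linear by blast
  have "bounded_linear L'" using L'(1) linear_conv_bounded_linear by blast
  then have "Blinfun L' o\<^sub>L f' x0 = id_blinfun"
    by (intro blinfun_eqI) (simp add: f' bounded_linear_Blinfun_apply L'(2))
  from inverse_function_theorem[OF U(1) _ cf' U(2) this, of f]
  obtain U1 V g g' where ift: "open U1" "U1 \<subseteq> U" "x0 \<in> U1" "open V" "homeomorphism U1 V f g"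
    "\<And>X. X \<in> V \<Longrightarrow> (g has_derivative (g' X)) (at X)"
    "\<And>X. X \<in> V \<Longrightarrow> g' X = inv (blinfun_apply (f' (g X)))"
    "\<And>X. X \<in> V \<Longrightarrow> bij (blinfun_apply (f' (g X)))"
    using fL f' by metis
  have g: "g X \<in> U1" "f (g X) = X" if "X \<in> V" for X
    using ift(5) that by (auto simp: homeomorphism_def)
  have f: "f x \<in> V" "g (f x) = x" if "x \<in> U1" for x
    using ift(5) that by (auto simp: homeomorphism_def)
  have gU: "g X \<in> U" if "X \<in> V" for X using g(1)[OF that] ift(2) by blast
  define Y where "Y = (\<lambda>X. \<Phi> (?z (g X)) $ None)"
  have vcY: "vc (X, Y X) = \<Phi> (?z (g X))" if "X \<in> V" for X
  proof -
    have "vc (X, Y X) $ a = \<Phi> (?z (g X)) $ a" for a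
      using g(2)[OF that] by (cases a) (auto simp: Y_def f_def vec_eq_iff)
    then show ?thesis by (simp add: vec_eq_iff)
  qed
  have LD: "L (g X) (g' X H) = H" if "X \<in> V" for X H
    unfolding ift(7)[OF that] f'[symmetric] by (rule surj_f_inv_f) (rule bij_is_surj[OF ift(8)[OF that]])
  show thesis
  proof (rule that[of U1 V Y g])
    show "(\<lambda>v. pt (\<Phi> (vc v))) ` graph_on U1 y = graph_on V Y"
    proof
      show "(\<lambda>v. pt (\<Phi> (vc v))) ` graph_on U1 y \<subseteq> graph_on V Y"
      proof
        fix v assume "v \<in> (\<lambda>v. pt (\<Phi> (vc v))) ` graph_on U1 y"
        then obtain a where a: "a \<in> U1" "v = pt (\<Phi> (vc (a, y a)))" by (auto simp: graph_on_def)
        then have "v = pt (vc (f a, Y (f a)))" using vcY[OF f(1)[of a]] f(2)[of a] by simp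
        then show "v \<in> graph_on V Y" using f(1)[OF a(1)] by (simp add: graph_on_def)
      qed
      show "graph_on V Y \<subseteq> (\<lambda>v. pt (\<Phi> (vc v))) ` graph_on U1 y"
      proof
        fix v assume "v \<in> graph_on V Y"
        then obtain X where X: "X \<in> V" "v = (X, Y X)" by (auto simp: graph_on_def)
        then have "v = pt (\<Phi> (vc (g X, y (g X))))" using arg_cong[OF vcY[OF X(1)], of pt] by simp
        then show "v \<in> (\<lambda>v. pt (\<Phi> (vc v))) ` graph_on U1 y" using g(1)[OF X(1)] by (auto simp: graph_on_def)
      qed
    qed
    fix X assume X: "X \<in> V"
    show "\<exists>D. (g has_derivative D) (at X) \<and> (\<forall>H k. (\<Sum>j\<in>UNIV. E (Some k) j (?z (g X)) (p (g X)) * D H $ j) = H $ k)"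
      using ift(6)[OF X] LD[OF X] by (intro exI[of _ "g' X"]) (auto simp: L_def vec_eq_iff)
    have "(Y has_derivative (\<lambda>H. \<Sum>i\<in>UNIV. E None i (?z (g X)) (p (g X)) * g' X H $ i)) (at X)"
      unfolding Y_def by (rule has_partials_compose_map[OF k\<Phi>[OF gU[OF X]] ift(6)[OF X]])
    moreover have "(\<Sum>i\<in>UNIV. E None i (?z (g X)) (p (g X)) * g' X H $ i) =
        (\<Sum>k\<in>UNIV. - (eta (Some k) (?z (g X)) (p (g X)) / eta None (?z (g X)) (p (g X))) * H $ k)" for H
    proof -
      have "(\<Sum>i\<in>UNIV. E None i (?z (g X)) (p (g X)) * g' X H $ i) =
        (\<Sum>k\<in>UNIV. - (eta (Some k) (?z (g X)) (p (g X)) / eta None (?z (g X)) (p (g X))) * (\<Sum>i\<in>UNIV. E (Some k) i (?z (g X)) (p (g X)) * g' X H $ i))"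
        unfolding E_None[OF zW[OF gU[OF X]] e[OF gU[OF X]]] by (rule sum_mult_lin)
      moreover have "(\<Sum>i\<in>UNIV. E (Some k) i (?z (g X)) (p (g X)) * g' X H $ i) = H $ k" for k
        using LD[OF X, of H] by (auto simp: L_def vec_eq_iff)
      ultimately show ?thesis by simp
    qed
    ultimately show "has_partials Y (\<lambda>k. - (eta (Some k) (?z (g X)) (p (g X)) / eta None (?z (g X)) (p (g X)))) X"
      by (simp add: has_partials_def)
  qed (use ift g vcY in auto)
qed

end

section \<open>Diffeomorphisms and the pullback of the flat connection\<close>

lemma coord_change_of_diffeo:
  fixes \<phi> :: "('k::scalar_field, 'n::finite) point \<Rightarrow> ('k, 'n) point"
  assumes "analytic_diffeo W W' \<phi> \<psi>"
  shows "coord_change (\<lambda>z. vc (\<phi> (pt z))) (\<lambda>w. vc (\<psi> (pt w))) (pt -` W) (pt -` W')"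
proof
  have "open W" "open W'" using assms by (auto simp: analytic_diffeo_def)
  then show "open (pt -` W :: ('k ^ 'n option) set)" "open (pt -` W' :: ('k ^ 'n option) set)"
    by (simp_all add: open_vimage continuous_pt)
qed (use assms in \<open>auto simp: analytic_diffeo_def analytic_on_points_iff\<close>)

lemma diffeo_of_coord_change:
  fixes \<Phi> :: "'k::scalar_field ^ 'n::finite option \<Rightarrow> 'k ^ 'n option"
  assumes "coord_change \<Phi> \<Psi> W W'"
  shows "analytic_diffeo (vc -` W) (vc -` W') (\<lambda>v. pt (\<Phi> (vc v))) (\<lambda>w. pt (\<Psi> (vc w)))"
proof -
  interpret coord_change \<Phi> \<Psi> W W' by fact
  show ?thesis
    using open_vimage[OF open_W continuous_vc] open_vimage[OF open_W' continuous_vc] \<Phi>_W \<Psi>_W' \<Psi>_\<Phi> \<Phi>_\<Psi> an_\<Phi> an_\<Psi>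
    by (auto simp: analytic_diffeo_def analytic_on_points_iff)
qed

lemma solution_has_partials:
  fixes F :: "('k::scalar_field, 'n::finite) system"
  shows "solution F N U y \<longleftrightarrow> open U \<and> (\<exists>p. \<forall>x\<in>U. (x, y x, p x) \<in> N \<and> has_partials y (\<lambda>j. p x $ j) x \<and>
    (\<forall>j. has_partials (\<lambda>x. p x $ j) (\<lambda>i. F j i (x, y x, p x)) x))"
  by (simp add: solution_def has_partials_def)

text \<open>The vectors \<open>tv p j\<close> span a hyperplane, so the covectors that annihilate
  them form a line; the factor is read at \<open>None\<close>, where \<open>xi p\<close> is
  1.\<close>

lemma multiple_of_xi:
  assumes "\<And>j. (\<Sum>a\<in>UNIV. \<nu> a * tv p j a) = 0"
  shows "\<nu> a = \<nu> None * xi p a"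
proof (cases a)
  case (Some j)
  have "p $ j * \<nu> None + \<nu> (Some j) = 0"
    using assms[of j] sum_tv[of p j \<nu>] by (simp add: mult.commute)
  then show ?thesis using Some by (simp add: xi_def eq_neg_iff_add_eq_0 mult.commute add.commute)
qed (simp add: xi_def)

context coord_change
begin

text \<open>Christoffel symbols of the pullback of the flat connection by \<Phi>.\<close>

definition christoffel :: "'n option \<Rightarrow> 'n option \<Rightarrow> 'n option \<Rightarrow> 'k ^ 'n option \<Rightarrow> 'k" where
  "christoffel c a b z = (\<Sum>A\<in>UNIV. pd b (J A a) z * K c A z)"

lemma an_christoffel:
  assumes "z \<in> W"
  shows "an (christoffel c a b) z"
  unfolding christoffel_def[abs_def] by (intro an_sum an_mult an_pd an_J an_K assms)

lemma pd_J:
  assumes "z \<in> W"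
  shows "pd b (J A a) z = (\<Sum>c\<in>UNIV. christoffel c a b z * J A c z)"
proof -
  have "(\<Sum>c\<in>UNIV. christoffel c a b z * J A c z) = (\<Sum>B\<in>UNIV. pd b (J B a) z * (\<Sum>c\<in>UNIV. K c B z * J A c z))"
    unfolding christoffel_def by (rule sum_mult_lin)
  moreover have "(\<Sum>c\<in>UNIV. K c B z * J A c z) = (if B = A then 1 else 0)" for B
    using JK[OF assms, of A B] by (simp add: mult.commute)
  ultimately show ?thesis by (simp add: sum_if_mult)
qed

lemma christoffel_sym: "z \<in> W \<Longrightarrow> christoffel c a b z = christoffel c b a z"
  using pd_commute[OF an_\<Phi>[of z]] by (simp add: christoffel_def J_def[abs_def])

lemma J_covector_inj:
  assumes z: "z \<in> W" and 0: "\<And>a. (\<Sum>A\<in>UNIV. \<beta> A * J A a z) = 0"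
  shows "\<beta> B = 0"
proof -
  have "(\<Sum>a\<in>UNIV. (\<Sum>A\<in>UNIV. \<beta> A * J A a z) * K a B z) = (\<Sum>A\<in>UNIV. \<beta> A * (\<Sum>a\<in>UNIV. J A a z * K a B z))"
    by (rule sum_mult_lin)
  then show ?thesis by (simp add: 0 JK[OF z] sum_if_mult)
qed

text \<open>The conormal \<beta> of the image is constant to first order, since the slope
  \<open>P\<close> has vanishing derivative. \<open>second_order\<close> then relates only the
  second derivatives of \<Phi> and \<open>q\<close>, both with the factor \<open>l\<close>; this is
  nonzero because the Jacobian is invertible and \<beta> has \<open>y\<close> component 1. Both
  directions of the equivalence rely on this computation.\<close>

lemma image_of_solution:
  assumes U: "open U" "x0 \<in> U" and zW: "\<And>x. x \<in> U \<Longrightarrow> vc (x, y x) \<in> W"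
    and y: "\<And>x. x \<in> U \<Longrightarrow> has_partials y (\<lambda>j. p x $ j) x" and q: "\<And>j. has_partials (\<lambda>x. p x $ j) (q j) x0"
    and img: "(\<lambda>v. pt (\<Phi> (vc v))) ` graph_on U y \<subseteq> graph_on V Y"
    and Y: "\<And>X. X \<in> V \<Longrightarrow> has_partials Y (\<lambda>k. P X $ k) X" "\<And>X k. X \<in> V \<Longrightarrow> has_partials (\<lambda>X. P X $ k) (\<lambda>_. 0) X"
    and star: "\<And>A a b. pd b (J A a) (vc (x0, y x0)) = (\<Sum>c\<in>UNIV. \<Gamma> c a b * J A c (vc (x0, y x0)))"
  shows "q j i = quad \<Gamma> (p x0) j i"
proof -
  let ?z = "\<lambda>x. vc (x, y x)"
  define X where "X = (\<lambda>x. \<chi> k. \<Phi> (?z x) $ Some k)"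
  have XV: "X x \<in> V" "\<Phi> (?z x) $ None = Y (X x)" if "x \<in> U" for x
  proof -
    have "pt (\<Phi> (?z x)) \<in> graph_on V Y" using img that by (auto simp: graph_on_def)
    moreover have "pt (\<Phi> (?z x)) = (X x, \<Phi> (?z x) $ None)" by (simp add: pt_def X_def)
    ultimately show "X x \<in> V" "\<Phi> (?z x) $ None = Y (X x)" by (auto simp: graph_on_def)
  qed
  have k\<Phi>: "has_partials (\<lambda>x. \<Phi> (?z x) $ A) (\<lambda>i. E A i (?z x) (p x)) x" if "x \<in> U" for A x
    using has_partials_compose[of "\<lambda>z. \<Phi> z $ A" "\<lambda>m x. ?z x $ m" x "\<lambda>m i. tv (p x) i m"] an_\<Phi>[OF zW[OF that]] has_partials_graph[OF y[OF that]]
    by (simp only: vec_lambda_eta E_def J_def)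
  have DX: "(X has_derivative (\<lambda>h. \<chi> k. \<Sum>j\<in>UNIV. E (Some k) j (?z x) (p x) * h $ j)) (at x)" if "x \<in> U" for x
    unfolding X_def by (rule has_derivative_vec_lambda) (use k\<Phi>[OF that] in \<open>simp add: has_partials_def\<close>)
  have ENone: "E None j (?z x) (p x) = (\<Sum>k\<in>UNIV. P (X x) $ k * E (Some k) j (?z x) (p x))" if x: "x \<in> U" for j x
  proof (rule has_partials_unique[where i = j and D = "\<lambda>j. E None j (?z x) (p x)"
      and D' = "\<lambda>j. \<Sum>k\<in>UNIV. P (X x) $ k * E (Some k) j (?z x) (p x)"])
    show "has_partials (\<lambda>x. \<Phi> (?z x) $ None) (\<lambda>j. E None j (?z x) (p x)) x" by (rule k\<Phi>[OF x])
    have "((\<lambda>x. Y (X x)) has_derivative (\<lambda>h. \<Sum>k\<in>UNIV. P (X x) $ k * (\<chi> k. \<Sum>j\<in>UNIV. E (Some k) j (?z x) (p x) * h $ j) $ k)) (at x)"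
      by (rule has_partials_compose_map[OF Y(1)[OF XV(1)[OF x]] DX[OF x]])
    then have "has_partials (\<lambda>x. Y (X x)) (\<lambda>j. \<Sum>k\<in>UNIV. P (X x) $ k * E (Some k) j (?z x) (p x)) x"
      unfolding has_partials_def by (simp add: sum_mult_lin[symmetric])
    then show "has_partials (\<lambda>x. \<Phi> (?z x) $ None) (\<lambda>j. \<Sum>k\<in>UNIV. P (X x) $ k * E (Some k) j (?z x) (p x)) x"
      by (rule has_partials_transform[OF _ U(1) x]) (simp add: XV)
  qed
  define \<beta> where "\<beta> = (\<lambda>A x. xi (P (X x)) A)"
  have van: "(\<Sum>A\<in>UNIV. \<beta> A x * E A j (?z x) (p x)) = 0" if "x \<in> U" for x j
    using ENone[OF that, of j] by (simp add: \<beta>_def sum_UNIV_option xi_def sum_negf)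
  have k\<beta>: "has_partials (\<beta> A) (\<lambda>_. 0) x0" for A
  proof (cases A)
    case (Some k)
    have "has_partials (\<lambda>x. P (X x) $ k) (\<lambda>_. 0) x0"
      using has_partials_compose_map[OF Y(2)[OF XV(1)[OF U(2)]] DX[OF U(2)], of k] by (simp add: has_partials_def)
    from has_partials_uminus[OF this] show ?thesis by (simp add: Some \<beta>_def xi_def)
  qed (simp add: \<beta>_def xi_def has_partials_const)
  note z0 = zW[OF U(2)]
  define l where "l = (\<Sum>A\<in>UNIV. \<beta> A x0 * J A None (?z x0))"
  have \<beta>J: "(\<Sum>A\<in>UNIV. \<beta> A x0 * J A c (?z x0)) = l * xi (p x0) c" for c
    unfolding l_def by (rule multiple_of_xi) (simp add: J_E[symmetric] van[OF U(2)])
  have "l \<noteq> 0"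
  proof
    assume "l = 0"
    then have "\<beta> None x0 = 0" by (intro J_covector_inj[OF z0, of "\<lambda>A. \<beta> A x0"]) (simp add: \<beta>J)
    then show False by (simp add: \<beta>_def xi_def)
  qed
  moreover have "- l * quad \<Gamma> (p x0) j i + l * q j i = 0"
    using second_order[OF U zW y q k\<beta> van, of j i] second_order_quad[OF z0 star \<beta>J, of i j] \<beta>J[of None]
    by (simp add: xi_def)
  ultimately show ?thesis by simp
qed

end

text \<open>Through every jet in \<open>N\<close> runs a solution whose image solves the flat
  system. Hence \<open>image_of_solution\<close>, with the pulled back connection, gives the value
  of \<open>F\<close> at that jet.\<close>

lemma flat_imp_cubic:
  fixes F :: "('k::scalar_field, 'n::finite) system"
  assumes sys: "analytic_system F \<Omega>" and ci: "completely_integrable F \<Omega>"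
    and eq: "locally_equivalent F \<Omega> flat_system UNIV s"
  shows "has_cubic_form F \<Omega> s"
proof -
  obtain W W' \<phi> \<psi> N N' where diffeo: "analytic_diffeo W W' \<phi> \<psi>" and N: "open N" "s \<in> N" "N \<subseteq> \<Omega>"
    and NW': "\<forall>(x, y, p)\<in>N. (x, y) \<in> W" and maps: "maps_solutions \<phi> F N flat_system N'"
    using eq unfolding locally_equivalent_def by (elim exE conjE) (rule that)
  have NW: "(x, y) \<in> W" if "(x, y, p) \<in> N" for x y p using NW' that by auto
  interpret coord_change "\<lambda>z. vc (\<phi> (pt z))" "\<lambda>w. vc (\<psi> (pt w))" "pt -` W" "pt -` W'"
    by (rule coord_change_of_diffeo[OF diffeo])
  have an\<Gamma>: "an (christoffel c a b) z" if "pt z \<in> W" for c a b z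
    by (rule an_christoffel) (simp add: that)
  have F_quad: "F i j (x0, y0, p0) = quad (\<lambda>c a b. christoffel c a b (vc (x0, y0))) p0 i j" if jet: "(x0, y0, p0) \<in> N" for x0 y0 p0 i j
  proof -
    obtain U y p where U: "open U" "x0 \<in> U" "y x0 = y0" "p x0 = p0" and sN: "\<And>x. x \<in> U \<Longrightarrow> (x, y x, p x) \<in> N"
      and dy: "\<And>x. x \<in> U \<Longrightarrow> (y has_derivative (\<lambda>h. \<Sum>j\<in>UNIV. p x $ j * h $ j)) (at x)"
      and dp: "\<And>x j1. x \<in> U \<Longrightarrow> ((\<lambda>z. p z $ j1) has_derivative (\<lambda>h. \<Sum>j2\<in>UNIV. F j1 j2 (x, y x, p x) * h $ j2)) (at x)"
      by (rule solution_exists[OF sys ci N(1) N(3) jet]) (rule that)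
    have "solution F N U y"
      unfolding solution_def by (intro conjI exI[of _ p] ballI allI U(1) sN dy dp)
    with maps have "\<forall>x\<in>U. \<exists>U1 V Y. open U1 \<and> x \<in> U1 \<and> U1 \<subseteq> U \<and> solution flat_system N' V Y \<and> \<phi> ` graph_on U1 y = graph_on V Y"
      by (simp add: maps_solutions_def)
    from bspec[OF this U(2)] obtain U1 V Y where V: "open U1" "x0 \<in> U1" "U1 \<subseteq> U" "solution flat_system N' V Y"
      "\<phi> ` graph_on U1 y = graph_on V Y" by (elim exE conjE) (rule that)
    obtain P where P: "\<forall>X\<in>V. (X, Y X, P X) \<in> N' \<and> has_partials Y (\<lambda>k. P X $ k) X \<and>
        (\<forall>j. has_partials (\<lambda>X. P X $ j) (\<lambda>i. flat_system j i (X, Y X, P X)) X)"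
      using V(4) unfolding solution_has_partials by (elim exE conjE) (rule that)
    have "F i j (x0, y x0, p x0) = quad (\<lambda>c a b. christoffel c a b (vc (x0, y x0))) (p x0) i j"
    proof (rule image_of_solution[OF V(1,2), where y = y and p = p and V = V and Y = Y and P = P])
      fix x assume "x \<in> U1"
      then have x: "x \<in> U" using V(3) by blast
      show "vc (x, y x) \<in> pt -` W" using NW[OF sN[OF x]] by simp
      show "has_partials y (\<lambda>j. p x $ j) x" using dy[OF x] by (simp add: has_partials_def)
    next
      show "has_partials (\<lambda>x. p x $ j) (\<lambda>i. F j i (x0, y x0, p x0)) x0" for j using dp[OF U(2)] by (simp add: has_partials_def)
      show "(\<lambda>v. pt (vc (\<phi> (pt (vc v))))) ` graph_on U1 y \<subseteq> graph_on V Y" using V(5) by simp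
      show "has_partials Y (\<lambda>k. P X $ k) X" if "X \<in> V" for X using P that by blast
      show "has_partials (\<lambda>X. P X $ k) (\<lambda>_. 0) X" if "X \<in> V" for X k using bspec[OF P that] by (simp add: flat_system_def)
      show "pd b (J A a) (vc (x0, y x0)) = (\<Sum>c\<in>UNIV. christoffel c a b (vc (x0, y x0)) * J A c (vc (x0, y x0)))" for A a b
        by (rule pd_J) (use NW[OF sN[OF U(2)]] in simp)
    qed
    then show ?thesis by (simp add: U)
  qed
  \<comment> \<open>These are the coefficients that \<open>quad_cubic\<close> exhibits, now as
    functions of the point.\<close>
  define G where "G = (\<lambda>i j v. - christoffel None (Some i) (Some j) (vc v))"
  define H where "H = (\<lambda>i j k v. christoffel (Some k) (Some i) (Some j) (vc v) - (if k = i then christoffel None (Some j) None (vc v) else 0) - (if k = j then christoffel None (Some i) None (vc v) else 0))"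
  define L where "L = (\<lambda>j k v. 2 * christoffel (Some k) (Some j) None (vc v) - (if k = j then christoffel None None None (vc v) else 0))"
  define M where "M = (\<lambda>k v. christoffel (Some k) None None (vc v))"
  have an_if: "an (\<lambda>w. if P then f w else 0) z" if "an f z" for P f z
    using that by (cases P) (simp_all add: an_const)
  have an: "analytic_on_points (G i j) W" "analytic_on_points (H i j k) W" "analytic_on_points (L j k) W" "analytic_on_points (M k) W" for i j k
    unfolding analytic_on_points_iff G_def H_def L_def M_def vc_pt
    by (auto intro!: an_minus an_diff an_mult an_const an_if an\<Gamma>)
  have sym: "G i j v = G j i v" "H i j k v = H j i k v" if "v \<in> W" for i j k v
    using that christoffel_sym[of "vc v"] by (auto simp: G_def H_def)
  have form: "F i j (x, y, p) = G i j (x, y) + (\<Sum>k\<in>UNIV. p $ k * (H i j k (x, y) + 1/2 * p $ i * L j k (x, y)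
      + 1/2 * p $ j * L i k (x, y) + p $ i * p $ j * M k (x, y)))" if "(x, y, p) \<in> N" for i j x y p
    unfolding F_quad[OF that] G_def H_def L_def M_def
    by (rule quad_cubic) (rule christoffel_sym, use NW[OF that] in simp)
  have "open W" using diffeo by (simp add: analytic_diffeo_def)
  show ?thesis
    unfolding has_cubic_form_def
    by (rule exI[of _ N], rule exI[of _ W], intro conjI, fact N(1), fact N(2), fact N(3), fact, use NW in blast,
      rule exI[of _ G], rule exI[of _ H], rule exI[of _ L], rule exI[of _ M], use an sym form in blast)
qed

section \<open>Prolongation to first-order jets\<close>

context coord_change
begin

text \<open>The slope of the image hyperplane, obtained by rescaling \<open>eta\<close> to have
  \<open>y\<close> component 1.\<close>

definition prolong :: "'k ^ 'n option \<Rightarrow> 'k ^ 'n \<Rightarrow> 'k ^ 'n" where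
  "prolong z p = (\<chi> k. - (eta (Some k) z p / eta None z p))"

lemma xi_prolong: "eta None z p \<noteq> 0 \<Longrightarrow> xi (prolong z p) A = eta A z p * inverse (eta None z p)"
  by (cases A) (simp_all add: xi_def prolong_def divide_inverse)

text \<open>Existence of the derivative is enough, since \<open>second_order\<close> determines its
  relevant values in \<open>solution_to_flat\<close>.\<close>

lemma has_partials_eta:
  assumes z: "vc (x, y x) \<in> W" and y: "has_partials y (\<lambda>j. p x $ j) x" and q: "\<And>j. has_partials (\<lambda>x. p x $ j) (q j) x"
  shows "\<exists>D. has_partials (\<lambda>x. eta A (vc (x, y x)) (p x)) D x"
proof -
  let ?z = "\<lambda>x. vc (x, y x)"
  have kK: "has_partials (\<lambda>x. K c A (?z x)) (\<lambda>i. \<Sum>b\<in>UNIV. pd b (K c A) (?z x) * tv (p x) i b) x" for c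
    using has_partials_compose[of "K c A" "\<lambda>m x. ?z x $ m" x "\<lambda>m i. tv (p x) i m"] an_K[OF z] has_partials_graph[OF y]
    by (simp only: vec_lambda_eta)
  have kxi: "has_partials (\<lambda>x. xi (p x) c) (\<lambda>i. case c of None \<Rightarrow> 0 | Some k \<Rightarrow> - q k i) x" for c
    using has_partials_uminus[OF q] by (cases c) (simp_all add: xi_def has_partials_const)
  have "has_partials (\<lambda>x. \<Sum>c\<in>UNIV. xi (p x) c * K c A (?z x)) (\<lambda>i. \<Sum>c\<in>UNIV. (case c of None \<Rightarrow> 0 | Some k \<Rightarrow> - q k i) * K c A (?z x)
      + xi (p x) c * (\<Sum>b\<in>UNIV. pd b (K c A) (?z x) * tv (p x) i b)) x"
    by (intro has_partials_sum has_partials_mult kK kxi)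
  then show ?thesis unfolding eta_def by blast
qed

text \<open>The conormal of the image, normalised to \<beta> with \<open>y\<close> component 1, is
  differentiated along the solution. In \<open>second_order\<close> the equation for
  \<open>p\<close> cancels the second derivatives of \<Phi>, so the derivative of \<beta>
  annihilates all image tangent vectors. Its \<open>y\<close> component is 0 and the
  \<open>x\<close> parts of these vectors form a basis; hence the slope has derivative 0.\<close>

lemma solution_to_flat:
  assumes U: "open U" "x0 \<in> U" and zW: "\<And>x. x \<in> U \<Longrightarrow> vc (x, y x) \<in> W"
    and y: "\<And>x. x \<in> U \<Longrightarrow> has_partials y (\<lambda>j. p x $ j) x"
    and q: "\<And>x j. x \<in> U \<Longrightarrow> has_partials (\<lambda>x. p x $ j) (\<lambda>i. quad (\<lambda>c a b. \<Gamma> c a b (vc (x, y x))) (p x) j i) x"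
    and e: "\<And>x. x \<in> U \<Longrightarrow> eta None (vc (x, y x)) (p x) \<noteq> 0"
    and star: "\<And>z A a b. z \<in> W \<Longrightarrow> pd b (J A a) z = (\<Sum>c\<in>UNIV. \<Gamma> c a b z * J A c z)"
  obtains U1 V Y P g where "open U1" "x0 \<in> U1" "U1 \<subseteq> U" "open V"
    "(\<lambda>v. pt (\<Phi> (vc v))) ` graph_on U1 y = graph_on V Y"
    "\<And>X. X \<in> V \<Longrightarrow> g X \<in> U1" "\<And>X. X \<in> V \<Longrightarrow> vc (X, Y X) = \<Phi> (vc (g X, y (g X)))"
    "\<And>X. X \<in> V \<Longrightarrow> P X = prolong (vc (g X, y (g X))) (p (g X))"
    "\<And>X. X \<in> V \<Longrightarrow> has_partials Y (\<lambda>k. P X $ k) X" "\<And>X k. X \<in> V \<Longrightarrow> has_partials (\<lambda>X. P X $ k) (\<lambda>_. 0) X"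
proof -
  let ?z = "\<lambda>x. vc (x, y x)"
  obtain U1 V Y g where gt: "open U1" "x0 \<in> U1" "U1 \<subseteq> U" "open V"
    "(\<lambda>v. pt (\<Phi> (vc v))) ` graph_on U1 y = graph_on V Y"
    "\<And>X. X \<in> V \<Longrightarrow> g X \<in> U1" "\<And>X. X \<in> V \<Longrightarrow> vc (X, Y X) = \<Phi> (vc (g X, y (g X)))"
    "\<And>X. X \<in> V \<Longrightarrow> has_partials Y (\<lambda>k. - (eta (Some k) (vc (g X, y (g X))) (p (g X)) / eta None (vc (g X, y (g X))) (p (g X)))) X"
    "\<And>X. X \<in> V \<Longrightarrow> \<exists>D. (g has_derivative D) (at X) \<and> (\<forall>H k. (\<Sum>j\<in>UNIV. E (Some k) j (vc (g X, y (g X))) (p (g X)) * D H $ j) = H $ k)"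
    by (rule graph_transform[OF U zW y has_partials_isCont[OF q] e]) (assumption | rule that)+
  define P where "P = (\<lambda>X. prolong (?z (g X)) (p (g X)))"
  define \<beta> where "\<beta> = (\<lambda>A x. eta A (?z x) (p x) * inverse (eta None (?z x) (p x)))"
  have Pk: "P X $ k = - \<beta> (Some k) (g X)" for X k by (simp add: P_def prolong_def \<beta>_def divide_inverse)
  have \<beta>0: "has_partials (\<beta> (Some k)) (\<lambda>_. 0) (g X)" if X: "X \<in> V" for X k
  proof -
    define x where "x = g X"
    have x: "x \<in> U" using gt(3,6) X by (auto simp: x_def)
    note z = zW[OF x]
    have "\<forall>A. \<exists>D. has_partials (\<lambda>x. eta A (?z x) (p x)) D x"
      using has_partials_eta[OF z y[OF x] q[OF x]] by blast
    from choice[OF this] obtain \<eta>' where \<eta>': "\<And>A. has_partials (\<lambda>x. eta A (?z x) (p x)) (\<eta>' A) x" by blast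
    define \<beta>' where "\<beta>' = (\<lambda>A i. \<eta>' A i * inverse (eta None (?z x) (p x)) + eta A (?z x) (p x) *
      - (inverse (eta None (?z x) (p x)) * \<eta>' None i * inverse (eta None (?z x) (p x))))"
    have k\<beta>: "has_partials (\<beta> A) (\<beta>' A) x" for A
      unfolding \<beta>_def \<beta>'_def by (intro has_partials_mult has_partials_inverse \<eta>' e[OF x])
    have "has_partials (\<beta> None) (\<lambda>_. 0) x"
      by (rule has_partials_transform[OF has_partials_const[of 1] U(1) x]) (simp add: \<beta>_def e)
    then have \<beta>'None: "\<beta>' None i = 0" for i by (rule has_partials_unique[OF k\<beta>])
    have van: "(\<Sum>A\<in>UNIV. \<beta> A x * E A j (?z x) (p x)) = 0" if "x \<in> U" for x j
    proof -
      have "(\<Sum>A\<in>UNIV. \<beta> A x * E A j (?z x) (p x)) = inverse (eta None (?z x) (p x)) * (\<Sum>A\<in>UNIV. eta A (?z x) (p x) * E A j (?z x) (p x))"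
        unfolding sum_distrib_left \<beta>_def by (simp add: mult_ac)
      then show ?thesis by (simp add: eta_E[OF zW[OF that]])
    qed
    have \<beta>J: "(\<Sum>A\<in>UNIV. \<beta> A x * J A c (?z x)) = inverse (eta None (?z x) (p x)) * xi (p x) c" for c
      unfolding eta_J[OF z, symmetric] sum_distrib_left \<beta>_def by (simp add: mult_ac)
    have "(\<Sum>A\<in>UNIV. \<beta>' A i * E A j (?z x) (p x)) = 0" for i j
      using second_order[OF U(1) x zW y q[OF x] k\<beta> van, of i j]
        second_order_quad[OF z star[OF z] \<beta>J, of i j] \<beta>J[of None]
      by (simp add: xi_def)
    then have 0: "(\<Sum>k\<in>UNIV. \<beta>' (Some k) i * E (Some k) j (?z x) (p x)) = 0" for i j
      by (simp add: sum_UNIV_option \<beta>'None)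
    \<comment> \<open>\<open>D\<close> inverts the \<open>x\<close> part of the image tangent
      vectors; applied to an axis vector it isolates one component of
      \<open>\<beta>'\<close>.\<close>
    obtain D where D: "\<And>H k. (\<Sum>j\<in>UNIV. E (Some k) j (?z x) (p x) * D H $ j) = H $ k"
      using gt(9)[OF X] unfolding x_def by blast
    have "\<beta>' (Some k) i = 0" for i
    proof -
      have "(\<Sum>j\<in>UNIV. (\<Sum>l\<in>UNIV. \<beta>' (Some l) i * E (Some l) j (?z x) (p x)) * D (axis k 1) $ j)
        = (\<Sum>l\<in>UNIV. \<beta>' (Some l) i * (\<Sum>j\<in>UNIV. E (Some l) j (?z x) (p x) * D (axis k 1) $ j))"
        by (rule sum_mult_lin)
      then show ?thesis by (simp add: 0 D axis_def sum_if_mult)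
    qed
    then have "\<beta>' (Some k) = (\<lambda>_. 0)" by blast
    with k\<beta>[of "Some k"] show ?thesis by (simp add: x_def)
  qed
  show thesis
  proof (rule that[of U1 V Y g P])
    fix X assume X: "X \<in> V"
    show "P X = prolong (?z (g X)) (p (g X))" by (simp add: P_def)
    show "has_partials Y (\<lambda>k. P X $ k) X" using gt(8)[OF X] by (simp add: P_def prolong_def)
    fix k
    obtain D where "(g has_derivative D) (at X)" using gt(9)[OF X] by blast
    from has_partials_compose_map[OF \<beta>0[OF X] this, of k] have "has_partials (\<lambda>X. \<beta> (Some k) (g X)) (\<lambda>_. 0) X" by (simp add: has_partials_def)
    from has_partials_uminus[OF this] show "has_partials (\<lambda>X. P X $ k) (\<lambda>_. 0) X" by (simp add: Pk)
  qed (use gt in auto)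
qed

text \<open>Jets over \<open>W\<close> whose image hyperplane is not vertical, so that the
  prolongation of \<Phi> is defined on them.\<close>

definition jets_dom :: "('k, 'n) jet set" where
  "jets_dom = {s. vc (fst s, fst (snd s)) \<in> W \<and> eta None (vc (fst s, fst (snd s))) (snd (snd s)) \<noteq> 0}"

definition jet_map :: "('k, 'n) jet \<Rightarrow> ('k, 'n) jet" where
  "jet_map s = (fst (pt (\<Phi> (vc (fst s, fst (snd s))))), snd (pt (\<Phi> (vc (fst s, fst (snd s))))), prolong (vc (fst s, fst (snd s))) (snd (snd s)))"

lemma isCont_eta:
  fixes s :: "('k, 'n) jet"
  assumes "vc (fst s, fst (snd s)) \<in> W"
  shows "isCont (\<lambda>s. eta A (vc (fst s, fst (snd s))) (snd (snd s))) s"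
proof -
  have "continuous_on UNIV (\<lambda>s :: ('k, 'n) jet. vc (fst s, fst (snd s)))"
    by (intro continuous_on_compose2[OF continuous_vc] continuous_intros) auto
  then have 1: "isCont (\<lambda>s :: ('k, 'n) jet. vc (fst s, fst (snd s))) s"
    using continuous_on_eq_continuous_at[OF open_UNIV] by blast
  have 2: "isCont (\<lambda>s :: ('k, 'n) jet. K c A (vc (fst s, fst (snd s)))) s" for c
    by (rule isCont_o2[OF 1 an_isCont[OF an_K[OF assms]]])
  have 3: "isCont (\<lambda>s :: ('k, 'n) jet. xi (snd (snd s)) c) s" for c
    by (cases c) (auto simp: xi_def intro!: continuous_intros)
  show ?thesis unfolding eta_def by (intro continuous_sum continuous_mult 2 3)
qed

lemma open_jets_dom: "open jets_dom"
proof -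
  define B where "B = {s :: ('k, 'n) jet. vc (fst s, fst (snd s)) \<in> W}"
  have "continuous_on UNIV (\<lambda>s :: ('k, 'n) jet. vc (fst s, fst (snd s)))"
    by (intro continuous_on_compose2[OF continuous_vc] continuous_intros) auto
  from open_vimage[OF open_W this] have B: "open B" by (simp add: B_def vimage_def)
  have "continuous_on B (\<lambda>s. eta None (vc (fst s, fst (snd s))) (snd (snd s)))"
    by (rule continuous_at_imp_continuous_on) (auto simp: B_def isCont_eta)
  from continuous_open_preimage[OF this B, of "- {0}"] have "open (B \<inter> (\<lambda>s. eta None (vc (fst s, fst (snd s))) (snd (snd s))) -` (- {0}))"
    by (simp add: open_Compl)
  then show ?thesis by (simp add: B_def vimage_def Int_def jets_dom_def)
qed

lemma continuous_jet_map: "continuous_on jets_dom jet_map"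
proof (rule continuous_at_imp_continuous_on, rule ballI)
  fix s :: "('k, 'n) jet" assume s: "s \<in> jets_dom"
  then have W: "vc (fst s, fst (snd s)) \<in> W" and e: "eta None (vc (fst s, fst (snd s))) (snd (snd s)) \<noteq> 0"
    by (auto simp: jets_dom_def)
  have "continuous_on UNIV (\<lambda>s :: ('k, 'n) jet. vc (fst s, fst (snd s)))"
    by (intro continuous_on_compose2[OF continuous_vc] continuous_intros) auto
  then have 1: "isCont (\<lambda>s :: ('k, 'n) jet. vc (fst s, fst (snd s))) s"
    using continuous_on_eq_continuous_at[OF open_UNIV] by blast
  have "isCont \<Phi> (vc (fst s, fst (snd s)))" by (rule an_isCont_vec[OF an_\<Phi>[OF W]])
  from isCont_o2[OF 1 this] have 2: "isCont (\<lambda>s :: ('k, 'n) jet. \<Phi> (vc (fst s, fst (snd s)))) s" .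
  have "isCont pt (\<Phi> (vc (fst s, fst (snd s))))" using continuous_pt by (auto simp: continuous_on_eq_continuous_at)
  from isCont_o2[OF 2 this] have 3: "isCont (\<lambda>s :: ('k, 'n) jet. pt (\<Phi> (vc (fst s, fst (snd s))))) s" .
  have 4: "isCont (\<lambda>s :: ('k, 'n) jet. prolong (vc (fst s, fst (snd s))) (snd (snd s))) s"
  proof -
    have "isCont (\<lambda>s :: ('k, 'n) jet. - (eta (Some k) (vc (fst s, fst (snd s))) (snd (snd s)) / eta None (vc (fst s, fst (snd s))) (snd (snd s)))) s" for k
      by (intro continuous_minus isCont_divide isCont_eta W e)
    then show ?thesis unfolding prolong_def isCont_def by (intro tendsto_vec_lambda)
  qed
  show "isCont jet_map s"
    unfolding jet_map_def[abs_def] by (intro continuous_Pair continuous_fst continuous_snd 3 4)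
qed

interpretation D: coord_change \<Psi> \<Phi> W' W
  by (rule dual)

lemma dual_eta: "D.eta a w B = (\<Sum>A\<in>UNIV. xi B A * J A a (\<Psi> w))"
  by (simp add: D.eta_def D.K_def J_def)

text \<open>Transport forward and back multiplies \<open>xi p\<close> by a nonzero factor. Therefore
  the inverse prolongation is defined at the image jet, and the factor cancels in the slope.\<close>

lemma dual_eta_prolong:
  assumes "z \<in> W" "eta None z p \<noteq> 0"
  shows "D.eta a (\<Phi> z) (prolong z p) = xi p a * inverse (eta None z p)"
proof -
  have "D.eta a (\<Phi> z) (prolong z p) = inverse (eta None z p) * (\<Sum>A\<in>UNIV. eta A z p * J A a z)"
    unfolding dual_eta xi_prolong[OF assms(2)] sum_distrib_left by (simp add: \<Psi>_\<Phi>[OF assms(1)] mult_ac)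
  then show ?thesis unfolding eta_J[OF assms(1)] by (simp only: mult.commute)
qed

lemma dual_prolong:
  assumes "z \<in> W" "eta None z p \<noteq> 0"
  shows "D.prolong (\<Phi> z) (prolong z p) = p"
  using assms(2) by (simp add: D.prolong_def dual_eta_prolong[OF assms] xi_def vec_eq_iff)

text \<open>The dual of \<open>graph_transform\<close> makes the image a graph with slope
  \<open>p\<close>. First \<open>p\<close> is shown to be differentiable; its derivative is then
  identified by \<open>image_of_solution\<close>, because \<Phi> maps the new graph back into the
  flat one.\<close>

lemma flat_to_solution:
  assumes U: "open U" "X0 \<in> U" and zW: "\<And>X. X \<in> U \<Longrightarrow> vc (X, Y X) \<in> W'"
    and Y: "\<And>X. X \<in> U \<Longrightarrow> has_partials Y (\<lambda>j. P X $ j) X" and P: "\<And>X j. X \<in> U \<Longrightarrow> has_partials (\<lambda>X. P X $ j) (\<lambda>_. 0) X"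
    and e: "\<And>X. X \<in> U \<Longrightarrow> D.eta None (vc (X, Y X)) (P X) \<noteq> 0"
    and star: "\<And>z A a b. z \<in> W \<Longrightarrow> pd b (J A a) z = (\<Sum>c\<in>UNIV. \<Gamma> c a b z * J A c z)"
  obtains U1 V y p g where "open U1" "X0 \<in> U1" "U1 \<subseteq> U" "open V"
    "(\<lambda>v. pt (\<Psi> (vc v))) ` graph_on U1 Y = graph_on V y"
    "\<And>x. x \<in> V \<Longrightarrow> g x \<in> U1" "\<And>x. x \<in> V \<Longrightarrow> vc (x, y x) = \<Psi> (vc (g x, Y (g x)))"
    "\<And>x. x \<in> V \<Longrightarrow> p x = D.prolong (vc (g x, Y (g x))) (P (g x))"
    "\<And>x. x \<in> V \<Longrightarrow> has_partials y (\<lambda>k. p x $ k) x"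
    "\<And>x j. x \<in> V \<Longrightarrow> has_partials (\<lambda>x. p x $ j) (\<lambda>i. quad (\<lambda>c a b. \<Gamma> c a b (vc (x, y x))) (p x) j i) x"
proof -
  obtain U1 V y g where gt: "open U1" "X0 \<in> U1" "U1 \<subseteq> U" "open V"
    "(\<lambda>v. pt (\<Psi> (vc v))) ` graph_on U1 Y = graph_on V y"
    "\<And>X. X \<in> V \<Longrightarrow> g X \<in> U1" "\<And>X. X \<in> V \<Longrightarrow> vc (X, y X) = \<Psi> (vc (g X, Y (g X)))"
    "\<And>X. X \<in> V \<Longrightarrow> has_partials y (\<lambda>k. - (D.eta (Some k) (vc (g X, Y (g X))) (P (g X)) / D.eta None (vc (g X, Y (g X))) (P (g X)))) X"
    "\<And>X. X \<in> V \<Longrightarrow> \<exists>D. (g has_derivative D) (at X) \<and> (\<forall>H k. (\<Sum>j\<in>UNIV. D.E (Some k) j (vc (g X, Y (g X))) (P (g X)) * D H $ j) = H $ k)"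
    by (rule D.graph_transform[OF U zW Y has_partials_isCont[OF P] e]) (assumption | rule that)+
  let ?z = "\<lambda>x. vc (x, y x)"
  have gU: "g x \<in> U" if "x \<in> V" for x using gt(3,6) that by blast
  have zW1: "?z x \<in> W" if "x \<in> V" for x using gt(7)[OF that] \<Psi>_W'[OF zW[OF gU[OF that]]] by simp
  define p where "p = (\<lambda>x. D.prolong (vc (g x, Y (g x))) (P (g x)))"
  have ky: "has_partials y (\<lambda>k. p x $ k) x" if "x \<in> V" for x using gt(8)[OF that] by (simp add: p_def D.prolong_def)
  \<comment> \<open>This rewrites \<open>D.eta\<close> with the Jacobian at the new graph, where
    \<open>y\<close> is already known to be differentiable.\<close>
  define \<zeta> where "\<zeta> = (\<lambda>a x. \<Sum>A\<in>UNIV. xi (P (g x)) A * J A a (?z x))"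
  have \<zeta>: "D.eta a (vc (g x, Y (g x))) (P (g x)) = \<zeta> a x" if "x \<in> V" for a x
    unfolding dual_eta \<zeta>_def gt(7)[OF that] ..
  have pk: "p x $ k = - (\<zeta> (Some k) x * inverse (\<zeta> None x))" if "x \<in> V" for x k
    by (simp add: p_def D.prolong_def \<zeta>[OF that] divide_inverse)
  have "\<exists>D. has_partials (\<lambda>x. p x $ k) D x" if x: "x \<in> V" for x k
  proof -
    have kJ: "has_partials (\<lambda>x. J A a (?z x)) (\<lambda>i. \<Sum>b\<in>UNIV. pd b (J A a) (?z x) * tv (p x) i b) x" for A a
      using has_partials_compose[of "J A a" "\<lambda>m x. ?z x $ m" x "\<lambda>m i. tv (p x) i m"] an_J[OF zW1[OF x]] has_partials_graph[OF ky[OF x]]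
      by (simp only: vec_lambda_eta)
    obtain D where D: "(g has_derivative D) (at x)" using gt(9)[OF x] by blast
    have "has_partials (\<lambda>x. P (g x) $ l) (\<lambda>_. 0) x" for l
      using has_partials_compose_map[OF P[OF gU[OF x]] D, of l] by (simp add: has_partials_def)
    note kP = has_partials_uminus[OF this]
    have kxi: "has_partials (\<lambda>x. xi (P (g x)) A) (\<lambda>_. 0) x" for A
      using kP by (cases A) (simp_all add: xi_def has_partials_const)
    have k\<zeta>: "has_partials (\<zeta> a) (\<lambda>i. \<Sum>A\<in>UNIV. 0 * J A a (?z x) + xi (P (g x)) A * (\<Sum>b\<in>UNIV. pd b (J A a) (?z x) * tv (p x) i b)) x" for a
      unfolding \<zeta>_def by (intro has_partials_sum has_partials_mult kxi kJ)
    have "\<zeta> None x \<noteq> 0" using e[OF gU[OF x]] \<zeta>[OF x] by simp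
    from has_partials_uminus[OF has_partials_mult[OF k\<zeta> has_partials_inverse[OF k\<zeta> this]]]
    obtain D' where "has_partials (\<lambda>x. - (\<zeta> (Some k) x * inverse (\<zeta> None x))) D' x" by blast
    then have "has_partials (\<lambda>x. p x $ k) D' x" by (rule has_partials_transform[OF _ gt(4) x]) (simp add: pk)
    then show ?thesis by blast
  qed
  then have "\<exists>q. \<forall>k. has_partials (\<lambda>x. p x $ k) (q k) x" if "x \<in> V" for x
    using that by (intro choice) blast
  then obtain q where q: "\<And>x k. x \<in> V \<Longrightarrow> has_partials (\<lambda>x. p x $ k) (q x k) x" by metis
  have img: "(\<lambda>v. pt (\<Phi> (vc v))) ` graph_on V y \<subseteq> graph_on U1 Y"
  proof
    fix v assume "v \<in> (\<lambda>v. pt (\<Phi> (vc v))) ` graph_on V y"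
    then obtain w where "w \<in> graph_on U1 Y" "v = pt (\<Phi> (\<Psi> (vc w)))" unfolding gt(5)[symmetric] by auto
    moreover have "vc w \<in> W'" using \<open>w \<in> graph_on U1 Y\<close> zW gt(3) by (auto simp: graph_on_def)
    ultimately show "v \<in> graph_on U1 Y" by (simp add: \<Phi>_\<Psi>)
  qed
  show thesis
  proof (rule that[of U1 V y g p])
    fix x j assume x: "x \<in> V"
    show "p x = D.prolong (vc (g x, Y (g x))) (P (g x))" by (simp add: p_def)
    show "has_partials y (\<lambda>k. p x $ k) x" by (rule ky[OF x])
    have *: "q x j i = quad (\<lambda>c a b. \<Gamma> c a b (?z x)) (p x) j i" for i
      by (rule image_of_solution[OF gt(4) x zW1 ky q[OF x] img Y P star[OF zW1[OF x]]]) (use gt(3) in auto)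
    show "has_partials (\<lambda>x. p x $ j) (\<lambda>i. quad (\<lambda>c a b. \<Gamma> c a b (?z x)) (p x) j i) x"
      unfolding *[symmetric] using q[OF x, of j] by simp
  qed (use gt in auto)
qed

lemma flat_equivalence:
  assumes star: "\<And>z A a b. z \<in> W \<Longrightarrow> pd b (J A a) z = (\<Sum>c\<in>UNIV. \<Gamma> c a b z * J A c z)"
    and N0: "open N0" "N0 \<subseteq> \<Omega>" "(x0, y0, p0) \<in> N0"
    and F: "\<And>x y p i j. (x, y, p) \<in> N0 \<Longrightarrow> F i j (x, y, p) = quad (\<lambda>c a b. \<Gamma> c a b (vc (x, y))) p i j"
    and s: "vc (x0, y0) \<in> W" "eta None (vc (x0, y0)) p0 \<noteq> 0"
  shows "locally_equivalent F \<Omega> flat_system UNIV (x0, y0, p0)"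
proof -
  define N where "N = N0 \<inter> jets_dom"
  \<comment> \<open>The image of \<open>N\<close> under prolongation, written as a preimage under
    the inverse prolongation so that it is visibly open. \<open>dual_prolong\<close> puts the jets
    of transformed solutions into it.\<close>
  define N' where "N' = D.jets_dom \<inter> D.jet_map -` N"
  have open_N: "open N" using N0(1) open_jets_dom by (auto simp: N_def)
  from continuous_open_preimage[OF D.continuous_jet_map D.open_jets_dom open_N] have open_N': "open N'" by (simp add: N'_def)
  have N_iff: "(x, y, p) \<in> N \<longleftrightarrow> (x, y, p) \<in> N0 \<and> vc (x, y) \<in> W \<and> eta None (vc (x, y)) p \<noteq> 0" for x y p
    by (simp add: N_def jets_dom_def)
  have N'_iff: "(x, y, p) \<in> N' \<longleftrightarrow> vc (x, y) \<in> W' \<and> D.eta None (vc (x, y)) p \<noteq> 0 \<and>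
      (fst (pt (\<Psi> (vc (x, y)))), snd (pt (\<Psi> (vc (x, y)))), D.prolong (vc (x, y)) p) \<in> N" for x y p
    by (simp add: N'_def D.jets_dom_def D.jet_map_def)
  have fwd: "maps_solutions (\<lambda>v. pt (\<Phi> (vc v))) F N flat_system N'"
    unfolding maps_solutions_def
  proof (intro allI impI ballI)
    fix U y x assume "solution F N U y" and x: "x \<in> U"
    then obtain p where U: "open U" and p: "\<forall>x\<in>U. (x, y x, p x) \<in> N \<and> has_partials y (\<lambda>j. p x $ j) x \<and>
      (\<forall>j. has_partials (\<lambda>x. p x $ j) (\<lambda>i. F j i (x, y x, p x)) x)"
      unfolding solution_has_partials by (elim conjE exE) (rule that)
    have jN: "(x, y x, p x) \<in> N" if "x \<in> U" for x using p that by blast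
    have ky: "has_partials y (\<lambda>j. p x $ j) x" if "x \<in> U" for x using p that by blast
    have kp: "has_partials (\<lambda>x. p x $ j) (\<lambda>i. quad (\<lambda>c a b. \<Gamma> c a b (vc (x, y x))) (p x) j i) x" if "x \<in> U" for x j
    proof -
      have "(\<lambda>i. F j i (x, y x, p x)) = (\<lambda>i. quad (\<lambda>c a b. \<Gamma> c a b (vc (x, y x))) (p x) j i)"
        by (rule ext, rule F) (use jN[OF that] in \<open>simp add: N_iff\<close>)
      then show ?thesis using bspec[OF p that] by metis
    qed
    obtain U1 V Y P g where r: "open U1" "x \<in> U1" "U1 \<subseteq> U" "open V"
      "(\<lambda>v. pt (\<Phi> (vc v))) ` graph_on U1 y = graph_on V Y"
      "\<And>X. X \<in> V \<Longrightarrow> g X \<in> U1" "\<And>X. X \<in> V \<Longrightarrow> vc (X, Y X) = \<Phi> (vc (g X, y (g X)))"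
      "\<And>X. X \<in> V \<Longrightarrow> P X = prolong (vc (g X, y (g X))) (p (g X))"
      "\<And>X. X \<in> V \<Longrightarrow> has_partials Y (\<lambda>k. P X $ k) X" "\<And>X k. X \<in> V \<Longrightarrow> has_partials (\<lambda>X. P X $ k) (\<lambda>_. 0) X"
    proof (rule solution_to_flat[OF U x _ ky kp _ star])
      show "vc (x, y x) \<in> W" "eta None (vc (x, y x)) (p x) \<noteq> 0" if "x \<in> U" for x using jN[OF that] by (simp_all add: N_iff)
    qed (assumption | rule that)+
    have "(X, Y X, P X) \<in> N'" if X: "X \<in> V" for X
    proof -
      have gU: "g X \<in> U" using r(3,6) X by blast
      note j = jN[OF gU]
      have z: "vc (g X, y (g X)) \<in> W" and e: "eta None (vc (g X, y (g X))) (p (g X)) \<noteq> 0" using j by (simp_all add: N_iff)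
      show ?thesis
        unfolding N'_iff r(7)[OF X] r(8)[OF X]
        using j e by (simp add: \<Phi>_W[OF z] dual_eta_prolong[OF z e] dual_prolong[OF z e] \<Psi>_\<Phi>[OF z] xi_def)
    qed
    then have "solution flat_system N' V Y"
      unfolding solution_has_partials using r(4,9,10) by (intro conjI exI[of _ P]) (auto simp: flat_system_def)
    with r show "\<exists>U1 V Y. open U1 \<and> x \<in> U1 \<and> U1 \<subseteq> U \<and> solution flat_system N' V Y \<and>
        (\<lambda>v. pt (\<Phi> (vc v))) ` graph_on U1 y = graph_on V Y"
      by (intro exI[of _ U1] exI[of _ V] exI[of _ Y] conjI)
  qed
  have bwd: "maps_solutions (\<lambda>w. pt (\<Psi> (vc w))) flat_system N' F N"
    unfolding maps_solutions_def
  proof (intro allI impI ballI)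
    fix U Y X assume "solution flat_system N' U Y" and X: "X \<in> U"
    then obtain P where U: "open U" and P: "\<forall>X\<in>U. (X, Y X, P X) \<in> N' \<and> has_partials Y (\<lambda>j. P X $ j) X \<and>
      (\<forall>j. has_partials (\<lambda>X. P X $ j) (\<lambda>i. flat_system j i (X, Y X, P X)) X)"
      unfolding solution_has_partials by (elim conjE exE) (rule that)
    have jN: "(X, Y X, P X) \<in> N'" if "X \<in> U" for X using P that by blast
    have kY: "has_partials Y (\<lambda>j. P X $ j) X" if "X \<in> U" for X using P that by blast
    have kP: "has_partials (\<lambda>X. P X $ j) (\<lambda>_. 0) X" if "X \<in> U" for X j
      using bspec[OF P that] by (simp add: flat_system_def)
    obtain U1 V y p g where r: "open U1" "X \<in> U1" "U1 \<subseteq> U" "open V"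
      "(\<lambda>v. pt (\<Psi> (vc v))) ` graph_on U1 Y = graph_on V y"
      "\<And>x. x \<in> V \<Longrightarrow> g x \<in> U1" "\<And>x. x \<in> V \<Longrightarrow> vc (x, y x) = \<Psi> (vc (g x, Y (g x)))"
      "\<And>x. x \<in> V \<Longrightarrow> p x = D.prolong (vc (g x, Y (g x))) (P (g x))"
      "\<And>x. x \<in> V \<Longrightarrow> has_partials y (\<lambda>k. p x $ k) x"
      "\<And>x j. x \<in> V \<Longrightarrow> has_partials (\<lambda>x. p x $ j) (\<lambda>i. quad (\<lambda>c a b. \<Gamma> c a b (vc (x, y x))) (p x) j i) x"
    proof (rule flat_to_solution[OF U X _ kY kP _ star])
      show "vc (X, Y X) \<in> W'" "D.eta None (vc (X, Y X)) (P X) \<noteq> 0" if "X \<in> U" for X using jN[OF that] by (simp_all add: N'_iff)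
    qed (assumption | rule that)+
    have j: "(x, y x, p x) \<in> N" if x: "x \<in> V" for x
    proof -
      have "g x \<in> U" using r(3,6) x by blast
      from jN[OF this] show ?thesis
        by (simp add: N'_iff r(7)[OF x, symmetric] r(8)[OF x, symmetric])
    qed
    have kp: "has_partials (\<lambda>x. p x $ k) (\<lambda>i. F k i (x, y x, p x)) x" if "x \<in> V" for x k
    proof -
      have "(\<lambda>i. F k i (x, y x, p x)) = (\<lambda>i. quad (\<lambda>c a b. \<Gamma> c a b (vc (x, y x))) (p x) k i)"
        by (rule ext, rule F) (use j[OF that] in \<open>simp add: N_iff\<close>)
      then show ?thesis using r(10)[OF that, of k] by metis
    qed
    have "solution F N V y"
      unfolding solution_has_partials using r(4,9) j kp by (intro conjI exI[of _ p]) auto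
    with r show "\<exists>U1 V Ya. open U1 \<and> X \<in> U1 \<and> U1 \<subseteq> U \<and> solution F N V Ya \<and>
        (\<lambda>w. pt (\<Psi> (vc w))) ` graph_on U1 Y = graph_on V Ya"
      by (intro exI[of _ U1] exI[of _ V] exI[of _ y] conjI)
  qed
  have "coord_change \<Phi> \<Psi> W W'" by unfold_locales
  note dif = diffeo_of_coord_change[OF this]
  have "(x0, y0, p0) \<in> N" using N0 s by (simp add: N_iff)
  moreover have "N \<subseteq> \<Omega>" using N0(2) by (auto simp: N_def)
  moreover have "\<forall>(x, y, p)\<in>N. (x, y) \<in> vc -` W" by (auto simp: N_iff)
  moreover have "\<forall>(x, y, p)\<in>N'. (x, y) \<in> vc -` W'" by (auto simp: N'_iff)
  ultimately show ?thesis
    unfolding locally_equivalent_def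
    using dif open_N open_N' fwd bwd
    by (intro exI[of _ "vc -` W"] exI[of _ "vc -` W'"] exI[of _ "\<lambda>v. pt (\<Phi> (vc v))"] exI[of _ "\<lambda>w. pt (\<Psi> (vc w))"]
        exI[of _ N] exI[of _ N'] conjI) (assumption | simp)+
qed

end

section \<open>Flat systems and cubic systems\<close>

text \<open>One symmetric connection that induces the cubic system; the components with upper index
  \<open>y\<close> and at least one lower index \<open>y\<close> are chosen to be 0.
  \<open>G\<close> and \<open>H\<close> are symmetrised because their symmetry is given only on
  \<open>W\<close>, whereas \<open>flat_projective\<close> asks for symmetric functions.\<close>

definition cubic_christoffel :: "('n \<Rightarrow> 'n \<Rightarrow> 'k) \<Rightarrow> ('n \<Rightarrow> 'n \<Rightarrow> 'n \<Rightarrow> 'k) \<Rightarrow> ('n \<Rightarrow> 'n \<Rightarrow> 'k) \<Rightarrow> ('n \<Rightarrow> 'k)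
    \<Rightarrow> 'n option \<Rightarrow> 'n option \<Rightarrow> 'n option \<Rightarrow> 'k::field_char_0" where
  "cubic_christoffel G H L M c a b = (case c of
     None \<Rightarrow> (case a of None \<Rightarrow> 0 | Some i \<Rightarrow> (case b of None \<Rightarrow> 0 | Some j \<Rightarrow> - (1/2 * (G i j + G j i))))
   | Some k \<Rightarrow> (case a of
       None \<Rightarrow> (case b of None \<Rightarrow> M k | Some j \<Rightarrow> 1/2 * L j k)
     | Some i \<Rightarrow> (case b of None \<Rightarrow> 1/2 * L i k | Some j \<Rightarrow> 1/2 * (H i j k + H j i k))))"

lemma cubic_christoffel_sym: "cubic_christoffel G H L M c a b = cubic_christoffel G H L M c b a"
  by (simp add: cubic_christoffel_def add.commute split: option.split)

lemma quad_cubic_christoffel: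
  fixes G :: "'n::finite \<Rightarrow> 'n \<Rightarrow> 'k::field_char_0"
  assumes "\<And>i j. G i j = G j i" "\<And>i j k. H i j k = H j i k"
  shows "quad (cubic_christoffel G H L M) p i j = G i j + (\<Sum>k\<in>UNIV. p $ k *
     (H i j k + 1/2 * p $ i * L j k + 1/2 * p $ j * L i k + p $ i * p $ j * M k))"
proof -
  have "G j i = G i j" "H j i k = H i j k" for k by (rule assms)+
  then show ?thesis
    by (simp add: quad_cubic[OF cubic_christoffel_sym] cubic_christoffel_def cong: if_cong)
qed

lemma an_cubic_christoffel:
  assumes "\<And>i j. an (G i j) z" "\<And>i j k. an (H i j k) z" "\<And>i j. an (L i j) z" "\<And>k. an (M k) z"
  shows "an (\<lambda>z. cubic_christoffel (\<lambda>i j. G i j z) (\<lambda>i j k. H i j k z) (\<lambda>i j. L i j z) (\<lambda>k. M k z) c a b) z"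
  unfolding cubic_christoffel_def
  by (cases c; cases a; cases b; simp only: option.case) (intro an_const an_minus an_mult an_add assms)+

lemma (in coord_change) restrict:
  assumes "open S"
  shows "coord_change \<Phi> \<Psi> (W \<inter> S) (W' \<inter> \<Psi> -` S)"
proof
  have "continuous_on W' \<Psi>"
    by (rule continuous_at_imp_continuous_on, rule ballI, rule an_isCont_vec, rule an_\<Psi>)
  from continuous_open_preimage[OF this open_W' assms] show "open (W' \<inter> \<Psi> -` S)" .
qed (use assms open_W in \<open>auto simp: \<Phi>_W \<Psi>_\<Phi> \<Psi>_W' \<Phi>_\<Psi> an_\<Phi> an_\<Psi>\<close>)

text \<open>An identity Jacobian leaves the conormal unchanged, and \<open>xi p\<close> has
  \<open>y\<close> component 1.\<close>

lemma (in coord_change) eta_None_id: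
  assumes z: "z \<in> W" and id: "\<And>A a. J A a z = (if A = a then 1 else 0)"
  shows "eta None z p = 1"
proof -
  have "K c a z = (if a = c then 1 else 0)" for c a
    using KJ[OF z, of c a] by (simp add: id sum_if_mult)
  then show ?thesis by (simp add: eta_def sum_if_mult xi_def)
qed

text \<open>The first correction adds \<open>\<alpha> a\<close> to the trace, the second adds
  \<open>CARD('a)\<close> times \<open>\<alpha> a\<close>; hence the factor
  \<open>Suc CARD('a)\<close>.\<close>

lemma trace_free:
  fixes \<Gamma> :: "'a::finite \<Rightarrow> 'a \<Rightarrow> 'a \<Rightarrow> 'k::field_char_0" and \<alpha> :: "'a \<Rightarrow> 'k"
  assumes "\<And>b. \<alpha> b = - (\<Sum>c\<in>UNIV. \<Gamma> c b c) * inverse (of_nat (Suc CARD('a)))"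
  shows "(\<Sum>c\<in>UNIV. \<Gamma> c a c + (if c = a then \<alpha> c else 0) + (if c = c then \<alpha> a else 0)) = 0"
proof -
  have "(\<Sum>c\<in>UNIV. \<Gamma> c a c + (if c = a then \<alpha> c else 0) + (if c = c then \<alpha> a else 0)) =
    (\<Sum>c\<in>UNIV. \<Gamma> c a c) + of_nat (Suc CARD('a)) * \<alpha> a"
    by (simp add: sum.distrib algebra_simps)
  also have "of_nat (Suc CARD('a)) * \<alpha> a = - (\<Sum>c\<in>UNIV. \<Gamma> c a c)"
    unfolding assms by (simp del: of_nat_Suc)
  finally show ?thesis by simp
qed

lemma cubic_imp_flat:
  fixes F :: "('k::scalar_field, 'n::finite) system"
  assumes n: "CARD('n) \<ge> 2" and sys: "analytic_system F \<Omega>" and ci: "completely_integrable F \<Omega>"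
    and cubic: "has_cubic_form F \<Omega> (x0, y0, p0)"
  shows "locally_equivalent F \<Omega> flat_system UNIV (x0, y0, p0)"
proof -
  obtain N W G H L M where N: "open N" "(x0, y0, p0) \<in> N" "N \<subseteq> \<Omega>" and "open W"
    and NW': "\<forall>(x, y, p)\<in>N. (x, y) \<in> W"
    and an: "\<forall>i j. analytic_on_points (G i j) W" "\<forall>i j k. analytic_on_points (H i j k) W"
      "\<forall>i j. analytic_on_points (L i j) W" "\<forall>k. analytic_on_points (M k) W"
    and symGH: "\<forall>v\<in>W. \<forall>i j. G i j v = G j i v" "\<forall>v\<in>W. \<forall>i j k. H i j k v = H j i k v"
    and form: "\<forall>(x, y, p)\<in>N. \<forall>i j. F i j (x, y, p) = G i j (x, y) + (\<Sum>k\<in>UNIV. p $ k *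
        (H i j k (x, y) + 1/2 * p $ i * L j k (x, y) + 1/2 * p $ j * L i k (x, y) + p $ i * p $ j * M k (x, y)))"
    using cubic unfolding has_cubic_form_def by (elim exE conjE) (rule that)
  have NW: "(x, y) \<in> W" if "(x, y, p) \<in> N" for x y p using NW' that by auto
  define \<Gamma>0 where "\<Gamma>0 = (\<lambda>c a b z. cubic_christoffel (\<lambda>i j. G i j (pt z)) (\<lambda>i j k. H i j k (pt z)) (\<lambda>i j. L i j (pt z)) (\<lambda>k. M k (pt z)) c a b)"
  define \<alpha> where "\<alpha> = (\<lambda>b z. - (\<Sum>c\<in>UNIV. \<Gamma>0 c b c z) * inverse (of_nat (Suc CARD('n option))))"
  define \<Gamma> where "\<Gamma> = (\<lambda>c a b z. \<Gamma>0 c a b z + (if c = a then \<alpha> b z else 0) + (if c = b then \<alpha> a z else 0))"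
  have an0: "an (\<Gamma>0 c a b) z" if "pt z \<in> W" for c a b z
    unfolding \<Gamma>0_def by (rule an_cubic_christoffel) (use an that in \<open>simp_all add: analytic_on_points_iff\<close>)
  have an\<alpha>: "an (\<alpha> b) z" if "pt z \<in> W" for b z
    unfolding \<alpha>_def by (intro an_mult an_const an_minus an_sum an0 that)
  have an\<Gamma>: "an (\<Gamma> c a b) z" if "pt z \<in> W" for c a b z
  proof -
    have an_if: "an (\<lambda>z. if Q then \<alpha> b z else 0) z" for Q b
      using an\<alpha>[OF that] by (cases Q) (simp_all add: an_const)
    show ?thesis unfolding \<Gamma>_def by (intro an_add an0[OF that] an_if)
  qed
  have sym: "\<Gamma> c a b = \<Gamma> c b a" for c a b
    using cubic_christoffel_sym[of _ _ _ _ c a b] by (auto simp: \<Gamma>_def \<Gamma>0_def fun_eq_iff add_ac)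
  have F: "F i j (x, y, p) = quad (\<lambda>c a b. \<Gamma> c a b (vc (x, y))) p i j" if "(x, y, p) \<in> N" for x y p i j
  proof -
    have "quad (\<lambda>c a b. \<Gamma> c a b (vc (x, y))) p i j = quad (\<lambda>c a b. \<Gamma>0 c a b (vc (x, y))) p i j"
      unfolding \<Gamma>_def by (rule quad_projective)
    also have "\<dots> = quad (cubic_christoffel (\<lambda>i j. G i j (x, y)) (\<lambda>i j k. H i j k (x, y)) (\<lambda>i j. L i j (x, y)) (\<lambda>k. M k (x, y))) p i j"
      by (simp add: \<Gamma>0_def)
    also have "\<dots> = F i j (x, y, p)"
      using form that symGH NW[OF that] by (subst quad_cubic_christoffel) auto
    finally show ?thesis by simp
  qed
  \<comment> \<open>A product neighbourhood inside \<open>N\<close> is wanted, so that at every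
    point of \<open>A\<close> the curvature can be tested against the same ball of slopes around
    \<open>p0\<close>.\<close>
  let ?f = "\<lambda>u :: ('k ^ 'n option) \<times> ('k ^ 'n). (fst (pt (fst u)), snd (pt (fst u)), snd u)"
  have "continuous_on UNIV ?f"
    by (intro continuous_intros continuous_on_compose2[OF continuous_pt]) auto
  from open_vimage[OF N(1) this] have "open (?f -` N)" .
  moreover have "(vc (x0, y0), p0) \<in> ?f -` N" using N(2) by simp
  ultimately obtain A B where A: "open A" "vc (x0, y0) \<in> A" and B: "open B" "p0 \<in> B" and AB: "A \<times> B \<subseteq> ?f -` N"
    by (rule open_prod_elim) auto
  obtain e where e: "0 < e" "ball p0 e \<subseteq> B" using B openE by blast
  have jN: "jt (join z p) \<in> N" if "z \<in> A" "norm (p - p0) < e" for z p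
  proof -
    have "p \<in> B" using that(2) e(2) by (auto simp: dist_norm norm_minus_commute subset_iff)
    then show ?thesis using AB that(1) by (auto simp: jt_join)
  qed
  have AW: "pt z \<in> W" if "z \<in> A" for z
    using jN[OF that, of p0] e(1) NW[of "fst (pt z)" "snd (pt z)" p0] by (simp add: jt_join)
  interpret fp: flat_projective \<Gamma> A
  proof
    have "CARD('n option) = Suc CARD('n)" by (simp add: UNIV_option_conv card_image)
    then show "CARD('n option) \<ge> 3" using n by simp
    show "open A" by fact
    show "an (\<Gamma> c a b) z" if "z \<in> A" for c a b z by (rule an\<Gamma>[OF AW[OF that]])
    show "\<Gamma> c a b = \<Gamma> c b a" for c a b by (rule sym)
    show "(\<Sum>c\<in>UNIV. \<Gamma> c a c z) = 0" if "z \<in> A" for a z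
      unfolding \<Gamma>_def by (rule trace_free) (simp add: \<alpha>_def)
    fix z and \<xi> u v w :: "'n option \<Rightarrow> 'k" assume z: "z \<in> A"
      and k: "(\<Sum>x\<in>UNIV. \<xi> x * u x) = 0" "(\<Sum>x\<in>UNIV. \<xi> x * v x) = 0" "(\<Sum>x\<in>UNIV. \<xi> x * w x) = 0"
    have "con4 (\<lambda>d a b c. curv \<Gamma> d a b c z) \<xi> u v w = 0"
    proof (rule con4_kernel[OF e(1) _ k])
      fix p i j l assume "norm (p - p0) < e"
      show "con4 (\<lambda>d a b c. curv \<Gamma> d a b c z) (xi p) (tv p i) (tv p j) (tv p l) = 0"
      proof (rule curvature_condition[OF sys ci N(1,3) sym _ _ jN[OF z \<open>norm (p - p0) < e\<close>]])
        show "F i j (jt (join z p)) = quad (\<lambda>c a b. \<Gamma> c a b z) p i j" if "jt (join z p) \<in> N" for z p i j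
          using F[of "fst (pt z)" "snd (pt z)" p i j] that by (simp add: jt_join)
        show "an (\<Gamma> c a b) z" if "jt (join z p) \<in> N" for z p c a b
          using NW[of "fst (pt z)" "snd (pt z)" p] that by (intro an\<Gamma>) (simp add: jt_join)
      qed
    qed
    then show "(\<Sum>d\<in>UNIV. \<xi> d * (\<Sum>a\<in>UNIV. u a * (\<Sum>b\<in>UNIV. v b * (\<Sum>c\<in>UNIV. w c * curv \<Gamma> d a b c z)))) = 0"
      by (simp add: con4_def)
  qed
  define z0 where "z0 = vc (x0, y0)"
  obtain \<Phi> \<theta> where \<Phi>: "\<And>i. an (\<lambda>z. \<Phi> z $ i) z0"
    "\<And>i j. pd j (\<lambda>z. \<Phi> z $ i) z0 = (if i = j then 1 else 0)"
    "\<forall>\<^sub>F z in nhds z0. \<forall>i a b. pd b (pd a (\<lambda>z. \<Phi> z $ i)) z =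
       (\<Sum>c\<in>UNIV. \<Gamma> c a b z * pd c (\<lambda>z. \<Phi> z $ i) z) - \<theta> b z * pd a (\<lambda>z. \<Phi> z $ i) z - \<theta> a z * pd b (\<lambda>z. \<Phi> z $ i) z"
    by (rule fp.flat_coordinates[OF A(2)[folded z0_def]]) (rule that)
  obtain S where S: "open S" "z0 \<in> S" "\<forall>z\<in>S. \<forall>i a b. pd b (pd a (\<lambda>z. \<Phi> z $ i)) z =
       (\<Sum>c\<in>UNIV. \<Gamma> c a b z * pd c (\<lambda>z. \<Phi> z $ i) z) - \<theta> b z * pd a (\<lambda>z. \<Phi> z $ i) z - \<theta> a z * pd b (\<lambda>z. \<Phi> z $ i) z"
    using \<Phi>(3) unfolding eventually_nhds by (elim exE conjE) (rule that)
  obtain W1 W1' \<Psi> where W1: "open W1" "z0 \<in> W1" "open W1'"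
    "\<And>v. v \<in> W1 \<Longrightarrow> \<Phi> v \<in> W1' \<and> \<Psi> (\<Phi> v) = v" "\<And>w. w \<in> W1' \<Longrightarrow> \<Psi> w \<in> W1 \<and> \<Phi> (\<Psi> w) = w"
    "\<And>v i. v \<in> W1 \<Longrightarrow> an (\<lambda>v. \<Phi> v $ i) v" "\<And>w i. w \<in> W1' \<Longrightarrow> an (\<lambda>w. \<Psi> w $ i) w"
    by (rule analytic_inverse[OF \<Phi>(1,2)]) (assumption | rule that)+
  have "coord_change \<Phi> \<Psi> W1 W1'"
    using W1 by unfold_locales blast+
  then interpret coord_change \<Phi> \<Psi> "W1 \<inter> S" "W1' \<inter> \<Psi> -` S"
    by (rule coord_change.restrict[OF _ S(1)])
  \<comment> \<open>The Jacobian satisfies \<open>star\<close> exactly for this representative of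
    the projective class; by \<open>quad_projective\<close> it induces the same system.\<close>
  define \<Gamma>' where "\<Gamma>' = (\<lambda>c a b z. \<Gamma> c a b z + (if c = a then - \<theta> b z else 0) + (if c = b then - \<theta> a z else 0))"
  show ?thesis
  proof (rule flat_equivalence[where \<Gamma> = \<Gamma>', OF _ N(1,3,2)])
    show "pd b (J A a) z = (\<Sum>c\<in>UNIV. \<Gamma>' c a b z * J A c z)" if z: "z \<in> W1 \<inter> S" for z A a b
    proof -
      have "(\<Sum>c\<in>UNIV. \<Gamma>' c a b z * J A c z) = (\<Sum>c\<in>UNIV. \<Gamma> c a b z * J A c z)
          + (\<Sum>c\<in>UNIV. (if c = a then 1 else 0) * (- \<theta> b z * J A c z)) + (\<Sum>c\<in>UNIV. (if c = b then 1 else 0) * (- \<theta> a z * J A c z))"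
        unfolding sum.distrib[symmetric] \<Gamma>'_def by (intro sum.cong) (auto simp: algebra_simps)
      also have "\<dots> = (\<Sum>c\<in>UNIV. \<Gamma> c a b z * J A c z) - \<theta> b z * J A a z - \<theta> a z * J A b z"
        unfolding sum_if_mult by simp
      finally show ?thesis using S(3) z by (simp add: J_def)
    qed
    show "F i j (x, y, p) = quad (\<lambda>c a b. \<Gamma>' c a b (vc (x, y))) p i j" if "(x, y, p) \<in> N" for x y p i j
      unfolding \<Gamma>'_def F[OF that] by (rule quad_projective[symmetric])
    show z0: "vc (x0, y0) \<in> W1 \<inter> S" using W1(2) S(2) by (simp add: z0_def)
    show "eta None (vc (x0, y0)) p0 \<noteq> 0"
      using eta_None_id[OF z0] \<Phi>(2) by (simp add: J_def z0_def)
  qed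
qed

lemma flat_iff_cubic:
  fixes F :: "('k::scalar_field, 'n::finite) system"
  assumes "CARD('n) \<ge> 2" "analytic_system F \<Omega>" "completely_integrable F \<Omega>"
  shows "locally_equivalent F \<Omega> flat_system UNIV s \<longleftrightarrow> has_cubic_form F \<Omega> s"
  using flat_imp_cubic[OF assms(2,3)] cubic_imp_flat[OF assms] by (cases s) blast

theorem theorem1p7:
  assumes "CARD('n::finite) \<ge> 2"
  shows "(\<forall>(F :: (real, 'n) system) \<Omega> s.
            s \<in> \<Omega> \<longrightarrow> analytic_system F \<Omega> \<longrightarrow> completely_integrable F \<Omega> \<longrightarrow>
            (locally_equivalent F \<Omega> flat_system UNIV s \<longleftrightarrow> has_cubic_form F \<Omega> s))
       \<and> (\<forall>(F :: (complex, 'n) system) \<Omega> s.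
            s \<in> \<Omega> \<longrightarrow> analytic_system F \<Omega> \<longrightarrow> completely_integrable F \<Omega> \<longrightarrow>
            (locally_equivalent F \<Omega> flat_system UNIV s \<longleftrightarrow> has_cubic_form F \<Omega> s))"
  by (intro conjI allI impI flat_iff_cubic assms)

end
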